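(* Let $T$ be a stable theory, or more generally a simple theory with the strong stable forking property. Let $M\models T$, let $A\subseteq M$, let $q\in S(M)$ be a complete type and let $p=q\upharpoonright A$. Then $q$ is a non-forking extension of $p$ if and only if $q$ is a non-þ-forking extension of $p$ (that is, $q$ does not fork over $A$ if and only if $q$ does not þ-fork over $A$).
   Context: $T$ is a complete first-order theory with monster model $\mathcal C$ (saturated, of large cardinality); all sets, tuples, types and models are small and live inside $\mathcal C$. One works in $\mathcal C^{eq}$. A family $\{\delta(x,a')\}_{a'\in S}$ is $k$-inconsistent if $\bigwedge_{i=1}^k\delta(x,a_i)$ is inconsistent for all pairwise distinct $a_1,\dots,a_k\in S$. A formula $\delta(x,a)$ strongly divides over $A$ if $tp(a/A)$ is non-algebraic and $\{\delta(x,a')\}_{a'\models tp(a/A)}$ is $k$-inconsistent for some $k\in\mathbb N$. It þ-divides over $A$ if there is a tuple $c$ such that $\delta(x,a)$ strongly divides over $Ac$. A formula þ-forks over $A$ if it implies a finite disjunction of formulas (with parameters) each of which þ-divides over $A$. A type þ-forks over $A$ if it contains a formula which þ-forks over $A$. Forking is in the usual sense of Shelah. A theory $T$ has the strong stable forking property if whenever $p$ is a type over some set $B\subseteq\mathcal C$ and $p$ forks over a set $A$ (not necessarily contained in $B$), this is witnessed by an instance of a stable formula in $p$, i.e. $p$ contains some $\phi(x,b)$ which forks over $A$ with $\phi(x,y)$ a stable formula. *)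

theory Defs
  imports Main
begin

unbundle cardinal_syntax

section \<open>Many-sorted first-order logic\<close>

text \<open>
  The theory under study is one-sorted (sort type \<open>unit\<close>), but its expansion by imaginaries is
  many-sorted, so syntax and semantics are set up once for an arbitrary set of sorts.
  Variables are de Bruijn indices into a context, i.e. the list of the sorts of the free
  variables; an assignment is a list of elements matching the context. A formula
  \<open>\<phi>(x, y)\<close> with \<open>x\<close> of sorts \<open>Xs\<close> and \<open>y\<close> of sorts \<open>Ys\<close> is a formula in the context
  \<open>Xs @ Ys\<close>, and it is evaluated at the concatenation \<open>a @ b\<close>.
\<close>

record ('s, 'f, 'r) signature =
  Sorts :: "'s set"
  Funs :: "'f set"
  fun_dom :: "'f \<Rightarrow> 's list"
  fun_cod :: "'f \<Rightarrow> 's"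
  Rels :: "'r set"
  rel_dom :: "'r \<Rightarrow> 's list"

definition is_signature :: "('s, 'f, 'r) signature \<Rightarrow> bool" where
  "is_signature L \<longleftrightarrow>
     (\<forall>f\<in>Funs L. set (fun_dom L f) \<subseteq> Sorts L \<and> fun_cod L f \<in> Sorts L) \<and>
     (\<forall>r\<in>Rels L. set (rel_dom L r) \<subseteq> Sorts L)"

datatype 'f tm = Var nat | App 'f "'f tm list"

datatype ('s, 'f, 'r) fm =
    Eql "'f tm" "'f tm"
  | Pred 'r "'f tm list"
  | Neg "('s, 'f, 'r) fm"
  | And "('s, 'f, 'r) fm" "('s, 'f, 'r) fm"
  | Exists 's "('s, 'f, 'r) fm"

inductive has_sort :: "('s, 'f, 'r) signature \<Rightarrow> 's list \<Rightarrow> 'f tm \<Rightarrow> 's \<Rightarrow> bool"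
  for L :: "('s, 'f, 'r) signature" and \<Gamma> :: "'s list" where
  Var: "i < length \<Gamma> \<Longrightarrow> has_sort L \<Gamma> (Var i) (\<Gamma> ! i)"
| App: "f \<in> Funs L \<Longrightarrow> list_all2 (has_sort L \<Gamma>) ts (fun_dom L f) \<Longrightarrow>
        has_sort L \<Gamma> (App f ts) (fun_cod L f)"

primrec wff :: "('s, 'f, 'r) signature \<Rightarrow> 's list \<Rightarrow> ('s, 'f, 'r) fm \<Rightarrow> bool" where
  "wff L \<Gamma> (Eql t u) \<longleftrightarrow> (\<exists>s\<in>Sorts L. has_sort L \<Gamma> t s \<and> has_sort L \<Gamma> u s)"
| "wff L \<Gamma> (Pred r ts) \<longleftrightarrow> r \<in> Rels L \<and> list_all2 (has_sort L \<Gamma>) ts (rel_dom L r)"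
| "wff L \<Gamma> (Neg \<phi>) \<longleftrightarrow> wff L \<Gamma> \<phi>"
| "wff L \<Gamma> (And \<phi> \<psi>) \<longleftrightarrow> wff L \<Gamma> \<phi> \<and> wff L \<Gamma> \<psi>"
| "wff L \<Gamma> (Exists s \<phi>) \<longleftrightarrow> s \<in> Sorts L \<and> wff L (s # \<Gamma>) \<phi>"

record ('s, 'f, 'r, 'a) struct =
  univ :: "'s \<Rightarrow> 'a set"
  fun_int :: "'f \<Rightarrow> 'a list \<Rightarrow> 'a"
  rel_int :: "'r \<Rightarrow> 'a list \<Rightarrow> bool"

definition tuples :: "('s, 'f, 'r, 'a) struct \<Rightarrow> 's list \<Rightarrow> 'a list set" where
  "tuples N \<Gamma> = {e. list_all2 (\<lambda>a s. a \<in> univ N s) e \<Gamma>}"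

definition points :: "('s, 'f, 'r) signature \<Rightarrow> ('s, 'f, 'r, 'a) struct \<Rightarrow> 'a set" where
  "points L N = (\<Union>s\<in>Sorts L. univ N s)"

definition is_structure :: "('s, 'f, 'r) signature \<Rightarrow> ('s, 'f, 'r, 'a) struct \<Rightarrow> bool" where
  "is_structure L N \<longleftrightarrow>
     (\<forall>s\<in>Sorts L. univ N s \<noteq> {}) \<and>
     (\<forall>s\<in>Sorts L. \<forall>t\<in>Sorts L. s \<noteq> t \<longrightarrow> univ N s \<inter> univ N t = {}) \<and>
     (\<forall>f\<in>Funs L. \<forall>e\<in>tuples N (fun_dom L f). fun_int N f e \<in> univ N (fun_cod L f))"

primrec val :: "('s, 'f, 'r, 'a) struct \<Rightarrow> 'a list \<Rightarrow> 'f tm \<Rightarrow> 'a" where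
  "val N e (Var i) = e ! i"
| "val N e (App f ts) = fun_int N f (map (val N e) ts)"

primrec sat :: "('s, 'f, 'r, 'a) struct \<Rightarrow> 'a list \<Rightarrow> ('s, 'f, 'r) fm \<Rightarrow> bool" where
  "sat N e (Eql t u) \<longleftrightarrow> val N e t = val N e u"
| "sat N e (Pred r ts) \<longleftrightarrow> rel_int N r (map (val N e) ts)"
| "sat N e (Neg \<phi>) \<longleftrightarrow> \<not> sat N e \<phi>"
| "sat N e (And \<phi> \<psi>) \<longleftrightarrow> sat N e \<phi> \<and> sat N e \<psi>"
| "sat N e (Exists s \<phi>) \<longleftrightarrow> (\<exists>a\<in>univ N s. sat N (a # e) \<phi>)"

text \<open>Theories are taken to be deductively closed, so that a complete theory decides every
  sentence by membership; consistency follows once there is a model.\<close>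

definition complete_theory :: "('s, 'f, 'r) signature \<Rightarrow> ('s, 'f, 'r) fm set \<Rightarrow> bool" where
  "complete_theory L T \<longleftrightarrow>
     (\<forall>\<phi>\<in>T. wff L [] \<phi>) \<and> (\<forall>\<phi>. wff L [] \<phi> \<longrightarrow> \<phi> \<in> T \<or> Neg \<phi> \<in> T)"

definition models ::
  "('s, 'f, 'r) signature \<Rightarrow> ('s, 'f, 'r, 'a) struct \<Rightarrow> ('s, 'f, 'r) fm set \<Rightarrow> bool" where
  "models L N T \<longleftrightarrow> is_structure L N \<and> (\<forall>\<phi>\<in>T. sat N [] \<phi>)"

definition substr :: "('s, 'f, 'r, 'a) struct \<Rightarrow> 'a set \<Rightarrow> ('s, 'f, 'r, 'a) struct" where
  "substr N M = N\<lparr>univ := \<lambda>s. univ N s \<inter> M\<rparr>"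

text \<open>Models of \<open>T\<close> living inside the monster model are its elementary substructures, given
  by their underlying sets.\<close>

definition elementary_submodel ::
  "('s, 'f, 'r) signature \<Rightarrow> ('s, 'f, 'r, 'a) struct \<Rightarrow> 'a set \<Rightarrow> bool" where
  "elementary_submodel L N M \<longleftrightarrow>
     M \<subseteq> points L N \<and> is_structure L (substr N M) \<and>
     (\<forall>\<Gamma> \<phi> e. set \<Gamma> \<subseteq> Sorts L \<and> wff L \<Gamma> \<phi> \<and> e \<in> tuples (substr N M) \<Gamma> \<longrightarrow>
        (sat (substr N M) e \<phi> \<longleftrightarrow> sat N e \<phi>))"


section \<open>Formulas with parameters and types\<close>

text \<open>An instance \<open>\<phi>(x, b)\<close> is the pair of \<open>\<phi>\<close> and the parameter tuple \<open>b\<close>; a (partial) type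
  is a set of instances.\<close>

type_synonym ('s, 'f, 'r, 'a) inst = "('s, 'f, 'r) fm \<times> 'a list"

definition insts :: "('s, 'f, 'r) signature \<Rightarrow> ('s, 'f, 'r, 'a) struct \<Rightarrow> 's list \<Rightarrow> 'a set
    \<Rightarrow> ('s, 'f, 'r, 'a) inst set" where
  "insts L N Xs A =
     {(\<phi>, b). set b \<subseteq> A \<and> (\<exists>Ys. set Ys \<subseteq> Sorts L \<and> b \<in> tuples N Ys \<and> wff L (Xs @ Ys) \<phi>)}"

definition sols :: "('s, 'f, 'r, 'a) struct \<Rightarrow> 's list \<Rightarrow> ('s, 'f, 'r, 'a) inst set
    \<Rightarrow> 'a list set" where
  "sols N Xs p = {a \<in> tuples N Xs. \<forall>(\<phi>, b)\<in>p. sat N (a @ b) \<phi>}"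

definition consistent :: "('s, 'f, 'r, 'a) struct \<Rightarrow> 's list \<Rightarrow> ('s, 'f, 'r, 'a) inst set
    \<Rightarrow> bool" where
  "consistent N Xs p \<longleftrightarrow> (\<forall>F. finite F \<and> F \<subseteq> p \<longrightarrow> sols N Xs F \<noteq> {})"

definition complete_types :: "('s, 'f, 'r) signature \<Rightarrow> ('s, 'f, 'r, 'a) struct \<Rightarrow> 's list
    \<Rightarrow> 'a set \<Rightarrow> ('s, 'f, 'r, 'a) inst set set" where
  "complete_types L N Xs A =
     {p. p \<subseteq> insts L N Xs A \<and> consistent N Xs p \<and>
         (\<forall>(\<phi>, b)\<in>insts L N Xs A. (\<phi>, b) \<in> p \<or> (Neg \<phi>, b) \<in> p)}"

definition restrict_type :: "('s, 'f, 'r, 'a) inst set \<Rightarrow> 'a set \<Rightarrow> ('s, 'f, 'r, 'a) inst set"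
  where "restrict_type q A = {(\<phi>, b) \<in> q. set b \<subseteq> A}"

definition tp :: "('s, 'f, 'r) signature \<Rightarrow> ('s, 'f, 'r, 'a) struct \<Rightarrow> 's list \<Rightarrow> 'a set
    \<Rightarrow> 'a list \<Rightarrow> ('s, 'f, 'r, 'a) inst set" where
  "tp L N Xs A a = {(\<phi>, b) \<in> insts L N Xs A. sat N (a @ b) \<phi>}"

definition algebraic :: "('s, 'f, 'r, 'a) struct \<Rightarrow> 's list \<Rightarrow> ('s, 'f, 'r, 'a) inst set
    \<Rightarrow> bool" where
  "algebraic N Xs p \<longleftrightarrow> (\<exists>\<phi>\<in>p. finite (sols N Xs {\<phi>}))"

definition small :: "('s, 'f, 'r) signature \<Rightarrow> ('s, 'f, 'r, 'a) struct \<Rightarrow> 'a set \<Rightarrow> bool" where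
  "small L N A \<longleftrightarrow> A \<subseteq> points L N \<and> |A| <o |points L N|"

definition saturated :: "('s, 'f, 'r) signature \<Rightarrow> ('s, 'f, 'r, 'a) struct \<Rightarrow> bool" where
  "saturated L N \<longleftrightarrow>
     (\<forall>A s. small L N A \<and> s \<in> Sorts L \<longrightarrow>
        (\<forall>p\<in>complete_types L N [s] A. sols N [s] p \<noteq> {}))"

text \<open>Of ``large cardinality'' only uncountability and being larger than the language is
  required.\<close>

definition monster_model ::
  "(unit, 'f, 'r) signature \<Rightarrow> (unit, 'f, 'r) fm set \<Rightarrow> (unit, 'f, 'r, 'a) struct \<Rightarrow> bool" where
  "monster_model L T C \<longleftrightarrow>
     is_signature L \<and> Sorts L = UNIV \<and> models L C T \<and> saturated L C \<and>
     |UNIV :: nat set| <o |points L C| \<and> |Funs L <+> Rels L| <o |points L C|"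


section \<open>Imaginaries\<close>

datatype ('f, 'r) eq_sort = Home | Quot nat "(unit, 'f, 'r) fm"

datatype ('f, 'r) eq_fun = Base 'f | Proj nat "(unit, 'f, 'r) fm"

datatype ('a, 'f, 'r) eq_elem = Real (the_real: 'a) | Imag nat "(unit, 'f, 'r) fm" "'a list set"

abbreviation home_ctx :: "nat \<Rightarrow> unit list" where
  "home_ctx n \<equiv> replicate n ()"

definition eq_class ::
  "(unit, 'f, 'r, 'a) struct \<Rightarrow> nat \<Rightarrow> (unit, 'f, 'r) fm \<Rightarrow> 'a list \<Rightarrow> 'a list set" where
  "eq_class C n E a = {b \<in> tuples C (home_ctx n). sat C (a @ b) E}"

definition definable_equiv ::
  "(unit, 'f, 'r) signature \<Rightarrow> (unit, 'f, 'r, 'a) struct \<Rightarrow> nat \<Rightarrow> (unit, 'f, 'r) fm \<Rightarrow> bool" where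
  "definable_equiv L C n E \<longleftrightarrow>
     wff L (home_ctx n @ home_ctx n) E \<and>
     equiv (tuples C (home_ctx n))
       {(a, b). a \<in> tuples C (home_ctx n) \<and> b \<in> tuples C (home_ctx n) \<and> sat C (a @ b) E}"

definition eq_sig :: "(unit, 'f, 'r) signature \<Rightarrow> (unit, 'f, 'r, 'a) struct
    \<Rightarrow> (('f, 'r) eq_sort, ('f, 'r) eq_fun, 'r) signature" where
  "eq_sig L C = \<lparr>
     Sorts = insert Home {Quot n E | n E. definable_equiv L C n E},
     Funs = Base ` Funs L \<union> {Proj n E | n E. definable_equiv L C n E},
     fun_dom = (\<lambda>f. case f of Base g \<Rightarrow> map (\<lambda>_. Home) (fun_dom L g)
                            | Proj n E \<Rightarrow> replicate n Home),
     fun_cod = (\<lambda>f. case f of Base g \<Rightarrow> Home | Proj n E \<Rightarrow> Quot n E),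
     Rels = Rels L,
     rel_dom = (\<lambda>r. map (\<lambda>_. Home) (rel_dom L r)) \<rparr>"

text \<open>The imaginaries of a given sort that have a representative in \<open>D\<close>; note that the
  equivalence classes are always taken in \<open>C\<close>.\<close>

definition eq_univ :: "(unit, 'f, 'r, 'a) struct \<Rightarrow> 'a set \<Rightarrow> ('f, 'r) eq_sort
    \<Rightarrow> ('a, 'f, 'r) eq_elem set" where
  "eq_univ C D s = (case s of
       Home \<Rightarrow> Real ` D
     | Quot n E \<Rightarrow> {Imag n E (eq_class C n E a) | a. a \<in> tuples C (home_ctx n) \<and> set a \<subseteq> D})"

definition eq_struct :: "(unit, 'f, 'r, 'a) struct
    \<Rightarrow> (('f, 'r) eq_sort, ('f, 'r) eq_fun, 'r, ('a, 'f, 'r) eq_elem) struct" where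
  "eq_struct C = \<lparr>
     univ = eq_univ C (univ C ()),
     fun_int = (\<lambda>f xs. case f of
         Base g \<Rightarrow> Real (fun_int C g (map the_real xs))
       | Proj n E \<Rightarrow> Imag n E (eq_class C n E (map the_real xs))),
     rel_int = (\<lambda>r xs. rel_int C r (map the_real xs)) \<rparr>"

text \<open>For an elementary submodel \<open>M\<close> of \<open>C\<close>, this is \<open>M\<close> together with its imaginaries.\<close>

definition eq_set :: "(unit, 'f, 'r) signature \<Rightarrow> (unit, 'f, 'r, 'a) struct \<Rightarrow> 'a set
    \<Rightarrow> ('a, 'f, 'r) eq_elem set" where
  "eq_set L C M = (\<Union>s\<in>Sorts (eq_sig L C). eq_univ C M s)"


section \<open>Stability and simplicity\<close>

definition stable_formula :: "('s, 'f, 'r, 'a) struct \<Rightarrow> 's list \<Rightarrow> 's list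
    \<Rightarrow> ('s, 'f, 'r) fm \<Rightarrow> bool" where
  "stable_formula N Xs Ys \<phi> \<longleftrightarrow>
     \<not> (\<exists>a b :: nat \<Rightarrow> 'a list.
          (\<forall>i. a i \<in> tuples N Xs) \<and> (\<forall>i. b i \<in> tuples N Ys) \<and>
          (\<forall>i j. sat N (a i @ b j) \<phi> \<longleftrightarrow> i < j))"

definition tree_property :: "('s, 'f, 'r, 'a) struct \<Rightarrow> 's list \<Rightarrow> 's list
    \<Rightarrow> ('s, 'f, 'r) fm \<Rightarrow> bool" where
  "tree_property N Xs Ys \<phi> \<longleftrightarrow>
     (\<exists>(b :: nat list \<Rightarrow> 'a list) k.
        (\<forall>\<sigma>. b \<sigma> \<in> tuples N Ys) \<and>
        (\<forall>\<sigma> I. finite I \<and> card I = k \<longrightarrow> sols N Xs {(\<phi>, b (\<sigma> @ [i])) | i. i \<in> I} = {}) \<and>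
        (\<forall>\<eta> :: nat \<Rightarrow> nat. consistent N Xs {(\<phi>, b (map \<eta> [0..<n])) | n. n \<ge> 1}))"

text \<open>Stability and simplicity of a complete theory are read off in its monster model.\<close>

definition stable_theory :: "('s, 'f, 'r) signature \<Rightarrow> ('s, 'f, 'r, 'a) struct \<Rightarrow> bool" where
  "stable_theory L N \<longleftrightarrow>
     (\<forall>Xs Ys \<phi>. set (Xs @ Ys) \<subseteq> Sorts L \<and> wff L (Xs @ Ys) \<phi> \<longrightarrow> stable_formula N Xs Ys \<phi>)"

definition simple_theory :: "('s, 'f, 'r) signature \<Rightarrow> ('s, 'f, 'r, 'a) struct \<Rightarrow> bool" where
  "simple_theory L N \<longleftrightarrow>
     (\<forall>Xs Ys \<phi>. set (Xs @ Ys) \<subseteq> Sorts L \<and> wff L (Xs @ Ys) \<phi> \<longrightarrow> \<not> tree_property N Xs Ys \<phi>)"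


section \<open>Forking\<close>

text \<open>Below \<open>N\<close> is meant to be saturated and parameter sets small, so that implication between
  formulas or types is inclusion of solution sets in \<open>N\<close>.\<close>

definition divides :: "('s, 'f, 'r) signature \<Rightarrow> ('s, 'f, 'r, 'a) struct \<Rightarrow> 's list \<Rightarrow> 'a set
    \<Rightarrow> ('s, 'f, 'r, 'a) inst \<Rightarrow> bool" where
  "divides L N Xs A = (\<lambda>(\<delta>, a).
     \<exists>Ys. set Ys \<subseteq> Sorts L \<and> a \<in> tuples N Ys \<and> wff L (Xs @ Ys) \<delta> \<and>
       (\<exists>(a' :: nat \<Rightarrow> 'a list) k.
          (\<forall>i. a' i \<in> sols N Ys (tp L N Ys A a)) \<and>
          (\<forall>I. finite I \<and> card I = k \<longrightarrow> sols N Xs {(\<delta>, a' i) | i. i \<in> I} = {})))"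

definition forks :: "('s, 'f, 'r) signature \<Rightarrow> ('s, 'f, 'r, 'a) struct \<Rightarrow> 's list \<Rightarrow> 'a set
    \<Rightarrow> ('s, 'f, 'r, 'a) inst set \<Rightarrow> bool" where
  "forks L N Xs A p \<longleftrightarrow>
     (\<exists>F. finite F \<and> (\<forall>\<psi>\<in>F. divides L N Xs A \<psi>) \<and>
        sols N Xs p \<subseteq> (\<Union>\<psi>\<in>F. sols N Xs {\<psi>}))"

definition strong_stable_forking ::
  "('s, 'f, 'r) signature \<Rightarrow> ('s, 'f, 'r, 'a) struct \<Rightarrow> bool" where
  "strong_stable_forking L N \<longleftrightarrow>
     (\<forall>Xs A B. \<forall>p\<in>complete_types L N Xs B.
        set Xs \<subseteq> Sorts L \<and> small L N A \<and> small L N B \<and> forks L N Xs A p \<longrightarrow>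
        (\<exists>(\<phi>, b)\<in>p. \<exists>Ys. set Ys \<subseteq> Sorts L \<and> b \<in> tuples N Ys \<and> wff L (Xs @ Ys) \<phi> \<and>
           stable_formula N Xs Ys \<phi> \<and> forks L N Xs A {(\<phi>, b)}))"

definition k_inconsistent :: "('s, 'f, 'r, 'a) struct \<Rightarrow> 's list \<Rightarrow> ('s, 'f, 'r) fm
    \<Rightarrow> 'a list set \<Rightarrow> nat \<Rightarrow> bool" where
  "k_inconsistent N Xs \<delta> S k \<longleftrightarrow>
     (\<forall>S'. finite S' \<and> S' \<subseteq> S \<and> card S' = k \<longrightarrow> sols N Xs {(\<delta>, a') | a'. a' \<in> S'} = {})"

definition strongly_divides :: "('s, 'f, 'r) signature \<Rightarrow> ('s, 'f, 'r, 'a) struct \<Rightarrow> 's list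
    \<Rightarrow> 'a set \<Rightarrow> ('s, 'f, 'r, 'a) inst \<Rightarrow> bool" where
  "strongly_divides L N Xs A = (\<lambda>(\<delta>, a).
     \<exists>Ys. set Ys \<subseteq> Sorts L \<and> a \<in> tuples N Ys \<and> wff L (Xs @ Ys) \<delta> \<and>
       \<not> algebraic N Ys (tp L N Ys A a) \<and>
       (\<exists>k. k_inconsistent N Xs \<delta> (sols N Ys (tp L N Ys A a)) k))"

definition thorn_divides :: "('s, 'f, 'r) signature \<Rightarrow> ('s, 'f, 'r, 'a) struct \<Rightarrow> 's list
    \<Rightarrow> 'a set \<Rightarrow> ('s, 'f, 'r, 'a) inst \<Rightarrow> bool" where
  "thorn_divides L N Xs A \<phi> \<longleftrightarrow>
     (\<exists>c. set c \<subseteq> points L N \<and> strongly_divides L N Xs (A \<union> set c) \<phi>)"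

definition thorn_forks_formula :: "('s, 'f, 'r) signature \<Rightarrow> ('s, 'f, 'r, 'a) struct
    \<Rightarrow> 's list \<Rightarrow> 'a set \<Rightarrow> ('s, 'f, 'r, 'a) inst \<Rightarrow> bool" where
  "thorn_forks_formula L N Xs A \<phi> \<longleftrightarrow>
     (\<exists>F. finite F \<and> (\<forall>\<psi>\<in>F. thorn_divides L N Xs A \<psi>) \<and>
        sols N Xs {\<phi>} \<subseteq> (\<Union>\<psi>\<in>F. sols N Xs {\<psi>}))"

definition thorn_forks :: "('s, 'f, 'r) signature \<Rightarrow> ('s, 'f, 'r, 'a) struct \<Rightarrow> 's list
    \<Rightarrow> 'a set \<Rightarrow> ('s, 'f, 'r, 'a) inst set \<Rightarrow> bool" where
  "thorn_forks L N Xs A p \<longleftrightarrow> (\<exists>\<phi>\<in>p. thorn_forks_formula L N Xs A \<phi>)"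

text \<open>Here \<open>A\<close> is the set over which the smaller type \<open>p\<close> is complete.\<close>

definition nonforking_extension :: "('s, 'f, 'r) signature \<Rightarrow> ('s, 'f, 'r, 'a) struct
    \<Rightarrow> 's list \<Rightarrow> 'a set \<Rightarrow> ('s, 'f, 'r, 'a) inst set \<Rightarrow> ('s, 'f, 'r, 'a) inst set \<Rightarrow> bool" where
  "nonforking_extension L N Xs A p q \<longleftrightarrow> p \<subseteq> q \<and> \<not> forks L N Xs A q"

definition non_thorn_forking_extension :: "('s, 'f, 'r) signature \<Rightarrow> ('s, 'f, 'r, 'a) struct
    \<Rightarrow> 's list \<Rightarrow> 'a set \<Rightarrow> ('s, 'f, 'r, 'a) inst set \<Rightarrow> ('s, 'f, 'r, 'a) inst set \<Rightarrow> bool" where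
  "non_thorn_forking_extension L N Xs A p q \<longleftrightarrow> p \<subseteq> q \<and> \<not> thorn_forks L N Xs A q"

end

theory Submission
  imports Defs "HOL-Library.Nat_Bijection"
begin

text \<open>
  If a formula strongly divides over \<open>Ac\<close>, the realizations of the non-algebraic type of its
  parameter already witness dividing over \<open>A\<close>; so thorn-forking implies forking.

  Conversely, suppose that \<open>q\<close> does not thorn-fork over \<open>A\<close>. Then \<open>q\<close> extends to a global type, here
  an ultrafilter \<open>U\<close>, without formulas thorn-dividing over \<open>A\<close>. For a stable formula \<open>\<phi>(x, y)\<close> the set
  of all \<open>b\<close> with \<open>\<phi>(x, b) \<in> U\<close> has a code \<open>e\<close>, and by a majority rule \<open>e\<close> is definable from
  realizations \<open>a\<^sub>0, a\<^sub>1, \<dots>\<close> of \<open>U\<close>, each over \<open>A\<close>, \<open>e\<close> and the previous ones. If \<open>e\<close> were not algebraic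
  over \<open>A\<close>, there would be a \<open>j\<close> such that \<open>e\<close> becomes algebraic over \<open>A a\<^sub>0 \<dots> a\<^sub>j\<close> but not before, and a
  formula in \<open>x\<close>, \<open>e\<close> witnessing that \<open>e\<close> is algebraic over \<open>A a\<^sub>0 \<dots> a\<^sub>j\<close> would strongly divide over
  \<open>A a\<^sub>0 \<dots> a\<^bsub>j-1\<^esub>\<close> and belong to \<open>U\<close>. So \<open>e\<close> is algebraic over \<open>A\<close>, that is, has finitely many conjugates.

  If \<open>T\<close> is stable and \<open>q\<close> forks over \<open>A\<close>, some \<open>\<delta>(x, d) \<in> U\<close> divides over \<open>A\<close>; by the pigeonhole
  principle infinitely many of the witnessing conjugates of \<open>d\<close> lie in the set coded by one conjugate
  of \<open>e\<close>, so they are consistent. If \<open>T\<close> is simple, take \<open>\<phi>(x, b) \<in> q\<close> stable and forking over \<open>A\<close>. The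
  same pigeonhole argument shows that the rank counting the height of trees of the dividing formulas
  would increase on the positive \<open>\<phi>\<close>-part of \<open>U\<close>, whereas it is finite by the lack of the tree property.
\<close>

section \<open>Renaming variables\<close>

text \<open>No automorphism of the monster model is used: conjugacy over \<open>A\<close> is
  expressed by formulas in types over \<open>A\<close>, so every property that a conjugate of
  \<open>e\<close> is to inherit has to be shown definable. This is why named blocks of variables,
  definable predicates and the translation of formulas about imaginaries take up so much room. The
  global type has too many parameters to be realized as a whole. An ultrafilter on tuples restricts
  to a complete type over every small set, and these restrictions are realized. Finitely many
  realizations define \<open>e\<close> because compactness bounds the ladders of a stable formula by
  some \<open>m\<close>, and then \<open>2 * m + 2\<close> realizations suffice; only so is there a
  last step before \<open>e\<close> becomes algebraic. In the simple case the dividing formulas need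
  not be stable, so their part of \<open>U\<close> has no code. Only the part of the stable \<phi>
  is coded, and the contradiction must come from a rank. Its trees have finite branching and finite
  height, so that being wide is a first-order condition that passes to conjugates; quantifying over
  all branching numbers replaces infinite branching.\<close>

primrec ren_tm :: "(nat \<Rightarrow> nat) \<Rightarrow> 'f tm \<Rightarrow> 'f tm" where
  "ren_tm f (Var i) = Var (f i)"
| "ren_tm f (App g ts) = App g (map (ren_tm f) ts)"

primrec ren :: "('s, 'f, 'r) fm \<Rightarrow> (nat \<Rightarrow> nat) \<Rightarrow> ('s, 'f, 'r) fm" where
  "ren (Eql t u) f = Eql (ren_tm f t) (ren_tm f u)"
| "ren (Pred r ts) f = Pred r (map (ren_tm f) ts)"
| "ren (Neg \<phi>) f = Neg (ren \<phi> f)"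
| "ren (And \<phi> \<psi>) f = And (ren \<phi> f) (ren \<psi> f)"
| "ren (Exists s \<phi>) f = Exists s (ren \<phi> (case_nat 0 (\<lambda>i. Suc (f i))))"

lemma has_sort_ren:
  assumes "has_sort L \<Gamma> t s" and "\<And>i. i < length \<Gamma> \<Longrightarrow> f i < length \<Delta> \<and> \<Delta> ! f i = \<Gamma> ! i"
  shows "has_sort L \<Delta> (ren_tm f t) s"
  using assms(1)
proof (induction rule: has_sort.induct)
  case (Var i)
  then show ?case using assms(2)[OF Var] has_sort.Var[of "f i" \<Delta> L] by simp
next
  case (App g ts)
  then have "list_all2 (has_sort L \<Delta>) (map (ren_tm f) ts) (fun_dom L g)"
    by (simp add: list_all2_conv_all_nth)
  with App show ?case by (simp add: has_sort.App)
qed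

lemma val_ren:
  assumes "has_sort L \<Gamma> t s" and "\<And>i. i < length \<Gamma> \<Longrightarrow> e' ! f i = e ! i"
  shows "val N e' (ren_tm f t) = val N e t"
  using assms(1)
proof (induction rule: has_sort.induct)
  case (App g ts)
  then have "map (val N e') (map (ren_tm f) ts) = map (val N e) ts"
    by (auto simp: list_all2_conv_all_nth in_set_conv_nth)
  then show ?case by (simp del: map_map)
qed (use assms(2) in auto)

lemma wff_ren:
  assumes "wff L \<Gamma> \<phi>" and "\<And>i. i < length \<Gamma> \<Longrightarrow> f i < length \<Delta> \<and> \<Delta> ! f i = \<Gamma> ! i"
  shows "wff L \<Delta> (ren \<phi> f)"
  using assms
proof (induction \<phi> arbitrary: \<Gamma> \<Delta> f)
  case (Eql t u)
  then show ?case using has_sort_ren[of L \<Gamma> _ _ f \<Delta>] by simp blast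
next
  case (Pred r ts)
  then show ?case using has_sort_ren[of L \<Gamma> _ _ f \<Delta>] by (auto simp: list_all2_conv_all_nth)
next
  case (Exists s \<phi>)
  have "wff L (s # \<Delta>) (ren \<phi> (case_nat 0 (\<lambda>i. Suc (f i))))"
    by (rule Exists.IH[of "s # \<Gamma>"]) (use Exists.prems in \<open>auto split: nat.split\<close>)
  then show ?case using Exists.prems by simp
qed auto

lemma sat_ren:
  assumes "wff L \<Gamma> \<phi>" and "\<And>i. i < length \<Gamma> \<Longrightarrow> e' ! f i = e ! i"
  shows "sat N e' (ren \<phi> f) \<longleftrightarrow> sat N e \<phi>"
  using assms
proof (induction \<phi> arbitrary: \<Gamma> e e' f)
  case (Eql t u)
  then show ?case using val_ren[of L \<Gamma> _ _ e' f e N] by auto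
next
  case (Pred r ts)
  then have "val N e' (ren_tm f (ts ! i)) = val N e (ts ! i)" if "i < length ts" for i
    using that by (auto simp: list_all2_conv_all_nth intro!: val_ren[of L \<Gamma>])
  then have "map (val N e') (map (ren_tm f) ts) = map (val N e) ts"
    by (simp add: list_eq_iff_nth_eq)
  then show ?case by (simp del: map_map)
next
  case (And \<phi> \<psi>)
  then show ?case using And.IH(1)[of \<Gamma> e' f e] And.IH(2)[of \<Gamma> e' f e] by auto
next
  case (Neg \<phi>)
  then show ?case using Neg.IH[of \<Gamma> e' f e] by auto
next
  case (Exists s \<phi>)
  have "sat N (a # e') (ren \<phi> (case_nat 0 (\<lambda>i. Suc (f i)))) \<longleftrightarrow> sat N (a # e) \<phi>" for a
    by (rule Exists.IH[of "s # \<Gamma>"]) (use Exists.prems in \<open>auto split: nat.split\<close>)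
  then show ?case by simp
qed

lemma rename_fm:
  assumes "wff L \<Gamma> \<phi>" and "set is \<subseteq> {..<length \<Delta>}" and "map ((!) \<Delta>) is = \<Gamma>"
  obtains \<phi>' where "wff L \<Delta> \<phi>'" and "\<And>N e. sat N e \<phi>' \<longleftrightarrow> sat N (map ((!) e) is) \<phi>"
proof
  have len: "length \<Gamma> = length is" using assms(3) by auto
  have nth: "\<Delta> ! (is ! i) = \<Gamma> ! i" if "i < length is" for i
    using assms(3) that by (metis nth_map)
  show "wff L \<Delta> (ren \<phi> ((!) is))"
    by (rule wff_ren[OF assms(1)]) (use nth len assms(2) in \<open>auto simp: subset_iff\<close>)
  show "sat N e (ren \<phi> ((!) is)) \<longleftrightarrow> sat N (map ((!) e) is) \<phi>" for N e
    by (rule sat_ren[OF assms(1)]) (use len in auto)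
qed

section \<open>Tuples\<close>

lemma tuples_length: "e \<in> tuples N \<Gamma> \<Longrightarrow> length e = length \<Gamma>"
  by (auto simp: tuples_def list_all2_lengthD)

lemma tuples_Nil [simp]: "tuples N [] = {[]}"
  by (auto simp: tuples_def)

lemma tuples_Cons [simp]: "a # e \<in> tuples N (s # \<Gamma>) \<longleftrightarrow> a \<in> univ N s \<and> e \<in> tuples N \<Gamma>"
  by (auto simp: tuples_def)

lemma tuples_append_iff: "length a = length \<Gamma> \<Longrightarrow>
    a @ b \<in> tuples N (\<Gamma> @ \<Delta>) \<longleftrightarrow> a \<in> tuples N \<Gamma> \<and> b \<in> tuples N \<Delta>"
  by (auto simp: tuples_def list_all2_append)

lemma tuples_appendI: "a \<in> tuples N \<Gamma> \<Longrightarrow> b \<in> tuples N \<Delta> \<Longrightarrow> a @ b \<in> tuples N (\<Gamma> @ \<Delta>)"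
  by (simp add: tuples_append_iff tuples_length)

lemma tuples_append_split:
  assumes "c \<in> tuples N (\<Gamma> @ \<Delta>)"
  obtains a b where "c = a @ b" and "a \<in> tuples N \<Gamma>" and "b \<in> tuples N \<Delta>"
  using assms by (auto simp: tuples_def list_all2_append2)

lemma tuples_Cons_split:
  assumes "c \<in> tuples N (s # \<Delta>)"
  obtains a b where "c = a # b" and "a \<in> univ N s" and "b \<in> tuples N \<Delta>"
  using assms by (auto simp: tuples_def list_all2_Cons2)

lemma tuples_singleton [simp]: "c \<in> tuples N [s] \<longleftrightarrow> (\<exists>a\<in>univ N s. c = [a])"
  by (auto simp: tuples_def list_all2_Cons2)

lemma tuples_concat:
  "(\<And>i. i \<in> set vs \<Longrightarrow> g i \<in> tuples N (\<Gamma> i)) \<Longrightarrow> concat (map g vs) \<in> tuples N (concat (map \<Gamma> vs))"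
  by (induction vs) (auto intro: tuples_appendI)

lemma tuples_concat_split:
  assumes "distinct vs" and "e \<in> tuples N (concat (map \<Gamma> vs))"
  shows "\<exists>h. e = concat (map h vs) \<and> (\<forall>i\<in>set vs. h i \<in> tuples N (\<Gamma> i))"
  using assms
proof (induction vs arbitrary: e)
  case (Cons v vs)
  then obtain a b where e: "e = a @ b" "a \<in> tuples N (\<Gamma> v)" "b \<in> tuples N (concat (map \<Gamma> vs))"
    by (auto elim: tuples_append_split)
  with Cons obtain h where h: "b = concat (map h vs)" "\<forall>i\<in>set vs. h i \<in> tuples N (\<Gamma> i)"
    by auto
  define h' where "h' = h(v := a)"
  have "map h' vs = map h vs" using Cons.prems by (simp add: h'_def)
  moreover have "h' v = a" by (simp add: h'_def)
  ultimately have "e = concat (map h' (v # vs))" using e h by (simp del: map_eq_conv)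
  moreover have "\<forall>i\<in>set (v # vs). h' i \<in> tuples N (\<Gamma> i)" using e h by (simp add: h'_def)
  ultimately show ?case by blast
qed simp

lemma tuples_points: "set \<Gamma> \<subseteq> Sorts L \<Longrightarrow> e \<in> tuples N \<Gamma> \<Longrightarrow> set e \<subseteq> points L N"
proof (induction \<Gamma> arbitrary: e)
  case (Cons s \<Gamma>)
  from Cons.prems(2) obtain a e' where "e = a # e'" "a \<in> univ N s" "e' \<in> tuples N \<Gamma>"
    by (rule tuples_Cons_split)
  with Cons show ?case by (auto simp: points_def)
qed simp

lemma tuples_of_points: "set e \<subseteq> points L N \<Longrightarrow> \<exists>\<Gamma>. set \<Gamma> \<subseteq> Sorts L \<and> e \<in> tuples N \<Gamma>"
proof (induction e)
  case (Cons a e)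
  then obtain \<Gamma> s where "set \<Gamma> \<subseteq> Sorts L" "e \<in> tuples N \<Gamma>" "s \<in> Sorts L" "a \<in> univ N s"
    by (auto simp: points_def)
  then show ?case by (intro exI[of _ "s # \<Gamma>"]) simp
qed (auto intro: exI[of _ "[]"])

lemma map_nth_segment: "length b = n \<Longrightarrow> length a = m \<Longrightarrow> map ((!) (a @ b @ c)) [m..<m + n] = b"
  by (auto intro!: nth_equalityI simp: nth_append)

text \<open>The index list \<open>is\<close> is tied to the block lengths \<open>l\<close> only, so
  one list can rearrange contexts, whose entries are sorts, and assignments, whose entries are
  elements.\<close>

definition positions :: "('i \<Rightarrow> nat) \<Rightarrow> 'i list \<Rightarrow> nat list \<Rightarrow> 'i list \<Rightarrow> ('i \<Rightarrow> 'b list) \<Rightarrow> bool" where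
  "positions l ws is vs h \<longleftrightarrow> (\<forall>i. length (h i) = l i) \<longrightarrow>
    set is \<subseteq> {..<length (concat (map h ws))} \<and> map ((!) (concat (map h ws))) is = concat (map h vs)"

lemma positions_Cons:
  assumes "positions l (us @ v # us') is vs h"
  shows "positions l (us @ v # us') ([sum_list (map l us)..<sum_list (map l us) + l v] @ is) (v # vs) h"
  unfolding positions_def
proof (rule impI)
  assume h: "\<forall>i. length (h i) = l i"
  let ?m = "sum_list (map l us)" and ?ws = "us @ v # us'"
  have m: "length (concat (map h us)) = ?m" using h by (simp add: length_concat comp_def)
  have "map ((!) (concat (map h ?ws))) [?m..<?m + l v] = h v"
    using map_nth_segment[OF _ m, of "h v" "l v" "concat (map h us')"] h by simp
  moreover have "?m + l v \<le> length (concat (map h ?ws))" using m h by simp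
  ultimately show "set ([?m..<?m + l v] @ is) \<subseteq> {..<length (concat (map h ?ws))} \<and>
      map ((!) (concat (map h ?ws))) ([?m..<?m + l v] @ is) = concat (map h (v # vs))"
    using assms h by (auto simp: positions_def)
qed

text \<open>Two entry types occur because \<open>is\<close> is bound existentially: the list
  obtained has to serve sorts and elements at the same time, and a fact about a bound list cannot be
  polymorphic.\<close>

lemma positions_exist:
  assumes "set vs \<subseteq> set ws"
  shows "\<exists>is. (\<forall>h::'i \<Rightarrow> 'b list. positions l ws is vs h) \<and> (\<forall>h::'i \<Rightarrow> 'c list. positions l ws is vs h)"
  using assms
proof (induction vs)
  case Nil
  then show ?case by (intro exI[of _ "[]"]) (auto simp: positions_def)
next
  case (Cons v vs)
  then obtain us us' where ws: "ws = us @ v # us'" by (meson list.set_intros(1) split_list subset_code(1))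
  from Cons obtain "is" where "\<forall>h::'i \<Rightarrow> 'b list. positions l ws is vs h"
    "\<forall>h::'i \<Rightarrow> 'c list. positions l ws is vs h" by auto
  then show ?case unfolding ws by (blast intro: positions_Cons)
qed


section \<open>Definable predicates\<close>

text \<open>The head of the list is bound innermost because it is de Bruijn index 0 of the context
  \<open>Ss @ \<Gamma>\<close>.\<close>

primrec exs :: "'s list \<Rightarrow> ('s, 'f, 'r) fm \<Rightarrow> ('s, 'f, 'r) fm" where
  "exs [] \<phi> = \<phi>"
| "exs (s # Ss) \<phi> = exs Ss (Exists s \<phi>)"

lemma wff_exs: "wff L (Ss @ \<Gamma>) \<phi> \<Longrightarrow> set Ss \<subseteq> Sorts L \<Longrightarrow> wff L \<Gamma> (exs Ss \<phi>)"
  by (induction Ss arbitrary: \<phi>) auto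

lemma sat_exs: "sat N e (exs Ss \<phi>) \<longleftrightarrow> (\<exists>a\<in>tuples N Ss. sat N (a @ e) \<phi>)"
proof (induction Ss arbitrary: \<phi>)
  case (Cons s Ss)
  have "(\<exists>a\<in>tuples N Ss. \<exists>x\<in>univ N s. sat N (x # a @ e) \<phi>) \<longleftrightarrow>
      (\<exists>a\<in>tuples N (s # Ss). sat N (a @ e) \<phi>)"
    by (metis append_Cons tuples_Cons tuples_Cons_split)
  then show ?case by (simp add: Cons.IH)
qed simp

text \<open>Empty blocks out of range turn a finite list of blocks into a total environment without
  contributing anything to a concatenation.\<close>

definition blk :: "'b list list \<Rightarrow> nat \<Rightarrow> 'b list" where
  "blk l i = (if i < length l then l ! i else [])"

lemma blk_Cons [simp]: "blk (x # l) 0 = x" "blk (x # l) (Suc i) = blk l i"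
  by (auto simp: blk_def)

lemma blk_numeral [simp]: "blk (x # l) (numeral k) = blk l (pred_numeral k)"
  by (simp add: numeral_eq_Suc)

lemma blk_1 [simp]: "blk (x # l) 1 = blk l 0"
  by (simp add: blk_def)

lemma blk_Nil [simp]: "blk [] i = []"
  by (simp add: blk_def)

lemma concat_blk: "concat (map (blk l) [0..<length l]) = concat l"
  by (rule arg_cong[of _ _ concat]) (auto simp: blk_def intro: nth_equalityI)

locale mstruct =
  fixes L :: "('s, 'f, 'r) signature" and N :: "('s, 'f, 'r, 'a) struct"
  assumes univ_nonempty: "s \<in> Sorts L \<Longrightarrow> univ N s \<noteq> {}"
    and univ_disjoint: "s \<in> Sorts L \<Longrightarrow> t \<in> Sorts L \<Longrightarrow> a \<in> univ N s \<Longrightarrow> a \<in> univ N t \<Longrightarrow> s = t"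
    and Sorts_nonempty: "Sorts L \<noteq> {}"
begin

lemma tuples_nonempty: "set \<Gamma> \<subseteq> Sorts L \<Longrightarrow> \<exists>e. e \<in> tuples N \<Gamma>"
proof (induction \<Gamma>)
  case (Cons s \<Gamma>)
  then obtain e a where "e \<in> tuples N \<Gamma>" "a \<in> univ N s" using univ_nonempty by fastforce
  then show ?case by (intro exI[of _ "a # e"]) simp
qed auto

definition envs :: "('i \<Rightarrow> 's list) \<Rightarrow> ('i \<Rightarrow> 'a list) set" where
  "envs \<Gamma> = {g. \<forall>i. g i \<in> tuples N (\<Gamma> i)}"

lemma rename_blocks:
  assumes "wff L (concat (map \<Gamma> vs)) \<phi>" and "set vs \<subseteq> set ws"
  obtains \<phi>' where "wff L (concat (map \<Gamma> ws)) \<phi>'"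
    and "\<And>g. g \<in> envs \<Gamma> \<Longrightarrow> sat N (concat (map g ws)) \<phi>' \<longleftrightarrow> sat N (concat (map g vs)) \<phi>"
proof -
  obtain "is" where is1: "positions (\<lambda>i. length (\<Gamma> i)) ws is vs \<Gamma>"
    and is2: "\<And>g::_ \<Rightarrow> 'a list. positions (\<lambda>i. length (\<Gamma> i)) ws is vs g"
    using positions_exist[OF assms(2)] by blast
  obtain \<phi>' where \<phi>': "wff L (concat (map \<Gamma> ws)) \<phi>'"
    "\<And>e. sat N e \<phi>' \<longleftrightarrow> sat N (map ((!) e) is) \<phi>"
    using rename_fm[OF assms(1), of "is" "concat (map \<Gamma> ws)"] is1 unfolding positions_def by metis
  show thesis
  proof (rule that[OF \<phi>'(1)])
    fix g assume "g \<in> envs \<Gamma>"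
    then have "\<forall>i. length (g i) = length (\<Gamma> i)" by (auto simp: envs_def intro: tuples_length)
    then show "sat N (concat (map g ws)) \<phi>' \<longleftrightarrow> sat N (concat (map g vs)) \<phi>"
      using is2[of g] \<phi>'(2) by (simp add: positions_def)
  qed
qed

text \<open>Predicates of environments assigning a tuple \<open>g i\<close> of sorts \<open>\<Gamma> i\<close> to every block \<open>i\<close>:
  named blocks of variables replace de Bruijn indices from here on.\<close>

definition defn :: "('i \<Rightarrow> 's list) \<Rightarrow> (('i \<Rightarrow> 'a list) \<Rightarrow> bool) \<Rightarrow> bool" where
  "defn \<Gamma> P \<longleftrightarrow> (\<exists>vs \<phi>. wff L (concat (map \<Gamma> vs)) \<phi> \<and>
     (\<forall>g\<in>envs \<Gamma>. P g \<longleftrightarrow> sat N (concat (map g vs)) \<phi>))"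

lemma defn_sat: "wff L (concat (map \<Gamma> vs)) \<phi> \<Longrightarrow> defn \<Gamma> (\<lambda>g. sat N (concat (map g vs)) \<phi>)"
  unfolding defn_def by blast

lemma defn_sat1: "wff L (\<Gamma> i) \<phi> \<Longrightarrow> defn \<Gamma> (\<lambda>g. sat N (g i) \<phi>)"
  using defn_sat[of \<Gamma> "[i]"] by simp

lemma defn_sat2: "wff L (\<Gamma> i @ \<Gamma> j) \<phi> \<Longrightarrow> defn \<Gamma> (\<lambda>g. sat N (g i @ g j) \<phi>)"
  using defn_sat[of \<Gamma> "[i, j]"] by simp

lemma defn_sat3: "wff L (\<Gamma> i @ \<Gamma> j @ \<Gamma> k) \<phi> \<Longrightarrow> defn \<Gamma> (\<lambda>g. sat N (g i @ g j @ g k) \<phi>)"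
  using defn_sat[of \<Gamma> "[i, j, k]"] by simp

lemma defn_eqI: "defn \<Gamma> P \<Longrightarrow> (\<And>g. g \<in> envs \<Gamma> \<Longrightarrow> P g \<longleftrightarrow> Q g) \<Longrightarrow> defn \<Gamma> Q"
  unfolding defn_def by auto

lemma defn_not: "defn \<Gamma> P \<Longrightarrow> defn \<Gamma> (\<lambda>g. \<not> P g)"
  unfolding defn_def by (metis wff.simps(3) sat.simps(3))

lemma defn_conj:
  assumes "defn \<Gamma> P" and "defn \<Gamma> Q"
  shows "defn \<Gamma> (\<lambda>g. P g \<and> Q g)"
proof -
  obtain vs \<phi> ws \<psi> where P: "wff L (concat (map \<Gamma> vs)) \<phi>"
      "\<And>g. g \<in> envs \<Gamma> \<Longrightarrow> P g \<longleftrightarrow> sat N (concat (map g vs)) \<phi>"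
    and Q: "wff L (concat (map \<Gamma> ws)) \<psi>"
      "\<And>g. g \<in> envs \<Gamma> \<Longrightarrow> Q g \<longleftrightarrow> sat N (concat (map g ws)) \<psi>"
    using assms unfolding defn_def by blast
  obtain \<phi>' where \<phi>': "wff L (concat (map \<Gamma> (vs @ ws))) \<phi>'"
    "\<And>g. g \<in> envs \<Gamma> \<Longrightarrow> sat N (concat (map g (vs @ ws))) \<phi>' \<longleftrightarrow> sat N (concat (map g vs)) \<phi>"
    using rename_blocks[OF P(1), of "vs @ ws"] by auto
  obtain \<psi>' where \<psi>': "wff L (concat (map \<Gamma> (vs @ ws))) \<psi>'"
    "\<And>g. g \<in> envs \<Gamma> \<Longrightarrow> sat N (concat (map g (vs @ ws))) \<psi>' \<longleftrightarrow> sat N (concat (map g ws)) \<psi>"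
    using rename_blocks[OF Q(1), of "vs @ ws"] by auto
  show ?thesis unfolding defn_def
    by (rule exI[of _ "vs @ ws"], rule exI[of _ "And \<phi>' \<psi>'"])
      (use \<phi>' \<psi>' P(2) Q(2) in \<open>simp del: map_append concat_append\<close>)
qed

lemma defn_disj:
  assumes "defn \<Gamma> P" and "defn \<Gamma> Q"
  shows "defn \<Gamma> (\<lambda>g. P g \<or> Q g)"
proof -
  have "defn \<Gamma> (\<lambda>g. \<not> (\<not> P g \<and> \<not> Q g))" by (intro defn_not defn_conj assms)
  then show ?thesis by simp
qed

lemma defn_imp:
  assumes "defn \<Gamma> P" and "defn \<Gamma> Q"
  shows "defn \<Gamma> (\<lambda>g. P g \<longrightarrow> Q g)"
  unfolding imp_conv_disj by (intro defn_not defn_disj assms)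

lemma defn_iff: "defn \<Gamma> P \<Longrightarrow> defn \<Gamma> Q \<Longrightarrow> defn \<Gamma> (\<lambda>g. P g \<longleftrightarrow> Q g)"
  unfolding iff_conv_conj_imp by (intro defn_conj defn_imp) assumption+

text \<open>The syntax has no truth constant, so \<exists>x. x = x in some sort takes its
  place.\<close>

lemma defn_const: "defn \<Gamma> (\<lambda>g. b)"
proof -
  obtain s where s: "s \<in> Sorts L" using Sorts_nonempty by blast
  then have "has_sort L [s] (Var 0) s" using has_sort.Var[of 0 "[s]" L] by simp
  then have "wff L [] (Exists s (Eql (Var 0) (Var 0)))" using s by auto
  from defn_sat[of \<Gamma> "[]", simplified, OF this] have "defn \<Gamma> (\<lambda>g. True)"
    using univ_nonempty[OF s] by (simp add: ex_in_conv)
  then show ?thesis using defn_not[of \<Gamma> "\<lambda>g. True"] by (cases b) auto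
qed

lemma defn_ball:
  assumes "finite I" and "\<And>i. i \<in> I \<Longrightarrow> defn \<Gamma> (\<lambda>g. P g i)"
  shows "defn \<Gamma> (\<lambda>g. \<forall>i\<in>I. P g i)"
  using assms
proof (induction I rule: finite_induct)
  case (insert i I)
  then have "defn \<Gamma> (\<lambda>g. P g i \<and> (\<forall>i\<in>I. P g i))" by (intro defn_conj) auto
  then show ?case by simp
qed (simp add: defn_const)

lemma defn_bex:
  assumes "finite I" and "\<And>i. i \<in> I \<Longrightarrow> defn \<Gamma> (\<lambda>g. P g i)"
  shows "defn \<Gamma> (\<lambda>g. \<exists>i\<in>I. P g i)"
  using defn_not[OF defn_ball[OF assms(1), of \<Gamma> "\<lambda>g i. \<not> P g i"]] assms(2) by (simp add: defn_not)

lemma defn_eq: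
  assumes "\<Gamma> i = \<Gamma> j" and "set (\<Gamma> i) \<subseteq> Sorts L"
  shows "defn \<Gamma> (\<lambda>g. g i = g j)"
proof -
  let ?n = "length (\<Gamma> i)"
  have "defn \<Gamma> (\<lambda>g. \<forall>p\<in>{..<?n}. sat N (g i @ g j) (Eql (Var p) (Var (?n + p))))"
  proof (intro defn_ball defn_sat2)
    fix p assume "p \<in> {..<?n}"
    then show "wff L (\<Gamma> i @ \<Gamma> j) (Eql (Var p) (Var (?n + p)))"
      using assms has_sort.Var[of p "\<Gamma> i @ \<Gamma> j" L] has_sort.Var[of "?n + p" "\<Gamma> i @ \<Gamma> j" L]
      by (auto simp: nth_append intro!: bexI[of _ "\<Gamma> i ! p"])
  qed simp
  moreover have "(\<forall>p\<in>{..<?n}. sat N (g i @ g j) (Eql (Var p) (Var (?n + p)))) \<longleftrightarrow> g i = g j"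
    if "g \<in> envs \<Gamma>" for g
  proof -
    have "length (g m) = length (\<Gamma> m)" for m using that by (auto simp: envs_def intro: tuples_length)
    then have "length (g i) = ?n" "length (g j) = ?n" using assms(1) by auto
    then show ?thesis by (auto simp: nth_append list_eq_iff_nth_eq)
  qed
  ultimately show ?thesis by (rule defn_eqI)
qed

text \<open>The common source of the quantifier rules. The two contexts agree only on the kept
  blocks \<open>V\<close>, since a quantified block may have other sorts outside the quantifier. A
  formula mentions finitely many blocks, so a finite quantifier prefix suffices even if the
  complement of \<open>V\<close> is infinite.\<close>

lemma defn_exists_blocks:
  assumes "defn \<Gamma>' P" and agree: "\<And>i. i \<in> V \<Longrightarrow> \<Gamma> i = \<Gamma>' i"
    and sorts: "\<And>i. i \<notin> V \<Longrightarrow> set (\<Gamma>' i) \<subseteq> Sorts L"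
  shows "defn \<Gamma> (\<lambda>g. \<exists>g'\<in>envs \<Gamma>'. (\<forall>i\<in>V. g' i = g i) \<and> P g')"
proof -
  obtain vs \<phi> where P: "wff L (concat (map \<Gamma>' vs)) \<phi>"
      "\<And>g. g \<in> envs \<Gamma>' \<Longrightarrow> P g \<longleftrightarrow> sat N (concat (map g vs)) \<phi>"
    using assms(1) unfolding defn_def by blast
  \<comment> \<open>\<open>remdups\<close> keeps each quantified block once, so that a tuple of
    witnesses splits into one value per block.\<close>
  define us where "us = filter (\<lambda>i. i \<notin> V) (remdups vs)"
  define ws where "ws = filter (\<lambda>i. i \<in> V) vs"
  have "set vs \<subseteq> set (us @ ws)" by (auto simp: us_def ws_def)
  then obtain \<phi>' where \<phi>': "wff L (concat (map \<Gamma>' (us @ ws))) \<phi>'"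
    "\<And>g. g \<in> envs \<Gamma>' \<Longrightarrow> sat N (concat (map g (us @ ws))) \<phi>' \<longleftrightarrow> sat N (concat (map g vs)) \<phi>"
    using rename_blocks[OF P(1)] by metis
  have ws: "map \<Gamma> ws = map \<Gamma>' ws" by (auto simp: ws_def agree)
  let ?\<theta> = "exs (concat (map \<Gamma>' us)) \<phi>'"
  have "wff L (concat (map \<Gamma> ws)) ?\<theta>"
    unfolding ws by (rule wff_exs) (use \<phi>'(1) sorts in \<open>auto simp: us_def\<close>)
  moreover have "(\<exists>g'\<in>envs \<Gamma>'. (\<forall>i\<in>V. g' i = g i) \<and> P g') \<longleftrightarrow> sat N (concat (map g ws)) ?\<theta>"
    if g: "g \<in> envs \<Gamma>" for g
  proof
    assume "\<exists>g'\<in>envs \<Gamma>'. (\<forall>i\<in>V. g' i = g i) \<and> P g'"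
    then obtain g' where g': "g' \<in> envs \<Gamma>'" "\<forall>i\<in>V. g' i = g i" "P g'" by blast
    have "map g ws = map g' ws" using g'(2) by (auto simp: ws_def)
    then have "sat N (concat (map g' us) @ concat (map g ws)) \<phi>'"
      using g' P(2) \<phi>'(2)[of g'] by (simp del: map_eq_conv)
    moreover have "concat (map g' us) \<in> tuples N (concat (map \<Gamma>' us))"
      using g'(1) by (intro tuples_concat) (auto simp: envs_def)
    ultimately show "sat N (concat (map g ws)) ?\<theta>" by (auto simp: sat_exs)
  next
    assume "sat N (concat (map g ws)) ?\<theta>"
    then obtain a where a: "a \<in> tuples N (concat (map \<Gamma>' us))" "sat N (a @ concat (map g ws)) \<phi>'"
      by (auto simp: sat_exs)
    obtain h where h: "a = concat (map h us)" "\<forall>i\<in>set us. h i \<in> tuples N (\<Gamma>' i)"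
      using tuples_concat_split[OF _ a(1)] by (auto simp: us_def)
    \<comment> \<open>Environments are total, so blocks absent from the formula also need a value of
      the right sorts; any one will do.\<close>
    define g' where "g' = (\<lambda>i. if i \<in> V then g i else if i \<in> set us then h i else (SOME e. e \<in> tuples N (\<Gamma>' i)))"
    have "g' i \<in> tuples N (\<Gamma>' i)" for i
    proof (cases "i \<in> V")
      case True
      then show ?thesis using g agree[OF True] by (simp add: g'_def envs_def) metis
    next
      case False
      then show ?thesis using h(2) someI_ex[OF tuples_nonempty[OF sorts[OF False]]] by (simp add: g'_def)
    qed
    then have env: "g' \<in> envs \<Gamma>'" by (simp add: envs_def)
    have "map g' ws = map g ws" "map g' us = map h us" by (auto simp: g'_def ws_def us_def)
    then have "P g'" using a(2) P(2)[OF env] \<phi>'(2)[OF env] h(1) by (simp del: map_eq_conv)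
    moreover have "\<forall>i\<in>V. g' i = g i" by (simp add: g'_def)
    ultimately show "\<exists>g'\<in>envs \<Gamma>'. (\<forall>i\<in>V. g' i = g i) \<and> P g'" using env by blast
  qed
  ultimately show ?thesis unfolding defn_def by blast
qed

text \<open>The second hypothesis is freshness: the value of block \<open>i\<close> reaches
  \<open>P\<close> through the second argument only.\<close>

lemma defn_ex:
  assumes "defn (\<Gamma>(i := S)) (\<lambda>g. P g (g i))" and "\<And>g v. P (g(i := v)) = P g" and "set S \<subseteq> Sorts L"
  shows "defn \<Gamma> (\<lambda>g. \<exists>w\<in>tuples N S. P g w)"
proof -
  have "defn \<Gamma> (\<lambda>g. \<exists>g'\<in>envs (\<Gamma>(i := S)). (\<forall>j\<in>- {i}. g' j = g j) \<and> P g' (g' i))"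
    by (rule defn_exists_blocks[OF assms(1)]) (use assms(3) in auto)
  moreover have "(\<exists>g'\<in>envs (\<Gamma>(i := S)). (\<forall>j\<in>- {i}. g' j = g j) \<and> P g' (g' i)) \<longleftrightarrow>
      (\<exists>w\<in>tuples N S. P g w)" if g: "g \<in> envs \<Gamma>" for g
  proof
    assume "\<exists>g'\<in>envs (\<Gamma>(i := S)). (\<forall>j\<in>- {i}. g' j = g j) \<and> P g' (g' i)"
    then obtain g' where g': "g' \<in> envs (\<Gamma>(i := S))" "\<forall>j\<in>- {i}. g' j = g j" "P g' (g' i)" by blast
    then have "g' = g(i := g' i)" by auto
    then have "P g (g' i)" using g'(3) assms(2) by metis
    moreover have "g' i \<in> tuples N S" using g'(1) by (auto simp: envs_def split: if_splits)
    ultimately show "\<exists>w\<in>tuples N S. P g w" by blast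
  next
    assume "\<exists>w\<in>tuples N S. P g w"
    then obtain w where "w \<in> tuples N S" "P g w" by blast
    then show "\<exists>g'\<in>envs (\<Gamma>(i := S)). (\<forall>j\<in>- {i}. g' j = g j) \<and> P g' (g' i)"
      using g assms(2) by (intro bexI[of _ "g(i := w)"]) (auto simp: envs_def)
  qed
  ultimately show ?thesis by (rule defn_eqI)
qed

lemma defn_all:
  assumes "defn (\<Gamma>(i := S)) (\<lambda>g. P g (g i))" and "\<And>g v. P (g(i := v)) = P g" and "set S \<subseteq> Sorts L"
  shows "defn \<Gamma> (\<lambda>g. \<forall>w\<in>tuples N S. P g w)"
proof -
  have "defn \<Gamma> (\<lambda>g. \<exists>w\<in>tuples N S. \<not> P g w)"
    by (rule defn_ex[where i = i]) (use assms in \<open>auto simp: defn_not\<close>)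
  from defn_not[OF this] show ?thesis by simp
qed

text \<open>Quantifying over a whole sequence spares a count of the quantified tuples. The
  quantifier is still first-order, because a definable predicate reads only finitely many members of
  the sequence.\<close>

lemma defn_ex_family:
  fixes n :: nat
  assumes "defn (\<lambda>m. if m < n then \<Gamma> m else S) (\<lambda>g. P g (\<lambda>j. g (n + j)))"
    and "\<And>g g'. (\<And>m. m < n \<Longrightarrow> g m = g' m) \<Longrightarrow> P g = P g'" and "set S \<subseteq> Sorts L"
  shows "defn \<Gamma> (\<lambda>g. \<exists>w. (\<forall>j. w j \<in> tuples N S) \<and> P g w)"
proof -
  let ?\<Gamma>' = "\<lambda>m. if m < n then \<Gamma> m else S"
  have "defn \<Gamma> (\<lambda>g. \<exists>g'\<in>envs ?\<Gamma>'. (\<forall>m\<in>{..<n}. g' m = g m) \<and> P g' (\<lambda>j. g' (n + j)))"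
    by (rule defn_exists_blocks[OF assms(1)]) (use assms(3) in auto)
  moreover have "(\<exists>g'\<in>envs ?\<Gamma>'. (\<forall>m\<in>{..<n}. g' m = g m) \<and> P g' (\<lambda>j. g' (n + j))) \<longleftrightarrow>
      (\<exists>w. (\<forall>j. w j \<in> tuples N S) \<and> P g w)" if g: "g \<in> envs \<Gamma>" for g
  proof
    assume "\<exists>g'\<in>envs ?\<Gamma>'. (\<forall>m\<in>{..<n}. g' m = g m) \<and> P g' (\<lambda>j. g' (n + j))"
    then obtain g' where g': "g' \<in> envs ?\<Gamma>'" "\<forall>m\<in>{..<n}. g' m = g m" "P g' (\<lambda>j. g' (n + j))" by blast
    have "P g' = P g" by (rule assms(2)) (use g'(2) in auto)
    moreover have "g' (n + j) \<in> tuples N S" for j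
    proof -
      have "g' (n + j) \<in> tuples N (?\<Gamma>' (n + j))" using g'(1) unfolding envs_def by blast
      then show ?thesis by simp
    qed
    ultimately show "\<exists>w. (\<forall>j. w j \<in> tuples N S) \<and> P g w"
      using g'(3) by (intro exI[of _ "\<lambda>j. g' (n + j)"]) simp
  next
    assume "\<exists>w. (\<forall>j. w j \<in> tuples N S) \<and> P g w"
    then obtain w where w: "\<forall>j. w j \<in> tuples N S" "P g w" by blast
    let ?g = "\<lambda>m. if m < n then g m else w (m - n)"
    have "P ?g = P g" by (rule assms(2)) auto
    then show "\<exists>g'\<in>envs ?\<Gamma>'. (\<forall>m\<in>{..<n}. g' m = g m) \<and> P g' (\<lambda>j. g' (n + j))"
      using g w by (intro bexI[of _ ?g]) (simp_all add: envs_def)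
  qed
  ultimately show ?thesis by (rule defn_eqI)
qed

lemma defn_fm:
  assumes "defn (blk l) P"
  obtains \<phi> where "wff L (concat l) \<phi>"
    and "\<And>es. list_all2 (\<lambda>e \<Gamma>. e \<in> tuples N \<Gamma>) es l \<Longrightarrow> sat N (concat es) \<phi> \<longleftrightarrow> P (blk es)"
proof -
  obtain vs \<phi> where P: "wff L (concat (map (blk l) vs)) \<phi>"
      "\<And>g. g \<in> envs (blk l) \<Longrightarrow> P g \<longleftrightarrow> sat N (concat (map g vs)) \<phi>"
    using assms(1) unfolding defn_def by blast
  \<comment> \<open>Blocks beyond the list may occur in \<open>vs\<close>, but they are empty, so
    appending them leaves the concatenation equal to \<open>concat l\<close>.\<close>
  define ws where "ws = [0..<length l] @ filter (\<lambda>v. length l \<le> v) vs"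
  have "set vs \<subseteq> set ws" by (auto simp: ws_def)
  then obtain \<phi>' where \<phi>': "wff L (concat (map (blk l) ws)) \<phi>'"
    "\<And>g. g \<in> envs (blk l) \<Longrightarrow> sat N (concat (map g ws)) \<phi>' \<longleftrightarrow> sat N (concat (map g vs)) \<phi>"
    using rename_blocks[OF P(1)] by metis
  have *: "concat (map (blk l') ws) = concat l'" if "length l' = length l" for l' :: "'c list list"
    using that concat_blk[of l'] by (auto simp: ws_def blk_def)
  show thesis
  proof (rule that[of \<phi>'])
    show "wff L (concat l) \<phi>'" using \<phi>'(1) *[of l] by simp
    fix es assume es: "list_all2 (\<lambda>e \<Gamma>. e \<in> tuples N \<Gamma>) es l"
    then have len: "length es = length l" by (rule list_all2_lengthD)
    have "blk es \<in> envs (blk l)" using es len by (auto simp: envs_def blk_def list_all2_conv_all_nth)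
    then show "sat N (concat es) \<phi>' \<longleftrightarrow> P (blk es)" using \<phi>'(2) P(2) *[OF len] by metis
  qed
qed

lemma defn_fm1:
  assumes "defn (blk [X]) P"
  obtains \<phi> where "wff L (X) \<phi>"
    and "\<And>x. x \<in> tuples N X \<Longrightarrow>
      sat N (x) \<phi> \<longleftrightarrow> P (blk [x])"
proof -
  obtain \<phi> where \<phi>: "wff L (concat [X]) \<phi>"
    "\<And>es. list_all2 (\<lambda>e \<Gamma>. e \<in> tuples N \<Gamma>) es [X] \<Longrightarrow> sat N (concat es) \<phi> \<longleftrightarrow> P (blk es)"
    using defn_fm[OF assms] by blast
  show thesis
    by (rule that[of \<phi>]) (use \<phi>(1) \<phi>(2)[of "[_]"] in simp_all)
qed

lemma defn_fm2:
  assumes "defn (blk [X, Y]) P"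
  obtains \<phi> where "wff L (X @ Y) \<phi>"
    and "\<And>x y. x \<in> tuples N X \<Longrightarrow> y \<in> tuples N Y \<Longrightarrow>
      sat N (x @ y) \<phi> \<longleftrightarrow> P (blk [x, y])"
proof -
  obtain \<phi> where \<phi>: "wff L (concat [X, Y]) \<phi>"
    "\<And>es. list_all2 (\<lambda>e \<Gamma>. e \<in> tuples N \<Gamma>) es [X, Y] \<Longrightarrow> sat N (concat es) \<phi> \<longleftrightarrow> P (blk es)"
    using defn_fm[OF assms] by blast
  show thesis
    by (rule that[of \<phi>]) (use \<phi>(1) \<phi>(2)[of "[_, _]"] in simp_all)
qed

lemma defn_fm3:
  assumes "defn (blk [X, Y, Z]) P"
  obtains \<phi> where "wff L (X @ Y @ Z) \<phi>"
    and "\<And>x y z. x \<in> tuples N X \<Longrightarrow> y \<in> tuples N Y \<Longrightarrow> z \<in> tuples N Z \<Longrightarrow>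
      sat N (x @ y @ z) \<phi> \<longleftrightarrow> P (blk [x, y, z])"
proof -
  obtain \<phi> where \<phi>: "wff L (concat [X, Y, Z]) \<phi>"
    "\<And>es. list_all2 (\<lambda>e \<Gamma>. e \<in> tuples N \<Gamma>) es [X, Y, Z] \<Longrightarrow> sat N (concat es) \<phi> \<longleftrightarrow> P (blk es)"
    using defn_fm[OF assms] by blast
  show thesis
    by (rule that[of \<phi>]) (use \<phi>(1) \<phi>(2)[of "[_, _, _]"] in simp_all)
qed

end


section \<open>Ultrafilters\<close>

definition ultra :: "'b filter \<Rightarrow> bool" where
  "ultra U \<longleftrightarrow> U \<noteq> bot \<and> (\<forall>P. eventually P U \<or> eventually (\<lambda>x. \<not> P x) U)"

lemma ultra_ex: "ultra U \<Longrightarrow> eventually P U \<Longrightarrow> \<exists>x. P x"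
  by (auto simp: ultra_def dest: eventually_happens)

lemma ultra_not: "ultra U \<Longrightarrow> eventually (\<lambda>x. \<not> P x) U \<longleftrightarrow> \<not> eventually P U"
  using ultra_ex[OF _ eventually_conj, of U P "\<lambda>x. \<not> P x"] by (auto simp: ultra_def)

lemma ultra_filtermap: "ultra U \<Longrightarrow> ultra (filtermap f U)"
  by (auto simp: ultra_def eventually_filtermap filtermap_bot_iff)

text \<open>A family that is maximal with the finite intersection property generates the
  ultrafilter. If it contained neither \<open>X\<close> nor the complement of \<open>X\<close>,
  finite subfamilies would refute both enlargements; their remaining members together would have a
  common point, and that point lies in \<open>X\<close> or in its complement.\<close>

lemma ultra_extending:
  assumes "\<And>F. finite F \<Longrightarrow> F \<subseteq> S \<Longrightarrow> \<Inter> F \<noteq> {}"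
  obtains U where "ultra U" and "\<And>X. X \<in> S \<Longrightarrow> eventually (\<lambda>x. x \<in> X) U"
proof -
  define fip where "fip = (\<lambda>Z::'a set set. \<forall>F. finite F \<longrightarrow> F \<subseteq> Z \<longrightarrow> \<Inter> F \<noteq> {})"
  define \<A> where "\<A> = {Z. S \<subseteq> Z \<and> fip Z}"
  have "\<exists>M\<in>\<A>. \<forall>X\<in>\<A>. M \<subseteq> X \<longrightarrow> X = M"
  proof (rule subset_Zorn_nonempty)
    have "fip S" unfolding fip_def using assms by blast
    then show "\<A> \<noteq> {}" unfolding \<A>_def by blast
    fix \<C> assume \<C>: "\<C> \<noteq> {}" "subset.chain \<A> \<C>"
    then have sub: "\<C> \<subseteq> \<A>" by (simp add: subset.chain_def)
    have "fip (\<Union> \<C>)" unfolding fip_def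
    proof (intro allI impI)
      fix F assume F: "finite F" "F \<subseteq> \<Union> \<C>"
      obtain Z where Z: "Z \<in> \<C>" "F \<subseteq> Z" by (rule finite_subset_Union_chain[OF F \<C>])
      then have "fip Z" using sub unfolding \<A>_def by blast
      then show "\<Inter> F \<noteq> {}" unfolding fip_def using F(1) Z(2) by simp
    qed
    moreover obtain Z where "Z \<in> \<C>" using \<C>(1) by blast
    then have "S \<subseteq> \<Union> \<C>" using sub unfolding \<A>_def by blast
    ultimately show "\<Union> \<C> \<in> \<A>" by (simp add: \<A>_def)
  qed
  then obtain M where M: "S \<subseteq> M" "fip M" and max: "\<And>X. S \<subseteq> X \<Longrightarrow> fip X \<Longrightarrow> M \<subseteq> X \<Longrightarrow> X = M"
    unfolding \<A>_def by auto
  define U where "U = Inf (principal ` M)"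
  have ev: "eventually (\<lambda>x. x \<in> X) U" if "X \<in> M" for X
  proof -
    have "U \<le> principal X" unfolding U_def using that by (intro Inf_lower) auto
    then show ?thesis by (simp add: le_principal)
  qed
  have "U \<noteq> bot" unfolding U_def
  proof (rule Inf_filter_not_bot)
    fix X assume "X \<subseteq> principal ` M" "finite X"
    then obtain F where F: "F \<subseteq> M" "finite F" "X = principal ` F" by (meson finite_subset_image)
    then have "\<Inter> F \<noteq> {}" using M(2) unfolding fip_def by simp
    moreover have "principal (\<Inter> F) \<le> Inf X" unfolding F(3) by (rule Inf_greatest) auto
    ultimately show "Inf X \<noteq> bot" by (auto simp: principal_eq_bot_iff bot_unique)
  qed
  moreover have "eventually P U \<or> eventually (\<lambda>x. \<not> P x) U" for P
  proof -
    have "X \<in> M \<or> - X \<in> M" for X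
    proof (rule ccontr)
      assume "\<not> (X \<in> M \<or> - X \<in> M)"
      then have "\<not> fip (insert X M)" "\<not> fip (insert (- X) M)"
        using max[of "insert X M"] max[of "insert (- X) M"] M(1) by (metis insertI1 subset_insertI subset_trans)+
      then obtain F G where F: "finite F" "F \<subseteq> insert X M" "\<Inter> F = {}"
        and G: "finite G" "G \<subseteq> insert (- X) M" "\<Inter> G = {}" unfolding fip_def by metis
      have "finite ((F - {X}) \<union> (G - {- X}))" using F(1) G(1) by simp
      moreover have "(F - {X}) \<union> (G - {- X}) \<subseteq> M"
        using F(2) G(2) by (intro Un_least) (simp_all add: Diff_subset_conv)
      ultimately have "\<Inter> ((F - {X}) \<union> (G - {- X})) \<noteq> {}" using M(2) unfolding fip_def by simp
      then obtain x where x: "\<And>Z. Z \<in> F - {X} \<Longrightarrow> x \<in> Z" "\<And>Z. Z \<in> G - {- X} \<Longrightarrow> x \<in> Z" by blast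
      show False
      proof (cases "x \<in> X")
        case True
        then have "\<forall>Z\<in>F. x \<in> Z" using x(1) by blast
        then show False using F(3) by blast
      next
        case False
        then have "\<forall>Z\<in>G. x \<in> Z" using x(2) by blast
        then show False using G(3) by blast
      qed
    qed
    then show ?thesis using ev[of "{x. P x}"] ev[of "- {x. P x}"] by auto
  qed
  ultimately have "ultra U" unfolding ultra_def by simp
  then show thesis using ev M(1) by (intro that) blast+
qed

section \<open>Majority rule for relations without long ladders\<close>

text \<open>Read \<open>S a b\<close> as the answer of \<open>a\<close> about \<open>b\<close>, and
  \<open>D b\<close> as the right answer. Every later entry of the list is made right about chosen
  parameters on which sets of earlier entries err. If \<open>m + 1\<close> entries erred about one
  parameter, the chosen parameters would form a forbidden ladder. So at most \<open>m\<close> of the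
  \<open>2 * m + 2\<close> entries err, and the number of positive answers exceeds \<open>m\<close>
  exactly if \<open>D b\<close>. \<open>R\<close> lets further demands be made on each entry in
  terms of the previous ones.\<close>

lemma majority_rule:
  fixes D :: "'y \<Rightarrow> bool" and S :: "'x \<Rightarrow> 'y \<Rightarrow> bool"
  assumes no_ladder: "\<And>a b. (\<And>i. i < m \<Longrightarrow> a i \<in> X \<and> b i \<in> Y) \<Longrightarrow>
      (\<And>i j. i < m \<Longrightarrow> j < m \<Longrightarrow> S (a i) (b j) \<longleftrightarrow> i < j) \<Longrightarrow> False"
    and step: "\<And>as B. set as \<subseteq> X \<Longrightarrow> finite B \<Longrightarrow> B \<subseteq> Y \<Longrightarrow> \<exists>a\<in>X. R as a \<and> (\<forall>b\<in>B. S a b \<longleftrightarrow> D b)"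
  obtains as where "length as = 2 * m + 2" and "set as \<subseteq> X"
    and "\<And>i. i < 2 * m + 2 \<Longrightarrow> R (take i as) (as ! i)"
    and "\<And>b. b \<in> Y \<Longrightarrow> D b \<longleftrightarrow> m < card {i. i < 2 * m + 2 \<and> S (as ! i) b}"
proof -
  \<comment> \<open>Joint error: the entries with index in \<open>I\<close> all give the wrong
    answer about \<open>b\<close>, whose right answer is \<open>t\<close>.\<close>
  define W where "W = (\<lambda>as I t b. b \<in> Y \<and> D b = t \<and> (\<forall>i\<in>I. S (as ! i) b = (\<not> t)))"
  define wit where "wit = (\<lambda>as I t. SOME b. W as I t b)"
  define ok where "ok = (\<lambda>as. set as \<subseteq> X \<and> (\<forall>i<length as. R (take i as) (as ! i) \<and>
    (\<forall>p\<le>i. \<forall>I\<subseteq>{..<p}. \<forall>t. (\<exists>b. W (take p as) I t b) \<longrightarrow>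
      (S (as ! i) (wit (take p as) I t) \<longleftrightarrow> t))))"
  have wit: "W as I t (wit as I t)" if "\<exists>b. W as I t b" for as I t
    unfolding wit_def using that by (rule someI_ex)
  have "\<exists>as. length as = n \<and> ok as" for n
  proof (induction n)
    case 0
    then show ?case by (intro exI[of _ "[]"]) (auto simp: ok_def)
  next
    case (Suc n)
    then obtain as where as: "length as = n" "ok as" by blast
    \<comment> \<open>The dummy variable of type \<open>unit\<close> makes the innermost set a
      singleton or empty, depending on whether a joint error exists. Finitely many prefixes and
      index sets keep \<open>B\<close> finite.\<close>
    define B where "B = (\<Union>p\<le>n. \<Union>I\<in>Pow {..<p}. \<Union>t. {wit (take p as) I t |_::unit. \<exists>b. W (take p as) I t b})"
    have "finite B" unfolding B_def by (intro finite_UN_I) auto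
    moreover have "B \<subseteq> Y" using wit by (auto simp: B_def W_def)
    ultimately obtain a where a: "a \<in> X" "R as a" "\<And>b. b \<in> B \<Longrightarrow> S a b \<longleftrightarrow> D b"
      using step[of as B] as(2) by (auto simp: ok_def)
    have new: "S a (wit (take p as) I t) \<longleftrightarrow> t"
      if "p \<le> n" "I \<subseteq> {..<p}" "\<exists>b. W (take p as) I t b" for p I t
    proof -
      have "wit (take p as) I t \<in> B" using that unfolding B_def by blast
      then show ?thesis using a(3) wit[OF that(3)] by (simp add: W_def)
    qed
    have "ok (as @ [a])" unfolding ok_def
    proof (intro conjI allI impI)
      show "set (as @ [a]) \<subseteq> X" using as a by (auto simp: ok_def)
      fix i assume i: "i < length (as @ [a])"
      show "R (take i (as @ [a])) ((as @ [a]) ! i)"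
        using i as a by (cases "i = n") (auto simp: ok_def nth_append)
      fix p I t assume p: "p \<le> i" "I \<subseteq> {..<p}" "\<exists>b. W (take p (as @ [a])) I t b"
      show "S ((as @ [a]) ! i) (wit (take p (as @ [a])) I t) \<longleftrightarrow> t"
        using i p as new by (cases "i = n") (auto simp: ok_def nth_append)
    qed
    then show ?case using as(1) by (intro exI[of _ "as @ [a]"]) simp
  qed
  then obtain as where as: "length as = 2 * m + 2" "ok as" by blast
  have few: "card I \<le> m" if I: "I \<subseteq> {..<2 * m + 2}" and b: "W as I t b" for I t b
  proof (rule ccontr)
    assume "\<not> card I \<le> m"
    define w where "w = (\<lambda>i. sorted_list_of_set I ! i)"
    have fin: "finite I" using I finite_subset by blast
    have wI: "w i \<in> I" if "i \<le> m" for i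
      using that \<open>\<not> card I \<le> m\<close> fin unfolding w_def
      by (metis le_less_trans linorder_not_le nth_mem sorted_list_of_set.length_sorted_key_list_of_set
          sorted_list_of_set.set_sorted_key_list_of_set)
    have less: "w i < w j" if "i < j" "j \<le> m" for i j
      using that \<open>\<not> card I \<le> m\<close> sorted_wrt_nth_less[OF strict_sorted_list_of_set, of i j I]
      by (simp add: w_def)
    \<comment> \<open>\<open>b\<close> shows that the first \<open>j\<close> entries of
      \<open>I\<close> have a joint error. The chosen one depends only on the list before entry
      \<open>w j\<close>, so \<open>a j\<close> and all later entries are right about it.\<close>
    define c where "c = (\<lambda>j. wit (take (w j) as) (w ` {..<j}) t)"
    define a where "a = (\<lambda>i. as ! w i)"
    have wK: "w i < 2 * m + 2" if "i \<le> m" for i using wI[OF that] I by auto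
    have ex: "\<exists>b. W (take (w j) as) (w ` {..<j}) t b" if "j \<le> m" for j
      using b wI less that by (intro exI[of _ b]) (auto simp: W_def)
    have cW: "W (take (w j) as) (w ` {..<j}) t (c j)" if "j \<le> m" for j
      unfolding c_def by (rule wit[OF ex[OF that]])
    have lo: "S (a i) (c j) = (\<not> t)" if "i < j" "j \<le> m" for i j
    proof -
      have "S (take (w j) as ! w i) (c j) = (\<not> t)" using cW[of j] that unfolding W_def by blast
      then show ?thesis using less[OF that] by (simp add: a_def)
    qed
    have hi: "S (a i) (c j) = t" if "j \<le> i" "i \<le> m" for i j
    proof -
      have "w j \<le> w i" using less[of j i] that by (cases "j = i") auto
      moreover have "w ` {..<j} \<subseteq> {..<w j}" using less that by auto
      ultimately show ?thesis
        using as ex[of j] wK[of i] that unfolding ok_def a_def c_def by auto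
    qed
    have aX: "a i \<in> X" if "i \<le> m" for i
      using as wK[OF that] by (auto simp: a_def ok_def)
    have cY: "c j \<in> Y" if "j \<le> m" for j using cW[OF that] by (simp add: W_def)
    show False
    proof (cases t)
      case False
      show False
      proof (rule no_ladder[of a c])
        fix i j assume "i < m" "j < m"
        then show "S (a i) (c j) \<longleftrightarrow> i < j" using lo[of i j] hi[of j i] False by (cases "i < j") auto
      qed (use aX cY in auto)
    next
      case True
      show False
      \<comment> \<open>Here \<open>S (a i) (c j)\<close> amounts to j \<le> i. Reversing both
        sequences with a shift by one makes the inequality strict; this consumes the additional
        error beyond \<open>m\<close>.\<close>
      proof (rule no_ladder[of "\<lambda>i. a (m - 1 - i)" "\<lambda>j. c (m - j)"])
        fix i j assume ij: "i < m" "j < m"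
        show "S (a (m - 1 - i)) (c (m - j)) \<longleftrightarrow> i < j"
        proof (cases "i < j")
          case True
          then have "m - j \<le> m - 1 - i" using ij by arith
          then show ?thesis using hi[of "m - j" "m - 1 - i"] True \<open>t\<close> by simp
        next
          case False
          then have "m - 1 - i < m - j" using ij by arith
          then show ?thesis using lo[of "m - 1 - i" "m - j"] False \<open>t\<close> by simp
        qed
      qed (use aX cY in auto)
    qed
  qed
  show thesis
  proof (rule that[of as])
    fix b assume b: "b \<in> Y"
    let ?p = "{i. i < 2 * m + 2 \<and> S (as ! i) b}" and ?n = "{i. i < 2 * m + 2 \<and> \<not> S (as ! i) b}"
    have "card ?p + card ?n = card (?p \<union> ?n)" by (rule card_Un_disjoint[symmetric]) auto
    also have "?p \<union> ?n = {..<2 * m + 2}" by auto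
    finally have sum: "card ?p + card ?n = 2 * m + 2" by simp
    show "D b \<longleftrightarrow> m < card ?p"
    proof
      assume "D b"
      then have "card ?n \<le> m" by (intro few[of _ True b]) (auto simp: W_def b)
      then show "m < card ?p" using sum by simp
    next
      assume "m < card ?p"
      then show "D b" using few[of ?p False b] by (auto simp: W_def b)
    qed
  qed (use as in \<open>auto simp: ok_def\<close>)
qed


section \<open>Saturated structures with codes for definable sets\<close>

lemma sols_antimono: "p \<subseteq> q \<Longrightarrow> sols N Xs q \<subseteq> sols N Xs p"
  by (auto simp: sols_def)

context mstruct
begin

lemma insts_conj:
  assumes "finite F" and "F \<subseteq> insts L N Xs B"
  shows "\<exists>\<psi>\<in>insts L N Xs B. sols N Xs {\<psi>} = sols N Xs F"
  using assms
proof (induction F rule: finite_induct)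
  case empty
  obtain \<phi> where "wff L Xs \<phi>" "\<And>x. x \<in> tuples N Xs \<Longrightarrow> sat N x \<phi>"
    using defn_fm1[OF defn_const[of "blk [Xs]" True]] by metis
  then show ?case by (intro bexI[of _ "(\<phi>, [])"]) (auto simp: sols_def insts_def intro!: exI[of _ "[]"])
next
  case (insert \<psi>1 F)
  then obtain \<psi>2 where \<psi>2: "\<psi>2 \<in> insts L N Xs B" "sols N Xs {\<psi>2} = sols N Xs F" by auto
  obtain \<phi> b Ys where 1: "\<psi>1 = (\<phi>, b)" "set b \<subseteq> B" "set Ys \<subseteq> Sorts L" "b \<in> tuples N Ys" "wff L (Xs @ Ys) \<phi>"
    using insert.prems by (auto simp: insts_def)
  obtain \<theta> c Zs where 2: "\<psi>2 = (\<theta>, c)" "set c \<subseteq> B" "set Zs \<subseteq> Sorts L" "c \<in> tuples N Zs" "wff L (Xs @ Zs) \<theta>"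
    using \<psi>2 by (auto simp: insts_def)
  have "defn (blk [Xs, Ys, Zs]) (\<lambda>g. sat N (g 0 @ g 1) \<phi> \<and> sat N (g 0 @ g 2) \<theta>)"
    by (intro defn_conj defn_sat2) (use 1 2 in simp_all)
  then obtain \<chi> where \<chi>: "wff L (Xs @ Ys @ Zs) \<chi>"
    "\<And>x y z. x \<in> tuples N Xs \<Longrightarrow> y \<in> tuples N Ys \<Longrightarrow> z \<in> tuples N Zs \<Longrightarrow>
      sat N (x @ y @ z) \<chi> \<longleftrightarrow> sat N (x @ y) \<phi> \<and> sat N (x @ z) \<theta>"
    by (rule defn_fm3) auto
  have "(\<chi>, b @ c) \<in> insts L N Xs B"
    using 1 2 \<chi>(1) by (auto simp: insts_def intro!: exI[of _ "Ys @ Zs"] tuples_appendI)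
  moreover have "sols N Xs {(\<chi>, b @ c)} = sols N Xs {\<psi>1} \<inter> sols N Xs {\<psi>2}"
    using 1 2 \<chi>(2) by (auto simp: sols_def)
  moreover have "sols N Xs (insert \<psi>1 F) = sols N Xs {\<psi>1} \<inter> sols N Xs F" by (auto simp: sols_def)
  ultimately show ?case using \<psi>2(2) by blast
qed

text \<open>By completeness \<open>q\<close> contains the conjunction or its negation, and the
  negation is inconsistent with \<open>F\<close>.\<close>

lemma complete_type_conj:
  assumes "q \<in> complete_types L N Xs B" and "finite F" and "F \<subseteq> q"
  shows "\<exists>\<psi>\<in>q. sols N Xs {\<psi>} = sols N Xs F"
proof -
  have q: "q \<subseteq> insts L N Xs B" "consistent N Xs q"
    "\<And>\<phi> b. (\<phi>, b) \<in> insts L N Xs B \<Longrightarrow> (\<phi>, b) \<in> q \<or> (Neg \<phi>, b) \<in> q"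
    using assms(1) by (auto simp: complete_types_def)
  obtain \<phi> b where \<phi>: "(\<phi>, b) \<in> insts L N Xs B" "sols N Xs {(\<phi>, b)} = sols N Xs F"
    using insts_conj[OF assms(2) subset_trans[OF assms(3) q(1)]] by (metis surj_pair)
  have "(Neg \<phi>, b) \<notin> q"
  proof
    assume "(Neg \<phi>, b) \<in> q"
    then have "sols N Xs (insert (Neg \<phi>, b) F) \<noteq> {}"
      using q(2) assms(2,3) by (simp add: consistent_def)
    then obtain x where "x \<in> sols N Xs (insert (Neg \<phi>, b) F)" by blast
    then have "x \<in> sols N Xs F" "\<not> sat N (x @ b) \<phi>" by (auto simp: sols_def)
    then show False using \<phi>(2) by (auto simp: sols_def)
  qed
  then show ?thesis using q(3) \<phi> by blast
qed

text \<open>Every entry of \<open>d\<close> occurs somewhere in \<open>a @ d'\<close>, and any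
  occurrence may be chosen for it: since the sorts are disjoint, the variable at that place
  automatically has the sort that \<phi> expects.\<close>

lemma reparametrize:
  assumes "wff L (\<Gamma> @ Zs) \<phi>" and "d \<in> tuples N Zs" and "set Zs \<subseteq> Sorts L"
    and "a \<in> tuples N Xs" and "set Xs \<subseteq> Sorts L" and "set d \<subseteq> B \<union> set a"
  obtains \<phi>' d' Zs' where "d' \<in> tuples N Zs'" and "set Zs' \<subseteq> Sorts L" and "set d' \<subseteq> B"
    and "wff L (\<Gamma> @ Xs @ Zs') \<phi>'"
    and "\<And>e. e \<in> tuples N \<Gamma> \<Longrightarrow> sat N (e @ a @ d') \<phi>' \<longleftrightarrow> sat N (e @ d) \<phi>"
proof -
  define d' where "d' = filter (\<lambda>x. x \<in> B) d"
  have "set d' \<subseteq> points L N" using tuples_points[OF assms(3,2)] by (auto simp: d'_def)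
  then obtain Zs' where Zs': "set Zs' \<subseteq> Sorts L" "d' \<in> tuples N Zs'" using tuples_of_points by blast
  have "\<exists>i<length (a @ d'). (a @ d') ! i = x" if "x \<in> set d" for x
    using that assms(6) in_set_conv_nth[of x "a @ d'"] by (auto simp: d'_def)
  then obtain f where f: "\<And>x. x \<in> set d \<Longrightarrow> f x < length (a @ d') \<and> (a @ d') ! f x = x" by metis
  let ?n = "length \<Gamma>"
  define js where "js = map f d"
  define "is" where "is = [0..<?n] @ map (\<lambda>i. ?n + i) js"
  have ad: "a @ d' \<in> tuples N (Xs @ Zs')" using assms(4) Zs' by (intro tuples_appendI)
  then have len: "length (Xs @ Zs') = length (a @ d')" using tuples_length by metis
  have lenZ: "length d = length Zs" using assms(2) by (rule tuples_length)
  have js: "map ((!) (Xs @ Zs')) js = Zs"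
  proof (rule nth_equalityI)
    fix p assume "p < length (map ((!) (Xs @ Zs')) js)"
    then have p: "p < length d" by (simp add: js_def)
    have "d ! p \<in> univ N (Zs ! p)" using assms(2) p by (auto simp: tuples_def list_all2_conv_all_nth)
    moreover have "d ! p \<in> univ N ((Xs @ Zs') ! f (d ! p))"
      using f[of "d ! p"] p ad by (auto simp: tuples_def list_all2_conv_all_nth)
    moreover have "Zs ! p \<in> Sorts L" using p lenZ assms(3) by auto
    moreover have "(Xs @ Zs') ! f (d ! p) \<in> Sorts L"
      using f[of "d ! p"] p len assms(5) Zs'(1) nth_mem[of "f (d ! p)" "Xs @ Zs'"] by auto
    ultimately have "(Xs @ Zs') ! f (d ! p) = Zs ! p" using univ_disjoint by blast
    then show "map ((!) (Xs @ Zs')) js ! p = Zs ! p" using p by (simp add: js_def)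
  qed (use lenZ in \<open>simp add: js_def\<close>)
  have shift: "map ((!) (u @ v)) is = u @ map ((!) v) js" if "length u = ?n" for u v :: "'c list"
  proof -
    have "map ((!) (u @ v)) [0..<?n] = u" using that by (auto intro!: nth_equalityI simp: nth_append)
    then show ?thesis using that by (simp add: is_def nth_append comp_def)
  qed
  have "set is \<subseteq> {..<length (\<Gamma> @ Xs @ Zs')}"
    using f len by (auto simp: is_def js_def)
  moreover have "map ((!) (\<Gamma> @ Xs @ Zs')) is = \<Gamma> @ Zs"
    using shift[of \<Gamma> "Xs @ Zs'"] js by simp
  ultimately obtain \<phi>' where \<phi>': "wff L (\<Gamma> @ Xs @ Zs') \<phi>'"
    "\<And>e. sat N e \<phi>' \<longleftrightarrow> sat N (map ((!) e) is) \<phi>"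
    using rename_fm[OF assms(1)] by metis
  show thesis
  proof (rule that[OF Zs'(2,1) _ \<phi>'(1)])
    fix e assume "e \<in> tuples N \<Gamma>"
    then have "map ((!) (e @ a @ d')) is = e @ map ((!) (a @ d')) js"
      by (intro shift) (rule tuples_length)
    also have "map ((!) (a @ d')) js = d"
      using f by (simp add: js_def comp_def map_idI)
    finally show "sat N (e @ a @ d') \<phi>' \<longleftrightarrow> sat N (e @ d) \<phi>" using \<phi>'(2) by simp
  qed (auto simp: d'_def)
qed

lemma defn_many:
  fixes K m :: nat
  assumes "wff L (Xs @ Ys) \<phi>" and "\<And>i. i < K \<Longrightarrow> \<Gamma> (v i) = Xs" and "\<Gamma> u = Ys"
  shows "defn \<Gamma> (\<lambda>g. m < card {i. i < K \<and> sat N (g (v i) @ g u) \<phi>})"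
proof -
  have "defn \<Gamma> (\<lambda>g. \<exists>W\<in>{W. W \<subseteq> {..<K} \<and> m < card W}. \<forall>i\<in>W. sat N (g (v i) @ g u) \<phi>)"
    by (intro defn_bex defn_ball defn_sat2) (use assms in \<open>auto intro: finite_subset\<close>)
  then show ?thesis
  proof (rule defn_eqI)
    fix g
    show "(\<exists>W\<in>{W. W \<subseteq> {..<K} \<and> m < card W}. \<forall>i\<in>W. sat N (g (v i) @ g u) \<phi>) \<longleftrightarrow>
        m < card {i. i < K \<and> sat N (g (v i) @ g u) \<phi>}" (is "?l \<longleftrightarrow> m < card ?S")
    proof
      assume ?l
      then obtain W where "W \<subseteq> ?S" "m < card W" by blast
      moreover have "finite ?S" by simp
      ultimately show "m < card ?S" by (meson card_mono less_le_trans)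
    next
      assume "m < card ?S"
      then show ?l by (intro bexI[of _ ?S]) auto
    qed
  qed
qed

text \<open>Does the work of automorphisms taking \<open>d\<close> to the \<open>a i\<close>. The
  type of \<open>d\<close> over \<open>A\<close> says that some solution of an algebraic formula of
  \<open>e\<close> satisfies \<kappa> and stands in the relation \<pi> to \<open>d\<close>. Each
  \<open>a i\<close> thus has such a solution, and since there are only finitely many, one serves
  infinitely many \<open>i\<close>. \<kappa> lists whatever else the conjugate has to inherit from
  \<open>e\<close>.\<close>

lemma algebraic_type_transfer:
  assumes "algebraic N [s] (tp L N [s] A [e])" and "s \<in> Sorts L" and "e \<in> univ N s"
    and "set Ys \<subseteq> Sorts L" and "wff L ([s] @ Ys) \<pi>" and "wff L [s] \<kappa>" and "d \<in> tuples N Ys"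
    and "sat N (e # d) \<pi>" and "sat N [e] \<kappa>" and "\<And>i::nat. a i \<in> sols N Ys (tp L N Ys A d)"
  obtains z where "z \<in> univ N s" and "sat N [z] \<kappa>" and "infinite {i. sat N (z # a i) \<pi>}"
proof -
  obtain \<theta> c where \<theta>: "(\<theta>, c) \<in> tp L N [s] A [e]" "finite (sols N [s] {(\<theta>, c)})"
    using assms(1) by (auto simp: algebraic_def)
  then obtain Cs where c: "set c \<subseteq> A" "set Cs \<subseteq> Sorts L" "c \<in> tuples N Cs" "wff L ([s] @ Cs) \<theta>"
    and e\<theta>: "sat N ([e] @ c) \<theta>"
    by (auto simp: tp_def insts_def)
  have "defn (blk [Ys, Cs]) (\<lambda>g. \<exists>z\<in>tuples N [s]. sat N (z @ g 1) \<theta> \<and> sat N (z @ g 0) \<pi> \<and> sat N z \<kappa>)"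
    by (rule defn_ex[where i = 2], intro defn_conj defn_sat2 defn_sat1) (use assms c in simp_all)
  then obtain \<zeta> where \<zeta>: "wff L (Ys @ Cs) \<zeta>"
    "\<And>y c. y \<in> tuples N Ys \<Longrightarrow> c \<in> tuples N Cs \<Longrightarrow> sat N (y @ c) \<zeta> \<longleftrightarrow>
      (\<exists>z\<in>tuples N [s]. sat N (z @ c) \<theta> \<and> sat N (z @ y) \<pi> \<and> sat N z \<kappa>)"
    by (rule defn_fm2) auto
  have "sat N (d @ c) \<zeta>"
    unfolding \<zeta>(2)[OF assms(7) c(3)] by (rule bexI[of _ "[e]"]) (use assms e\<theta> in simp_all)
  then have \<zeta>tp: "(\<zeta>, c) \<in> tp L N Ys A d"
    using c \<zeta>(1) by (auto simp: tp_def insts_def)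
  have "\<exists>z\<in>tuples N [s]. sat N (z @ c) \<theta> \<and> sat N (z @ a i) \<pi> \<and> sat N z \<kappa>" for i
  proof -
    have "a i \<in> tuples N Ys" "sat N (a i @ c) \<zeta>" using assms(10)[of i] \<zeta>tp by (auto simp: sols_def)
    then show ?thesis using \<zeta>(2) c(3) by blast
  qed
  then obtain z where z: "\<And>i. z i \<in> tuples N [s]" "\<And>i. sat N (z i @ c) \<theta>" "\<And>i. sat N (z i @ a i) \<pi>"
    "\<And>i. sat N (z i) \<kappa>" by metis
  have "range z \<subseteq> sols N [s] {(\<theta>, c)}" using z by (auto simp: sols_def simp del: tuples_singleton)
  then have "finite (z ` UNIV)" using \<theta>(2) finite_subset by blast
  then obtain i0 where i0: "infinite {i. z i = z i0}"
    using pigeonhole_infinite[of "UNIV :: nat set" z] by auto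
  obtain y where y: "z i0 = [y]" "y \<in> univ N s" using z(1)[of i0] by auto
  have "{i. z i = z i0} \<subseteq> {i. sat N (y # a i) \<pi>}"
    using z(3) y by (metis (mono_tags, lifting) Collect_mono append_Cons append_Nil)
  then have "infinite {i. sat N (y # a i) \<pi>}" using i0 finite_subset by blast
  then show thesis using that[of y] y z(4)[of i0] by simp
qed

end

text \<open>\<open>good\<close> abstracts from smallness of parameter sets, and \<open>code\<close> is elimination of imaginaries.\<close>

locale rich = mstruct L N
  for L :: "('s, 'f, 'r) signature" and N :: "('s, 'f, 'r, 'a) struct" +
  fixes good :: "'a set \<Rightarrow> bool"
  assumes good_empty: "good {}"
    and good_Un: "good B \<Longrightarrow> finite F \<Longrightarrow> F \<subseteq> points L N \<Longrightarrow> good (B \<union> F)"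
    and realize_family: "good B \<Longrightarrow> ultra U \<Longrightarrow> eventually (\<lambda>g. g \<in> mstruct.envs N \<Gamma>) U \<Longrightarrow>
      (\<And>i::nat. set (\<Gamma> i) \<subseteq> Sorts L) \<Longrightarrow>
      \<exists>g\<in>mstruct.envs N \<Gamma>. \<forall>vs Zs \<phi> c. set c \<subseteq> B \<longrightarrow> set Zs \<subseteq> Sorts L \<longrightarrow> c \<in> tuples N Zs \<longrightarrow>
        wff L (concat (map \<Gamma> vs) @ Zs) \<phi> \<longrightarrow>
        eventually (\<lambda>g. sat N (concat (map g vs) @ c) \<phi>) U \<longrightarrow> sat N (concat (map g vs) @ c) \<phi>"
    and code: "set Ys \<subseteq> Sorts L \<Longrightarrow> set Zs \<subseteq> Sorts L \<Longrightarrow> wff L (Ys @ Zs) \<phi> \<Longrightarrow> m \<in> tuples N Zs \<Longrightarrow>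
      \<exists>s\<in>Sorts L. \<exists>e\<in>univ N s. \<exists>\<rho>. wff L (Ys @ [s]) \<rho> \<and>
        (\<forall>y\<in>tuples N Ys. sat N (y @ [e]) \<rho> \<longleftrightarrow> sat N (y @ m) \<phi>) \<and>
        (\<forall>e1\<in>univ N s. \<forall>e2\<in>univ N s.
          (\<forall>y\<in>tuples N Ys. sat N (y @ [e1]) \<rho> \<longleftrightarrow> sat N (y @ [e2]) \<rho>) \<longrightarrow> e1 = e2)"
begin

lemma realize_tuple:
  assumes "good B" and "ultra U" and "eventually (\<lambda>x. x \<in> tuples N Xs) U" and "set Xs \<subseteq> Sorts L"
  obtains a where "a \<in> tuples N Xs"
    and "\<And>\<phi> c. (\<phi>, c) \<in> insts L N Xs B \<Longrightarrow> sat N (a @ c) \<phi> \<longleftrightarrow> eventually (\<lambda>x. sat N (x @ c) \<phi>) U"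
proof -
  \<comment> \<open>A single tuple is treated as a constant family, of which only block 0 is
    read.\<close>
  let ?U = "filtermap (\<lambda>x (i::nat). x) U" and ?\<Gamma> = "\<lambda>i::nat. Xs"
  have "\<exists>g\<in>envs ?\<Gamma>. \<forall>vs Zs \<phi> c. set c \<subseteq> B \<longrightarrow> set Zs \<subseteq> Sorts L \<longrightarrow> c \<in> tuples N Zs \<longrightarrow>
        wff L (concat (map ?\<Gamma> vs) @ Zs) \<phi> \<longrightarrow>
        eventually (\<lambda>g. sat N (concat (map g vs) @ c) \<phi>) ?U \<longrightarrow> sat N (concat (map g vs) @ c) \<phi>"
    by (rule realize_family) (use assms in \<open>auto simp: ultra_filtermap eventually_filtermap envs_def\<close>)
  then obtain g where g: "g \<in> envs ?\<Gamma>" "\<And>vs Zs \<phi> c. set c \<subseteq> B \<Longrightarrow> set Zs \<subseteq> Sorts L \<Longrightarrow> c \<in> tuples N Zs \<Longrightarrow>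
        wff L (concat (map ?\<Gamma> vs) @ Zs) \<phi> \<Longrightarrow>
        eventually (\<lambda>g. sat N (concat (map g vs) @ c) \<phi>) ?U \<Longrightarrow> sat N (concat (map g vs) @ c) \<phi>"
    by blast
  have *: "sat N (g 0 @ c) \<phi>" if "(\<phi>, c) \<in> insts L N Xs B" "eventually (\<lambda>x. sat N (x @ c) \<phi>) U" for \<phi> c
  proof -
    from that(1) obtain Zs where "set c \<subseteq> B" "set Zs \<subseteq> Sorts L" "c \<in> tuples N Zs" "wff L (Xs @ Zs) \<phi>"
      by (auto simp: insts_def)
    then show ?thesis using g(2)[of c Zs "[0]" \<phi>] that(2) by (simp add: eventually_filtermap)
  qed
  show thesis
  proof (rule that[of "g 0"])
    show "g 0 \<in> tuples N Xs" using g(1) by (simp add: envs_def)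
    fix \<phi> c assume \<phi>: "(\<phi>, c) \<in> insts L N Xs B"
    then have "(Neg \<phi>, c) \<in> insts L N Xs B" by (auto simp: insts_def)
    from *[OF \<phi>] *[OF this] show "sat N (g 0 @ c) \<phi> \<longleftrightarrow> eventually (\<lambda>x. sat N (x @ c) \<phi>) U"
      by (auto simp: ultra_not[OF assms(2)])
  qed
qed

text \<open>Allows infinitely many blocks at once, as ladders and trees require. An ultrafilter that
  concentrates on every member of \<open>\<P>\<close> is realized over the empty parameter
  set.\<close>

lemma compactness:
  fixes \<Gamma> :: "nat \<Rightarrow> 's list"
  assumes "\<And>P. P \<in> \<P> \<Longrightarrow> defn \<Gamma> P" and "\<And>i. set (\<Gamma> i) \<subseteq> Sorts L"
    and "\<And>F. finite F \<Longrightarrow> F \<subseteq> \<P> \<Longrightarrow> \<exists>g\<in>envs \<Gamma>. \<forall>P\<in>F. P g"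
  obtains g where "g \<in> envs \<Gamma>" and "\<And>P. P \<in> \<P> \<Longrightarrow> P g"
proof -
  let ?S = "insert (envs \<Gamma>) (Collect ` \<P>)"
  have "\<Inter> F \<noteq> {}" if F: "finite F" "F \<subseteq> ?S" for F
  proof -
    have "finite (F - {envs \<Gamma>})" "F - {envs \<Gamma>} \<subseteq> Collect ` \<P>" using F by auto
    then obtain G where G: "finite G" "G \<subseteq> \<P>" "F - {envs \<Gamma>} = Collect ` G" by (meson finite_subset_image)
    obtain g where g: "g \<in> envs \<Gamma>" "\<forall>P\<in>G. P g" using assms(3)[OF G(1,2)] by blast
    have "g \<in> X" if "X \<in> F" for X
    proof (cases "X = envs \<Gamma>")
      case False
      then have "X \<in> Collect ` G" using that G(3) by blast
      then show ?thesis using g(2) by auto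
    qed (use g in simp)
    then show ?thesis by blast
  qed
  then obtain U where U: "ultra U" "\<And>X. X \<in> ?S \<Longrightarrow> eventually (\<lambda>x. x \<in> X) U"
    using ultra_extending[of ?S] by metis
  have evE: "eventually (\<lambda>g. g \<in> envs \<Gamma>) U" using U(2) by blast
  obtain g where g: "g \<in> envs \<Gamma>" "\<forall>vs Zs \<phi> c. set c \<subseteq> {} \<longrightarrow> set Zs \<subseteq> Sorts L \<longrightarrow> c \<in> tuples N Zs \<longrightarrow>
        wff L (concat (map \<Gamma> vs) @ Zs) \<phi> \<longrightarrow>
        eventually (\<lambda>g. sat N (concat (map g vs) @ c) \<phi>) U \<longrightarrow> sat N (concat (map g vs) @ c) \<phi>"
    using realize_family[OF good_empty U(1) evE assms(2)] by blast
  show thesis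
  proof (rule that[OF g(1)])
    fix P assume P: "P \<in> \<P>"
    then obtain vs \<phi> where \<phi>: "wff L (concat (map \<Gamma> vs)) \<phi>"
      "\<And>g. g \<in> envs \<Gamma> \<Longrightarrow> P g \<longleftrightarrow> sat N (concat (map g vs)) \<phi>"
      using assms(1)[OF P] unfolding defn_def by blast
    have "eventually P U" using U(2)[of "Collect P"] P by auto
    with evE have "eventually (\<lambda>g. sat N (concat (map g vs)) \<phi>) U"
      by eventually_elim (use \<phi>(2) in blast)
    then show "P g" using g(2)[rule_format, of "[]" "[]" vs \<phi>] \<phi> g(1) by simp
  qed
qed

text \<open>Stability only excludes infinite ladders; ladders of every finite length would yield an
  infinite one by compactness.\<close>

lemma ladder_bound:
  assumes "stable_formula N Xs Ys \<phi>" and "wff L (Xs @ Ys) \<phi>" and "set (Xs @ Ys) \<subseteq> Sorts L"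
  obtains m :: nat where "\<And>a b. (\<And>i. i < m \<Longrightarrow> a i \<in> tuples N Xs \<and> b i \<in> tuples N Ys) \<Longrightarrow>
    (\<And>i j. i < m \<Longrightarrow> j < m \<Longrightarrow> sat N (a i @ b j) \<phi> \<longleftrightarrow> i < j) \<Longrightarrow> False"
proof (rule ccontr)
  assume "\<not> thesis"
  then have long: "\<exists>a b. (\<forall>i<m. a i \<in> tuples N Xs \<and> b i \<in> tuples N Ys) \<and>
      (\<forall>i<m. \<forall>j<m. sat N (a i @ b j) \<phi> \<longleftrightarrow> i < j)" for m :: nat
    using that[of m] by blast
  obtain x0 y0 where dummy: "x0 \<in> tuples N Xs" "y0 \<in> tuples N Ys" using tuples_nonempty assms(3) by fastforce
  \<comment> \<open>Even blocks hold the left side of the ladder, odd blocks the right side.\<close>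
  let ?\<Gamma> = "\<lambda>i::nat. if even i then Xs else Ys"
  define C where "C = (\<lambda>(i::nat, j) g. sat N (g (2 * i) @ g (2 * j + 1)) \<phi> \<longleftrightarrow> i < j)"
  obtain g where g: "g \<in> envs ?\<Gamma>" "\<And>P. P \<in> range C \<Longrightarrow> P g"
  proof (rule compactness[of "range C" ?\<Gamma>])
    show "defn ?\<Gamma> P" if "P \<in> range C" for P
    proof -
      obtain i j where P: "P = C (i, j)" using \<open>P \<in> range C\<close> by auto
      show "defn ?\<Gamma> P" unfolding P C_def case_prod_conv
        by (intro defn_iff defn_const defn_sat2) (use assms in simp)
    qed
    show "set (?\<Gamma> i) \<subseteq> Sorts L" for i using assms(3) by simp
    fix F assume F: "finite F" "F \<subseteq> range C"
    then obtain I where I: "finite I" "F = C ` I" by (meson finite_subset_image)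
    then have "finite (fst ` I \<union> snd ` I)" by simp
    then obtain m where m: "\<forall>k\<in>fst ` I \<union> snd ` I. k < m" unfolding finite_nat_set_iff_bounded by blast
    obtain a b where ab: "\<And>i. i < m \<Longrightarrow> a i \<in> tuples N Xs" "\<And>i. i < m \<Longrightarrow> b i \<in> tuples N Ys"
      "\<And>i j. i < m \<Longrightarrow> j < m \<Longrightarrow> sat N (a i @ b j) \<phi> \<longleftrightarrow> i < j" using long[of m] by blast
    let ?g = "\<lambda>n. if even n then (if n div 2 < m then a (n div 2) else x0)
        else (if n div 2 < m then b (n div 2) else y0)"
    have "?g \<in> envs ?\<Gamma>" using ab dummy by (auto simp: envs_def)
    moreover have "C (i, j) ?g" if "(i, j) \<in> I" for i j
    proof -
      have "i < m" "j < m" using m that by force+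
      then show ?thesis using ab(3) by (simp add: C_def)
    qed
    then have "\<forall>P\<in>F. P ?g" unfolding I(2) by auto
    ultimately show "\<exists>g\<in>envs ?\<Gamma>. \<forall>P\<in>F. P g" by blast
  qed blast
  have "g i \<in> tuples N (?\<Gamma> i)" for i using g(1) unfolding envs_def by blast
  from this[of "2 * i" for i] this[of "2 * i + 1" for i]
  have g1: "g (2 * i) \<in> tuples N Xs" and g2: "g (Suc (2 * i)) \<in> tuples N Ys" for i by simp_all
  have g3: "sat N (g (2 * i) @ g (Suc (2 * j))) \<phi> \<longleftrightarrow> i < j" for i j
    using g(2)[OF rangeI, of "(i, j)"] by (simp add: C_def)
  have "\<not> stable_formula N Xs Ys \<phi>" unfolding stable_formula_def not_not
    by (rule exI[of _ "\<lambda>i. g (2 * i)"], rule exI[of _ "\<lambda>i. g (Suc (2 * i))"]) (simp add: g1 g2 g3)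
  then show False using assms(1) by blast
qed

text \<open>Suppose that there are finitely many realizations. No formula of the type is algebraic,
  so every finite part has a solution outside them. An ultrafilter collecting these conditions is
  realized over \<open>B\<close> and the entries of the finitely many realizations, which gives one
  more realization.\<close>

lemma infinite_realizations:
  assumes "good B" and "set Ys \<subseteq> Sorts L" and "a \<in> tuples N Ys"
    and "\<not> algebraic N Ys (tp L N Ys B a)"
  shows "infinite (sols N Ys (tp L N Ys B a))"
proof
  let ?p = "tp L N Ys B a"
  let ?S = "sols N Ys ?p"
  assume fin: "finite ?S"
  have "\<Inter> F \<noteq> {}" if F: "finite F" "F \<subseteq> (\<lambda>\<psi>. sols N Ys {\<psi>} - ?S) ` ?p" for F
  proof -
    obtain G where G: "finite G" "G \<subseteq> ?p" "F = (\<lambda>\<psi>. sols N Ys {\<psi>} - ?S) ` G"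
      using finite_subset_image[OF F] by blast
    obtain \<psi> where \<psi>: "\<psi> \<in> insts L N Ys B" "sols N Ys {\<psi>} = sols N Ys G"
    proof -
      have "G \<subseteq> insts L N Ys B" using G(2) by (auto simp: tp_def)
      from insts_conj[OF G(1) this] that show thesis by blast
    qed
    have "a \<in> sols N Ys G" using G(2) assms(3) by (auto simp: sols_def tp_def)
    then have "\<psi> \<in> ?p" using \<psi> by (auto simp: tp_def sols_def)
    then have "infinite (sols N Ys G)" using assms(4) \<psi>(2) by (auto simp: algebraic_def)
    then have "sols N Ys G - ?S \<noteq> {}" using fin by (metis Diff_eq_empty_iff finite_subset)
    then show ?thesis unfolding G(3) by (auto simp: sols_def)
  qed
  then obtain U where U: "ultra U" "\<And>\<psi>. \<psi> \<in> ?p \<Longrightarrow> eventually (\<lambda>x. x \<in> sols N Ys {\<psi>} - ?S) U"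
  proof (rule ultra_extending)
    fix U assume "ultra U" "\<And>X. X \<in> (\<lambda>\<psi>. sols N Ys {\<psi>} - ?S) ` ?p \<Longrightarrow> eventually (\<lambda>x. x \<in> X) U"
    then show thesis using that[of U] by blast
  qed
  have "?p \<noteq> {}"
  proof -
    obtain \<psi> where "\<psi> \<in> insts L N Ys B" "sols N Ys {\<psi>} = sols N Ys {}"
      using insts_conj[of "{}" Ys B] by auto
    then have "\<psi> \<in> ?p" using assms(3) by (auto simp: tp_def sols_def)
    then show ?thesis by blast
  qed
  then obtain \<psi>0 where "\<psi>0 \<in> ?p" by blast
  have sub: "sols N Ys p \<subseteq> tuples N Ys" for p by (auto simp: sols_def)
  from U(2)[OF \<open>\<psi>0 \<in> ?p\<close>] have evS: "eventually (\<lambda>x. x \<in> tuples N Ys \<and> x \<notin> ?S) U"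
    by eventually_elim (use sub in blast)
  then have evT: "eventually (\<lambda>x. x \<in> tuples N Ys) U" by eventually_elim simp
  have pts: "\<Union> (set ` ?S) \<subseteq> points L N" using tuples_points[OF assms(2)] sub[of ?p] by blast
  have "good (B \<union> \<Union> (set ` ?S))" by (rule good_Un[OF assms(1) _ pts]) (use fin in simp)
  then obtain x where x: "x \<in> tuples N Ys" "\<And>\<phi> c. (\<phi>, c) \<in> insts L N Ys (B \<union> \<Union> (set ` ?S)) \<Longrightarrow>
      sat N (x @ c) \<phi> \<longleftrightarrow> eventually (\<lambda>x. sat N (x @ c) \<phi>) U"
    using realize_tuple[OF _ U(1) evT assms(2)] by blast
  have "x \<in> ?S"
  proof -
    have "sat N (x @ b) \<phi>" if \<phi>: "(\<phi>, b) \<in> ?p" for \<phi> b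
    proof -
      have "(\<phi>, b) \<in> insts L N Ys (B \<union> \<Union> (set ` ?S))" using \<phi> by (auto simp: tp_def insts_def)
      moreover have "eventually (\<lambda>x. sat N (x @ b) \<phi>) U"
        using U(2)[OF \<phi>] by eventually_elim (auto simp: sols_def)
      ultimately show ?thesis using x(2) by blast
    qed
    then show ?thesis using x(1) by (auto simp: sols_def)
  qed
  obtain \<delta> where \<delta>: "wff L (Ys @ Ys) \<delta>"
    "\<And>y z. y \<in> tuples N Ys \<Longrightarrow> z \<in> tuples N Ys \<Longrightarrow> sat N (y @ z) \<delta> \<longleftrightarrow> y = z"
    using defn_fm2[OF defn_eq[of "blk [Ys, Ys]" 0 1]] assms(2) by (auto simp del: One_nat_def)
  have "(\<delta>, x) \<in> insts L N Ys (B \<union> \<Union> (set ` ?S))"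
    using \<delta>(1) x(1) \<open>x \<in> ?S\<close> assms(2) unfolding insts_def by blast
  moreover have "sat N (x @ x) \<delta>" using \<delta>(2) x(1) by blast
  ultimately have "eventually (\<lambda>y. sat N (y @ x) \<delta>) U" using x(2) by blast
  with evS have "eventually (\<lambda>y. y \<notin> ?S \<and> y = x) U"
    by eventually_elim (use \<delta>(2) x(1) in blast)
  then show False using ultra_ex[OF U(1)] \<open>x \<in> ?S\<close> by blast
qed

section \<open>From strong dividing to dividing, and global types without thorn-dividing
  formulas\<close>

lemma strongly_divides_imp_divides:
  assumes "strongly_divides L N Xs (A \<union> C) \<psi>" and "good (A \<union> C)"
  shows "divides L N Xs A \<psi>"
proof -
  obtain \<delta> a where \<psi>: "\<psi> = (\<delta>, a)" by force
  from assms(1) obtain Ys k where Ys: "set Ys \<subseteq> Sorts L" "a \<in> tuples N Ys" "wff L (Xs @ Ys) \<delta>"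
    and nonalg: "\<not> algebraic N Ys (tp L N Ys (A \<union> C) a)"
    and k: "k_inconsistent N Xs \<delta> (sols N Ys (tp L N Ys (A \<union> C) a)) k"
    unfolding \<psi> strongly_divides_def by auto
  \<comment> \<open>Strong dividing counts distinct parameters while dividing counts indices;
    injectivity of the sequence reconciles the two.\<close>
  obtain a' :: "nat \<Rightarrow> 'a list" where a': "inj a'" "range a' \<subseteq> sols N Ys (tp L N Ys (A \<union> C) a)"
    using infinite_countable_subset[OF infinite_realizations[OF assms(2) Ys(1,2) nonalg]] by blast
  have "tp L N Ys A a \<subseteq> tp L N Ys (A \<union> C) a" by (auto simp: tp_def insts_def)
  then have "a' i \<in> sols N Ys (tp L N Ys A a)" for i using a'(2) unfolding sols_def by blast
  moreover have "sols N Xs {(\<delta>, a' i) | i. i \<in> I} = {}" if "finite I" "card I = k" for I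
  proof -
    have "card (a' ` I) = k" using that a'(1) by (metis card_image inj_on_subset subset_UNIV)
    moreover have "a' ` I \<subseteq> sols N Ys (tp L N Ys (A \<union> C) a)" using a'(2) by blast
    ultimately have "sols N Xs {(\<delta>, b) | b. b \<in> a' ` I} = {}"
      using k that(1) unfolding k_inconsistent_def by blast
    moreover have "{(\<delta>, b) | b. b \<in> a' ` I} = {(\<delta>, a' i) | i. i \<in> I}" by blast
    ultimately show ?thesis by simp
  qed
  ultimately show ?thesis unfolding \<psi> divides_def case_prod_conv
    by (intro exI[of _ Ys] conjI exI[of _ a'] exI[of _ k]) (use Ys in auto)
qed

lemma thorn_forks_imp_forks:
  assumes "good A" and "thorn_forks L N Xs A q"
  shows "forks L N Xs A q"
proof -
  obtain \<phi> F where \<phi>: "\<phi> \<in> q" and F: "finite F" "\<forall>\<psi>\<in>F. thorn_divides L N Xs A \<psi>"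
    "sols N Xs {\<phi>} \<subseteq> (\<Union>\<psi>\<in>F. sols N Xs {\<psi>})"
    using assms(2) unfolding thorn_forks_def thorn_forks_formula_def by blast
  have "\<forall>\<psi>\<in>F. divides L N Xs A \<psi>"
  proof
    fix \<psi> assume "\<psi> \<in> F"
    then obtain c where c: "set c \<subseteq> points L N" "strongly_divides L N Xs (A \<union> set c) \<psi>"
      using F(2) unfolding thorn_divides_def by blast
    show "divides L N Xs A \<psi>"
      by (rule strongly_divides_imp_divides[OF c(2) good_Un[OF assms(1) finite_set c(1)]])
  qed
  moreover have "sols N Xs q \<subseteq> sols N Xs {\<phi>}" using \<phi> by (auto simp: sols_def)
  ultimately show ?thesis unfolding forks_def
    by (intro exI[of _ F] conjI F(1) subset_trans[OF _ F(3)])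
qed

text \<open>Thorn-forking of a type is thorn-forking of one of its formulas, so a finite part of
  \<open>q\<close> is replaced by a single formula of \<open>q\<close>. Such a formula is not
  covered by finitely many thorn-dividing ones, which is the finite intersection property
  required.\<close>

lemma thorn_nonforking_ultrafilter:
  assumes "q \<in> complete_types L N Xs B" and "\<not> thorn_forks L N Xs A q"
  obtains U where "ultra U" and "eventually (\<lambda>x. x \<in> tuples N Xs) U"
    and "\<And>\<phi> b. (\<phi>, b) \<in> q \<Longrightarrow> eventually (\<lambda>x. sat N (x @ b) \<phi>) U"
    and "\<And>\<psi>. thorn_divides L N Xs A \<psi> \<Longrightarrow> \<not> eventually (\<lambda>x. x \<in> sols N Xs {\<psi>}) U"
proof -
  let ?s = "\<lambda>\<psi>. sols N Xs {\<psi>}" and ?D = "{\<psi>. thorn_divides L N Xs A \<psi>}"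
  have fip: "\<Inter> F \<noteq> {}" if F: "finite F" "F \<subseteq> ?s ` q \<union> (\<lambda>\<psi>. - ?s \<psi>) ` ?D" for F
  proof -
    have "finite (F \<inter> ?s ` q)" "F \<inter> ?s ` q \<subseteq> ?s ` q" using F by auto
    then obtain G where G: "finite G" "G \<subseteq> q" "F \<inter> ?s ` q = ?s ` G" by (meson finite_subset_image)
    have "finite (F - ?s ` q)" "F - ?s ` q \<subseteq> (\<lambda>\<psi>. - ?s \<psi>) ` ?D" using F by auto
    then obtain H where H: "finite H" "H \<subseteq> ?D" "F - ?s ` q = (\<lambda>\<psi>. - ?s \<psi>) ` H"
      by (meson finite_subset_image)
    obtain \<psi> where \<psi>: "\<psi> \<in> q" "?s \<psi> = sols N Xs G" using complete_type_conj[OF assms(1) G(1,2)] by blast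
    have "\<not> ?s \<psi> \<subseteq> (\<Union>\<theta>\<in>H. ?s \<theta>)"
    proof
      assume "?s \<psi> \<subseteq> (\<Union>\<theta>\<in>H. ?s \<theta>)"
      moreover have "\<forall>\<theta>\<in>H. thorn_divides L N Xs A \<theta>" using H(2) by blast
      ultimately have "thorn_forks_formula L N Xs A \<psi>"
        unfolding thorn_forks_formula_def by (intro exI[of _ H] conjI H(1))
      then show False using assms(2) \<psi>(1) unfolding thorn_forks_def by blast
    qed
    then obtain x where x: "x \<in> ?s \<psi>" "x \<notin> (\<Union>\<theta>\<in>H. ?s \<theta>)" unfolding subset_iff by metis
    have "x \<in> X" if "X \<in> F" for X
    proof (cases "X \<in> ?s ` q")
      case True
      then have "X \<in> ?s ` G" using G(3) that by blast
      then obtain \<theta> where \<theta>: "\<theta> \<in> G" "X = ?s \<theta>" by blast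
      then have "sols N Xs G \<subseteq> X" by (simp add: sols_antimono)
      then show ?thesis using x(1) unfolding \<psi>(2) by (rule subsetD)
    next
      case False
      then have "X \<in> (\<lambda>\<psi>. - ?s \<psi>) ` H" using H(3) that by blast
      then obtain \<theta> where "\<theta> \<in> H" "X = - ?s \<theta>" by blast
      then show ?thesis using x(2) by simp
    qed
    then show ?thesis by auto
  qed
  obtain U where U: "ultra U"
    "\<And>X. X \<in> ?s ` q \<union> (\<lambda>\<psi>. - ?s \<psi>) ` ?D \<Longrightarrow> eventually (\<lambda>x. x \<in> X) U"
    by (rule ultra_extending[of "?s ` q \<union> (\<lambda>\<psi>. - ?s \<psi>) ` ?D"]) (erule (1) fip, blast)
  have q: "eventually (\<lambda>x. x \<in> ?s \<psi>) U" if "\<psi> \<in> q" for \<psi> using U(2)[OF UnI1[OF imageI[OF that]]] .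
  obtain \<psi> where "\<psi> \<in> q" using complete_type_conj[OF assms(1), of "{}"] by blast
  show thesis
  proof (rule that[OF U(1)])
    show "eventually (\<lambda>x. x \<in> tuples N Xs) U"
      using q[OF \<open>\<psi> \<in> q\<close>] by eventually_elim (simp add: sols_def)
    show "eventually (\<lambda>x. sat N (x @ b) \<phi>) U" if "(\<phi>, b) \<in> q" for \<phi> b
      using q[OF that] by eventually_elim (simp add: sols_def)
    fix \<psi> assume "thorn_divides L N Xs A \<psi>"
    then have "- ?s \<psi> \<in> (\<lambda>\<psi>. - ?s \<psi>) ` ?D" by simp
    from U(2)[OF UnI2[OF this]] have "eventually (\<lambda>x. x \<in> - ?s \<psi>) U" .
    then show "\<not> eventually (\<lambda>x. x \<in> ?s \<psi>) U" using ultra_not[OF U(1)] by simp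
  qed
qed

end


section \<open>Codes of stable types\<close>

context rich
begin

text \<open>The majority rule defines the \<phi>-part of \<open>U\<close> by a formula with finitely
  many parameters, which can be coded. The code has to be there before realizations over it can be
  chosen, so the majority rule is used twice: here with no demand on the realizations, and again for
  the algebraicity of the code.\<close>

lemma code_exists:
  assumes "stable_formula N Xs Ys \<phi>" and "wff L (Xs @ Ys) \<phi>" and sorts: "set (Xs @ Ys) \<subseteq> Sorts L"
    and "ultra U" and evT: "eventually (\<lambda>x. x \<in> tuples N Xs) U"
  obtains s e \<rho> where "s \<in> Sorts L" and "e \<in> univ N s" and "wff L (Ys @ [s]) \<rho>"
    and "\<And>b. b \<in> tuples N Ys \<Longrightarrow> sat N (b @ [e]) \<rho> \<longleftrightarrow> eventually (\<lambda>x. sat N (x @ b) \<phi>) U"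
    and "\<And>e1 e2. e1 \<in> univ N s \<Longrightarrow> e2 \<in> univ N s \<Longrightarrow>
      (\<And>b. b \<in> tuples N Ys \<Longrightarrow> sat N (b @ [e1]) \<rho> \<longleftrightarrow> sat N (b @ [e2]) \<rho>) \<Longrightarrow> e1 = e2"
proof -
  let ?D = "\<lambda>b. eventually (\<lambda>x. sat N (x @ b) \<phi>) U"
  obtain m :: nat where m: "\<And>a b. (\<And>i. i < m \<Longrightarrow> a i \<in> tuples N Xs \<and> b i \<in> tuples N Ys) \<Longrightarrow>
    (\<And>i j. i < m \<Longrightarrow> j < m \<Longrightarrow> sat N (a i @ b j) \<phi> \<longleftrightarrow> i < j) \<Longrightarrow> False"
    by (rule ladder_bound[OF assms(1-3)]) blast
  have step: "\<exists>a\<in>tuples N Xs. True \<and> (\<forall>b\<in>B. sat N (a @ b) \<phi> \<longleftrightarrow> ?D b)" if "finite B" for B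
  proof -
    have "eventually (\<lambda>x. sat N (x @ b) \<phi> \<longleftrightarrow> ?D b) U" for b
      using ultra_not[OF assms(4), of "\<lambda>x. sat N (x @ b) \<phi>"] by (cases "?D b") simp_all
    then have "eventually (\<lambda>x. \<forall>b\<in>B. sat N (x @ b) \<phi> \<longleftrightarrow> ?D b) U"
      using that by (intro eventually_ball_finite) auto
    from ultra_ex[OF assms(4) eventually_conj[OF evT this]] show ?thesis by blast
  qed
  define K where "K = 2 * m + 2"
  obtain as where as: "length as = K" "set as \<subseteq> tuples N Xs"
    "\<And>b. b \<in> tuples N Ys \<Longrightarrow> ?D b \<longleftrightarrow> m < card {i. i < K \<and> sat N (as ! i @ b) \<phi>}"
    by (rule majority_rule[of m "tuples N Xs" "tuples N Ys" "\<lambda>a b. sat N (a @ b) \<phi>" "\<lambda>_ _. True" ?D])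
      (use m step in \<open>unfold K_def, blast+\<close>)
  let ?Zs = "replicate K Xs"
  have "defn (blk (Ys # ?Zs)) (\<lambda>g. m < card {i. i < K \<and> sat N (g (Suc i) @ g 0) \<phi>})"
    by (rule defn_many[OF assms(2)]) (simp_all add: blk_def)
  then obtain \<theta> where \<theta>: "wff L (concat (Ys # ?Zs)) \<theta>"
    "\<And>es. list_all2 (\<lambda>e \<Gamma>. e \<in> tuples N \<Gamma>) es (Ys # ?Zs) \<Longrightarrow>
      sat N (concat es) \<theta> \<longleftrightarrow> m < card {i. i < K \<and> sat N (blk es (Suc i) @ blk es 0) \<phi>}"
    by (rule defn_fm) blast
  have all: "list_all2 (\<lambda>e \<Gamma>. e \<in> tuples N \<Gamma>) as ?Zs"
    using as(1,2) by (auto simp: list_all2_conv_all_nth)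
  have blk_as: "blk (b # as) (Suc i) = as ! i" if "i < K" for b i using that as(1) by (simp add: blk_def)
  have def: "sat N (b @ concat as) \<theta> \<longleftrightarrow> ?D b" if "b \<in> tuples N Ys" for b
  proof -
    have "{i. i < K \<and> sat N (blk (b # as) (Suc i) @ blk (b # as) 0) \<phi>} = {i. i < K \<and> sat N (as ! i @ b) \<phi>}"
      using blk_as by auto
    then show ?thesis using \<theta>(2)[of "b # as"] all that as(3) by simp
  qed
  have mem: "concat as \<in> tuples N (concat ?Zs)"
    using all
  proof (induction rule: list_all2_induct)
    case (Cons x xs y ys)
    then show ?case by (simp add: tuples_appendI)
  qed simp
  have "\<exists>s\<in>Sorts L. \<exists>e\<in>univ N s. \<exists>\<rho>. wff L (Ys @ [s]) \<rho> \<and>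
        (\<forall>y\<in>tuples N Ys. sat N (y @ [e]) \<rho> \<longleftrightarrow> sat N (y @ concat as) \<theta>) \<and>
        (\<forall>e1\<in>univ N s. \<forall>e2\<in>univ N s.
          (\<forall>y\<in>tuples N Ys. sat N (y @ [e1]) \<rho> \<longleftrightarrow> sat N (y @ [e2]) \<rho>) \<longrightarrow> e1 = e2)"
    by (rule code[OF _ _ _ mem]) (use sorts \<theta>(1) in auto)
  then obtain s e \<rho> where "s \<in> Sorts L" "e \<in> univ N s" "wff L (Ys @ [s]) \<rho>"
    "\<forall>y\<in>tuples N Ys. sat N (y @ [e]) \<rho> \<longleftrightarrow> sat N (y @ concat as) \<theta>"
    "\<forall>e1\<in>univ N s. \<forall>e2\<in>univ N s.
      (\<forall>y\<in>tuples N Ys. sat N (y @ [e1]) \<rho> \<longleftrightarrow> sat N (y @ [e2]) \<rho>) \<longrightarrow> e1 = e2" by blast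
  then show thesis using def by (intro that[of s e \<rho>]) simp_all
qed

text \<open>Let \<chi>(x; z, w) say that \<phi>(z, x, w) holds and that fewer than \<open>k\<close>
  elements satisfy \<phi>(-, x, w). It holds at \<open>a\<close> and \<open>e # d\<close>.
  Conjugates of \<open>e # d\<close> over \<open>B\<close> share \<open>d\<close>, so
  \<open>k\<close> of them with a common solution \<open>x\<close> would give \<open>k\<close>
  elements satisfying \<phi>(-, x, d).\<close>

lemma algebraic_step_strongly_divides:
  assumes "s \<in> Sorts L" and "e \<in> univ N s" and Xs: "set Xs \<subseteq> Sorts L" and a: "a \<in> tuples N Xs"
    and nonalg: "\<not> algebraic N [s] (tp L N [s] B [e])"
    and alg: "algebraic N [s] (tp L N [s] (B \<union> set a) [e])"
  obtains \<chi> d where "strongly_divides L N Xs B (\<chi>, e # d)" and "sat N (a @ e # d) \<chi>"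
    and "(\<chi>, e # d) \<in> insts L N Xs (insert e B)"
proof -
  obtain \<eta> d0 where \<eta>: "(\<eta>, d0) \<in> tp L N [s] (B \<union> set a) [e]" "finite (sols N [s] {(\<eta>, d0)})"
    using alg unfolding algebraic_def by auto
  then obtain Zs0 where d0: "set d0 \<subseteq> B \<union> set a" "set Zs0 \<subseteq> Sorts L" "d0 \<in> tuples N Zs0"
      "wff L ([s] @ Zs0) \<eta>" and e\<eta>: "sat N ([e] @ d0) \<eta>"
    unfolding tp_def insts_def by blast
  obtain \<phi> d Zs where d: "d \<in> tuples N Zs" "set Zs \<subseteq> Sorts L" "set d \<subseteq> B" "wff L ([s] @ Xs @ Zs) \<phi>"
    and \<phi>: "\<And>z. z \<in> tuples N [s] \<Longrightarrow> sat N (z @ a @ d) \<phi> \<longleftrightarrow> sat N (z @ d0) \<eta>"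
    by (rule reparametrize[OF d0(4,3,2) a Xs d0(1)]) blast
  \<comment> \<open>One more than the number of solutions over \<open>a\<close>, so that
    \<open>\<not> ?many\<close> is true at \<open>a\<close>.\<close>
  define k where "k = Suc (card (sols N [s] {(\<eta>, d0)}))"
  let ?many = "\<lambda>x w. \<exists>v::nat \<Rightarrow> 'a list. (\<forall>i. v i \<in> tuples N [s]) \<and>
    ((\<forall>i\<in>{..<k}. \<forall>j\<in>{..<k} - {i}. v i \<noteq> v j) \<and> (\<forall>i\<in>{..<k}. sat N (v i @ x @ w) \<phi>))"
  have "defn (blk [Xs, [s], Zs]) (\<lambda>g. \<exists>v. (\<forall>i. v i \<in> tuples N [s]) \<and>
      ((\<forall>i\<in>{..<k}. \<forall>j\<in>{..<k} - {i}. v i \<noteq> v j) \<and> (\<forall>i\<in>{..<k}. sat N (v i @ g 0 @ g 2) \<phi>)))"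
    by (rule defn_ex_family[where n = 3], intro defn_conj defn_ball defn_not defn_eq defn_sat3)
      (use assms(1) d(4) in simp_all)
  then have "defn (blk [Xs, [s], Zs]) (\<lambda>g. sat N (g 1 @ g 0 @ g 2) \<phi> \<and> \<not> ?many (g 0) (g 2))"
    by (intro defn_conj defn_not defn_sat3) (use d(4) in simp_all)
  then obtain \<chi> where \<chi>: "wff L (Xs @ [s] @ Zs) \<chi>"
    "\<And>x z w. x \<in> tuples N Xs \<Longrightarrow> z \<in> tuples N [s] \<Longrightarrow> w \<in> tuples N Zs \<Longrightarrow>
      sat N (x @ z @ w) \<chi> \<longleftrightarrow> sat N (z @ x @ w) \<phi> \<and> \<not> ?many x w"
    by (rule defn_fm3) (simp del: tuples_singleton)
  have nomany: "\<not> ?many a d"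
  proof
    assume "?many a d"
    then obtain v :: "nat \<Rightarrow> 'a list" where v: "\<And>i. v i \<in> tuples N [s]"
      "\<forall>i\<in>{..<k}. \<forall>j\<in>{..<k} - {i}. v i \<noteq> v j" "\<forall>i\<in>{..<k}. sat N (v i @ a @ d) \<phi>" by blast
    have "inj_on v {..<k}" using v(2) unfolding inj_on_def by blast
    then have "card (v ` {..<k}) = k" by (simp add: card_image)
    moreover have "v ` {..<k} \<subseteq> sols N [s] {(\<eta>, d0)}"
      using v(1,3) \<phi> by (auto simp: sols_def simp del: tuples_singleton)
    ultimately have "k \<le> card (sols N [s] {(\<eta>, d0)})" using \<eta>(2) card_mono by metis
    then show False by (simp add: k_def)
  qed
  have es: "[e] \<in> tuples N [s]" using assms(2) by simp
  have sat\<chi>: "sat N (a @ e # d) \<chi>"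
    using \<chi>(2)[OF a es d(1)] \<phi>[OF es] e\<eta> nomany by simp
  have ed: "e # d \<in> tuples N (s # Zs)" using assms(2) d(1) by simp
  have inst: "(\<chi>, e # d) \<in> insts L N Xs (insert e B)"
    unfolding insts_def using ed d \<chi>(1) assms(1) by (auto intro!: exI[of _ "s # Zs"])
  \<comment> \<open>An algebraic formula for \<open>e # d\<close> over \<open>B\<close> would become
    one for \<open>e\<close> over \<open>B\<close> once \<open>d\<close>, whose entries lie in
    \<open>B\<close>, is made a parameter.\<close>
  have "\<not> algebraic N (s # Zs) (tp L N (s # Zs) B (e # d))"
  proof
    assume "algebraic N (s # Zs) (tp L N (s # Zs) B (e # d))"
    then obtain \<theta> b where \<theta>: "(\<theta>, b) \<in> tp L N (s # Zs) B (e # d)" "finite (sols N (s # Zs) {(\<theta>, b)})"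
      unfolding algebraic_def by auto
    then obtain Bs where b: "set b \<subseteq> B" "set Bs \<subseteq> Sorts L" "b \<in> tuples N Bs" "wff L ((s # Zs) @ Bs) \<theta>"
      and sat\<theta>: "sat N ((e # d) @ b) \<theta>" unfolding tp_def insts_def by blast
    have "(\<theta>, d @ b) \<in> tp L N [s] B [e]"
      unfolding tp_def insts_def using b d sat\<theta> by (auto intro!: exI[of _ "Zs @ Bs"] tuples_appendI)
    moreover have "(\<lambda>z. z @ d) ` sols N [s] {(\<theta>, d @ b)} \<subseteq> sols N (s # Zs) {(\<theta>, b)}"
      using d(1) by (auto simp: sols_def)
    then have "finite ((\<lambda>z. z @ d) ` sols N [s] {(\<theta>, d @ b)})" using \<theta>(2) finite_subset by blast
    then have "finite (sols N [s] {(\<theta>, d @ b)})" by (rule finite_imageD) (simp add: inj_on_def)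
    ultimately show False using nonalg unfolding algebraic_def by blast
  qed
  moreover have "k_inconsistent N Xs \<chi> (sols N (s # Zs) (tp L N (s # Zs) B (e # d))) k"
    unfolding k_inconsistent_def
  proof (intro allI impI)
    fix S' assume S': "finite S' \<and> S' \<subseteq> sols N (s # Zs) (tp L N (s # Zs) B (e # d)) \<and> card S' = k"
    \<comment> \<open>As \<open>d\<close> consists of elements of \<open>B\<close>, the type over
      \<open>B\<close> fixes the second component; the conjugates differ in the first entry
      only.\<close>
    obtain \<delta> where \<delta>: "wff L ([s] @ Zs @ Zs) \<delta>"
      "\<And>x y z. x \<in> tuples N [s] \<Longrightarrow> y \<in> tuples N Zs \<Longrightarrow> z \<in> tuples N Zs \<Longrightarrow> sat N (x @ y @ z) \<delta> \<longleftrightarrow> y = z"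
      by (rule defn_fm3[OF defn_eq[of "blk [[s], Zs, Zs]" 1 2]]) (use d(2) in \<open>simp_all del: tuples_singleton\<close>)
    have "sat N ((e # d) @ d) \<delta>" using \<delta>(2)[OF es d(1) d(1)] by simp
    then have "(\<delta>, d) \<in> tp L N (s # Zs) B (e # d)"
      unfolding tp_def insts_def using \<delta>(1) d by auto
    then have sat\<delta>: "sat N (c @ d) \<delta>" "c \<in> tuples N (s # Zs)" if "c \<in> S'" for c
      using S' that unfolding sols_def by blast+
    have "\<exists>z. z \<in> tuples N [s] \<and> c = z @ d" if "c \<in> S'" for c
    proof -
      obtain z y where c: "c = z # y" "z \<in> univ N s" "y \<in> tuples N Zs"
        using sat\<delta>(2)[OF \<open>c \<in> S'\<close>] by (rule tuples_Cons_split)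
      then have "y = d" using sat\<delta>(1)[OF \<open>c \<in> S'\<close>] \<delta>(2)[of "[z]" y d] d(1) by simp
      then show ?thesis using c by (intro exI[of _ "[z]"]) simp
    qed
    then obtain f where f: "\<And>c. c \<in> S' \<Longrightarrow> f c \<in> tuples N [s] \<and> c = f c @ d" by metis
    obtain h where h: "bij_betw h {..<k} S'"
      using S' ex_bij_betw_nat_finite[of S'] by (auto simp: atLeast0LessThan)
    show "sols N Xs {(\<chi>, a') |a'. a' \<in> S'} = {}"
    proof (rule ccontr)
      assume "sols N Xs {(\<chi>, a') |a'. a' \<in> S'} \<noteq> {}"
      then obtain x where x: "x \<in> tuples N Xs" "\<And>c. c \<in> S' \<Longrightarrow> sat N (x @ c) \<chi>" unfolding sols_def by blast
      define v where "v = (\<lambda>i. if i < k then f (h i) else [e])"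
      have hS: "h i \<in> S'" if "i < k" for i using h that unfolding bij_betw_def by blast
      have vs: "v i \<in> tuples N [s]" for i unfolding v_def using f[OF hS] es by auto
      have sat\<phi>: "sat N (v i @ x @ d) \<phi> \<and> \<not> ?many x d" if "i < k" for i
      proof -
        have "h i = v i @ d" using f[OF hS[OF that]] that by (simp add: v_def)
        then have "sat N (x @ v i @ d) \<chi>" using x(2)[OF hS[OF that]] by simp
        then show ?thesis using \<chi>(2)[OF x(1) vs d(1)] by blast
      qed
      have "v i \<noteq> v j" if "i < k" "j < k" "i \<noteq> j" for i j
      proof
        assume "v i = v j"
        then have "h i = h j" using f[OF hS[OF that(1)]] f[OF hS[OF that(2)]] that by (simp add: v_def)
        then show False using h that unfolding bij_betw_def inj_on_def by blast
      qed
      then have "?many x d" using vs sat\<phi> by (intro exI[of _ v]) (simp del: tuples_singleton)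
      \<comment> \<open>At least one instance of \<chi> is needed to extract the clause
        \<open>\<not> ?many x d\<close> that is being contradicted.\<close>
      moreover have "0 < k" by (simp add: k_def)
      ultimately show False using sat\<phi> by blast
    qed
  qed
  ultimately have "strongly_divides L N Xs B (\<chi>, e # d)"
    unfolding strongly_divides_def case_prod_conv
    using ed d(2) assms(1) \<chi>(1) by (intro exI[of _ "s # Zs"]) auto
  then show thesis using sat\<chi> inst by (rule that)
qed

text \<open>The code is definable from the first realizations of the type, hence becomes algebraic along
  them; at the step where this happens the type would contain a formula dividing strongly.\<close>

lemma code_algebraic:
  assumes "stable_formula N Xs Ys \<phi>" and "wff L (Xs @ Ys) \<phi>" and sorts: "set (Xs @ Ys) \<subseteq> Sorts L"
    and "ultra U" and evT: "eventually (\<lambda>x. x \<in> tuples N Xs) U" and "good A"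
    and nothorn: "\<And>\<psi>. thorn_divides L N Xs A \<psi> \<Longrightarrow> \<not> eventually (\<lambda>x. x \<in> sols N Xs {\<psi>}) U"
  obtains s e \<rho> where "s \<in> Sorts L" and "e \<in> univ N s" and "wff L (Ys @ [s]) \<rho>"
    and "\<And>b. b \<in> tuples N Ys \<Longrightarrow> sat N (b @ [e]) \<rho> \<longleftrightarrow> eventually (\<lambda>x. sat N (x @ b) \<phi>) U"
    and "algebraic N [s] (tp L N [s] A [e])"
proof -
  let ?D = "\<lambda>b. eventually (\<lambda>x. sat N (x @ b) \<phi>) U"
  obtain s e \<rho> where s: "s \<in> Sorts L" and e: "e \<in> univ N s" and \<rho>: "wff L (Ys @ [s]) \<rho>"
    and \<rho>D: "\<And>b. b \<in> tuples N Ys \<Longrightarrow> sat N (b @ [e]) \<rho> \<longleftrightarrow> ?D b"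
    and uniq: "\<And>e1 e2. e1 \<in> univ N s \<Longrightarrow> e2 \<in> univ N s \<Longrightarrow>
      (\<And>b. b \<in> tuples N Ys \<Longrightarrow> sat N (b @ [e1]) \<rho> \<longleftrightarrow> sat N (b @ [e2]) \<rho>) \<Longrightarrow> e1 = e2"
    by (rule code_exists[OF assms(1-5)]) blast
  obtain m :: nat where m: "\<And>a b. (\<And>i. i < m \<Longrightarrow> a i \<in> tuples N Xs \<and> b i \<in> tuples N Ys) \<Longrightarrow>
    (\<And>i j. i < m \<Longrightarrow> j < m \<Longrightarrow> sat N (a i @ b j) \<phi> \<longleftrightarrow> i < j) \<Longrightarrow> False"
    by (rule ladder_bound[OF assms(1-3)]) blast
  \<comment> \<open>Each entry realizes \<open>U\<close> over \<open>A\<close>, the code and the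
    previous entries. Since \<open>e\<close> is among the parameters, a formula with parameter
    \<open>e\<close> that is true at an entry belongs to \<open>U\<close>.\<close>
  define R where "R = (\<lambda>as a. \<forall>\<psi> c. (\<psi>, c) \<in> insts L N Xs (insert e A \<union> set (concat as)) \<longrightarrow>
    (sat N (a @ c) \<psi> \<longleftrightarrow> eventually (\<lambda>x. sat N (x @ c) \<psi>) U))"
  have Xs: "set Xs \<subseteq> Sorts L" and Ys: "set Ys \<subseteq> Sorts L" using sorts by auto
  have epts: "e \<in> points L N" using s e unfolding points_def by blast
  have step: "\<exists>a\<in>tuples N Xs. R as a \<and> (\<forall>b\<in>B. sat N (a @ b) \<phi> \<longleftrightarrow> ?D b)"
    if as: "set as \<subseteq> tuples N Xs" and B: "finite B" "B \<subseteq> tuples N Ys" for as B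
  proof -
    let ?F = "insert e (set (concat as) \<union> \<Union> (set ` B))"
    have "set (concat as) \<subseteq> points L N" using as tuples_points[OF Xs] by fastforce
    moreover have "\<Union> (set ` B) \<subseteq> points L N" using B(2) tuples_points[OF Ys] by blast
    ultimately have "?F \<subseteq> points L N" using epts by simp
    then have "good (A \<union> ?F)" by (intro good_Un[OF assms(6)]) (use B(1) in simp_all)
    then obtain a where a: "a \<in> tuples N Xs" "\<And>\<psi> c. (\<psi>, c) \<in> insts L N Xs (A \<union> ?F) \<Longrightarrow>
        sat N (a @ c) \<psi> \<longleftrightarrow> eventually (\<lambda>x. sat N (x @ c) \<psi>) U"
      using realize_tuple[OF _ assms(4) evT Xs] by blast
    have "(\<psi>, c) \<in> insts L N Xs (A \<union> ?F)" if "(\<psi>, c) \<in> insts L N Xs (insert e A \<union> set (concat as))" for \<psi> c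
      using that unfolding insts_def by auto
    then have "R as a" unfolding R_def using a(2) by blast
    moreover have "(\<phi>, b) \<in> insts L N Xs (A \<union> ?F)" if "b \<in> B" for b
      using that B(2) assms(2) Ys unfolding insts_def by auto
    ultimately show ?thesis using a by blast
  qed
  define K where "K = 2 * m + 2"
  obtain as where as: "length as = K" "set as \<subseteq> tuples N Xs" "\<And>i. i < K \<Longrightarrow> R (take i as) (as ! i)"
    "\<And>b. b \<in> tuples N Ys \<Longrightarrow> ?D b \<longleftrightarrow> m < card {i. i < K \<and> sat N (as ! i @ b) \<phi>}"
    by (rule majority_rule[of m "tuples N Xs" "tuples N Ys" "\<lambda>a b. sat N (a @ b) \<phi>" R ?D])
      (use m step in \<open>unfold K_def, blast+\<close>)
  let ?alg = "\<lambda>j. algebraic N [s] (tp L N [s] (A \<union> set (concat (take j as))) [e])"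
  have "?alg K"
  proof -
    let ?Zs = "replicate K Xs"
    \<comment> \<open>Collapses the case distinction that an update of the fresh block
      \<open>Suc K\<close> leaves inside the counting set.\<close>
    have [simp]: "i \<noteq> K \<and> (i \<noteq> K \<longrightarrow> i < K \<and> Q) \<longleftrightarrow> i < K \<and> Q" for i Q by auto
    \<comment> \<open>The formula says that the element codes the set given by the majority rule; as
      codes are unique, \<open>e\<close> is its only solution.\<close>
    have "defn (blk ([s] # ?Zs)) (\<lambda>g. \<forall>b\<in>tuples N Ys. sat N (b @ g 0) \<rho> \<longleftrightarrow>
        m < card {i. i < K \<and> sat N (g (Suc i) @ b) \<phi>})"
      by (rule defn_all[where i = "Suc K"], intro defn_iff defn_sat2 defn_many[OF assms(2)])
        (use \<rho> Ys in \<open>simp_all add: blk_def\<close>)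
    then obtain \<eta> where \<eta>: "wff L (concat ([s] # ?Zs)) \<eta>"
      "\<And>es. list_all2 (\<lambda>e \<Gamma>. e \<in> tuples N \<Gamma>) es ([s] # ?Zs) \<Longrightarrow>
        sat N (concat es) \<eta> \<longleftrightarrow> (\<forall>b\<in>tuples N Ys. sat N (b @ blk es 0) \<rho> \<longleftrightarrow>
          m < card {i. i < K \<and> sat N (blk es (Suc i) @ b) \<phi>})"
      by (rule defn_fm) blast
    have all: "list_all2 (\<lambda>e \<Gamma>. e \<in> tuples N \<Gamma>) as ?Zs"
      using as(1,2) by (auto simp: list_all2_conv_all_nth)
    have mem: "concat as \<in> tuples N (concat ?Zs)"
      using all
    proof (induction rule: list_all2_induct)
      case (Cons x xs y ys)
      then show ?case by (simp add: tuples_appendI)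
    qed simp
    have sat\<eta>: "sat N ([z] @ concat as) \<eta> \<longleftrightarrow> (\<forall>b\<in>tuples N Ys. sat N (b @ [z]) \<rho> \<longleftrightarrow> ?D b)" if "z \<in> univ N s" for z
    proof -
      have "{i. i < K \<and> sat N (blk ([z] # as) (Suc i) @ b) \<phi>} = {i. i < K \<and> sat N (as ! i @ b) \<phi>}" for b
        using as(1) by (auto simp: blk_def)
      then show ?thesis using \<eta>(2)[of "[z] # as"] all that as(4) by simp
    qed
    have "(\<eta>, concat as) \<in> tp L N [s] (A \<union> set (concat (take K as))) [e]"
      unfolding tp_def insts_def using sat\<eta>[OF e] \<rho>D \<eta>(1) mem as(1) Xs by (auto intro!: exI[of _ "concat ?Zs"])
    moreover have "sols N [s] {(\<eta>, concat as)} \<subseteq> {[e]}"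
    proof
      fix z' assume z': "z' \<in> sols N [s] {(\<eta>, concat as)}"
      then obtain z where z: "z' = [z]" "z \<in> univ N s" by (auto simp: sols_def)
      then have "sat N ([z] @ concat as) \<eta>" using z' by (simp add: sols_def)
      then have "z = e" using sat\<eta>[OF z(2)] \<rho>D by (intro uniq[OF z(2) e]) simp
      then show "z' \<in> {[e]}" using z by simp
    qed
    then have "finite (sols N [s] {(\<eta>, concat as)})" using finite_subset by blast
    ultimately show ?thesis unfolding algebraic_def by blast
  qed
  have "?alg 0"
  proof (rule ccontr)
    assume "\<not> ?alg 0"
    from ex_least_nat_less[of ?alg K, OF \<open>?alg K\<close> this]
    obtain j where j: "j < K" "\<not> ?alg j" "?alg (Suc j)" by auto
    let ?c = "concat (take j as)" and ?a = "as ! j"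
    have a: "?a \<in> tuples N Xs" using as(1,2) j(1) nth_mem by fastforce
    have "take (Suc j) as = take j as @ [?a]" using as(1) j(1) by (simp add: take_Suc_conv_app_nth)
    then have "A \<union> set (concat (take (Suc j) as)) = (A \<union> set ?c) \<union> set ?a" by auto
    with j(3) have "algebraic N [s] (tp L N [s] (A \<union> set ?c \<union> set ?a) [e])" by simp
    then obtain \<chi> d where \<chi>: "strongly_divides L N Xs (A \<union> set ?c) (\<chi>, e # d)" "sat N (?a @ e # d) \<chi>"
      "(\<chi>, e # d) \<in> insts L N Xs (insert e (A \<union> set ?c))"
      by (rule algebraic_step_strongly_divides[OF s e Xs a j(2)]) blast
    have "set ?c \<subseteq> points L N"
    proof
      fix x assume "x \<in> set ?c"
      then obtain y where "y \<in> set as" "x \<in> set y" by (auto dest: in_set_takeD)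
      then show "x \<in> points L N" using as(2) tuples_points[OF Xs] by blast
    qed
    then have "thorn_divides L N Xs A (\<chi>, e # d)" unfolding thorn_divides_def using \<chi>(1) by blast
    then have "\<not> eventually (\<lambda>x. x \<in> sols N Xs {(\<chi>, e # d)}) U" by (rule nothorn)
    moreover have "eventually (\<lambda>x. sat N (x @ e # d) \<chi>) U"
      using as(3)[OF j(1)] \<chi>(2,3) unfolding R_def by simp
    with evT have "eventually (\<lambda>x. x \<in> sols N Xs {(\<chi>, e # d)}) U"
      by eventually_elim (simp add: sols_def)
    ultimately show False by blast
  qed
  then have "algebraic N [s] (tp L N [s] A [e])" by simp
  then show thesis by (intro that[OF s e \<rho> \<rho>D])
qed

end


section \<open>Stable theories\<close>

context rich
begin

lemma stable_forks_imp_thorn_forks: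
  assumes stable: "stable_theory L N" and Xs: "set Xs \<subseteq> Sorts L" and "good A" and "good B"
    and q: "q \<in> complete_types L N Xs B" and "forks L N Xs A q"
  shows "thorn_forks L N Xs A q"
proof (rule ccontr)
  assume "\<not> thorn_forks L N Xs A q"
  then obtain U where U: "ultra U" and evT: "eventually (\<lambda>x. x \<in> tuples N Xs) U"
    and qU: "\<And>\<phi> b. (\<phi>, b) \<in> q \<Longrightarrow> eventually (\<lambda>x. sat N (x @ b) \<phi>) U"
    and nothorn: "\<And>\<psi>. thorn_divides L N Xs A \<psi> \<Longrightarrow> \<not> eventually (\<lambda>x. x \<in> sols N Xs {\<psi>}) U"
    by (rule thorn_nonforking_ultrafilter[OF q]) blast
  obtain F where F: "finite F" "\<forall>\<psi>\<in>F. divides L N Xs A \<psi>" "sols N Xs q \<subseteq> (\<Union>\<psi>\<in>F. sols N Xs {\<psi>})"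
    using assms(6) unfolding forks_def by blast
  have dpts: "set d \<subseteq> points L N" if "(\<delta>, d) \<in> F" for \<delta> d
  proof -
    have "divides L N Xs A (\<delta>, d)" using F(2) that by blast
    then obtain Ys where "set Ys \<subseteq> Sorts L" "d \<in> tuples N Ys" unfolding divides_def by auto
    then show ?thesis by (rule tuples_points)
  qed
  \<comment> \<open>Realizing \<open>U\<close> over these parameters too decides which of the
    dividing formulas covering \<open>q\<close> belongs to \<open>U\<close>.\<close>
  let ?P = "\<Union> ((set \<circ> snd) ` F)"
  have "?P \<subseteq> points L N"
  proof
    fix x assume "x \<in> ?P"
    then obtain \<delta> d where "(\<delta>, d) \<in> F" "x \<in> set d" by auto
    then show "x \<in> points L N" using dpts by blast
  qed
  then have "good (B \<union> ?P)" by (intro good_Un[OF assms(4)]) (use F(1) in simp_all)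
  then obtain a where a: "a \<in> tuples N Xs" "\<And>\<psi> c. (\<psi>, c) \<in> insts L N Xs (B \<union> ?P) \<Longrightarrow>
      sat N (a @ c) \<psi> \<longleftrightarrow> eventually (\<lambda>x. sat N (x @ c) \<psi>) U"
    using realize_tuple[OF _ U evT Xs] by blast
  have "sat N (a @ b) \<phi>" if "(\<phi>, b) \<in> q" for \<phi> b
  proof -
    have "(\<phi>, b) \<in> insts L N Xs B" using q that unfolding complete_types_def by blast
    then have "(\<phi>, b) \<in> insts L N Xs (B \<union> ?P)" unfolding insts_def by blast
    then show ?thesis using a(2) qU[OF that] by blast
  qed
  then have "a \<in> sols N Xs q" using a(1) by (auto simp: sols_def)
  then have "a \<in> (\<Union>\<psi>\<in>F. sols N Xs {\<psi>})" using F(3) by (rule rev_subsetD)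
  then obtain \<psi> where "\<psi> \<in> F" "a \<in> sols N Xs {\<psi>}" by (rule UN_E)
  moreover obtain \<delta> d where "\<psi> = (\<delta>, d)" by (rule prod.exhaust)
  ultimately have \<delta>F: "(\<delta>, d) \<in> F" "a \<in> sols N Xs {(\<delta>, d)}" by simp_all
  then have "divides L N Xs A (\<delta>, d)" using F(2) by blast
  then obtain Ys a' k where Ys: "set Ys \<subseteq> Sorts L" and d: "d \<in> tuples N Ys" and \<delta>: "wff L (Xs @ Ys) \<delta>"
    and a': "\<And>i::nat. a' i \<in> sols N Ys (tp L N Ys A d)"
    and k: "\<And>I. finite I \<and> card I = k \<Longrightarrow> sols N Xs {(\<delta>, a' i) | i. i \<in> I} = {}"
    unfolding divides_def case_prod_conv by blast
  have "set d \<subseteq> B \<union> ?P" using \<delta>F(1) by force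
  then have "(\<delta>, d) \<in> insts L N Xs (B \<union> ?P)" unfolding insts_def using Ys d \<delta> by blast
  then have ev\<delta>: "eventually (\<lambda>x. sat N (x @ d) \<delta>) U" using a(2) \<delta>F(2) by (simp add: sols_def)
  have "stable_formula N Xs Ys \<delta>" using stable \<delta> Xs Ys unfolding stable_theory_def by auto
  then obtain s e \<rho> where s: "s \<in> Sorts L" and e: "e \<in> univ N s" and \<rho>: "wff L (Ys @ [s]) \<rho>"
    and \<rho>U: "\<And>b. b \<in> tuples N Ys \<Longrightarrow> sat N (b @ [e]) \<rho> \<longleftrightarrow> eventually (\<lambda>x. sat N (x @ b) \<delta>) U"
    and alg: "algebraic N [s] (tp L N [s] A [e])"
    by (rule code_algebraic[OF _ \<delta> _ U evT assms(3)]) (use Xs Ys nothorn in simp_all)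
  \<comment> \<open>The negation of this predicate is the property \<kappa> of codes: any
    \<open>k\<close> members of the coded set have a common solution of \<delta>. It holds for
    \<open>e\<close> because \<open>U\<close> is closed under finite intersections, and the
    conjugate \<open>z\<close> inherits it.\<close>
  have "defn (blk [[s]]) (\<lambda>g. \<exists>w. (\<forall>i. w i \<in> tuples N Ys) \<and>
      ((\<forall>i\<in>{..<k}. sat N (w i @ g 0) \<rho>) \<and> \<not> (\<exists>x\<in>tuples N Xs. \<forall>i\<in>{..<k}. sat N (x @ w i) \<delta>)))"
    by (rule defn_ex_family[where n = 1], intro defn_conj defn_ball defn_not defn_sat2 defn_ex[where i = "Suc k" and S = Xs])
      (use \<rho> \<delta> Xs Ys in auto)
  from defn_not[OF this] obtain \<kappa> where \<kappa>: "wff L [s] \<kappa>"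
    "\<And>z. z \<in> tuples N [s] \<Longrightarrow> sat N z \<kappa> \<longleftrightarrow> \<not> (\<exists>w. (\<forall>i. w i \<in> tuples N Ys) \<and>
      ((\<forall>i\<in>{..<k}. sat N (w i @ z) \<rho>) \<and> \<not> (\<exists>x\<in>tuples N Xs. \<forall>i\<in>{..<k}. sat N (x @ w i) \<delta>)))"
    by (rule defn_fm1) (simp del: tuples_singleton bex_simps ball_simps)
  obtain \<pi> where \<pi>: "wff L ([s] @ Ys) \<pi>"
    "\<And>z y. z \<in> tuples N [s] \<Longrightarrow> y \<in> tuples N Ys \<Longrightarrow> sat N (z @ y) \<pi> \<longleftrightarrow> sat N (y @ z) \<rho>"
    by (rule defn_fm2[OF defn_sat2[of "blk [[s], Ys]" 1 0 \<rho>]]) (use \<rho> in \<open>simp_all del: tuples_singleton\<close>)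
  have es: "[e] \<in> tuples N [s]" using e by simp
  have e\<kappa>: "sat N [e] \<kappa>"
  proof -
    have "\<exists>x\<in>tuples N Xs. \<forall>i\<in>{..<k}. sat N (x @ w i) \<delta>"
      if "\<And>i. w i \<in> tuples N Ys" "\<forall>i\<in>{..<k}. sat N (w i @ [e]) \<rho>" for w
    proof -
      have "eventually (\<lambda>x. \<forall>i\<in>{..<k}. sat N (x @ w i) \<delta>) U"
        by (rule eventually_ball_finite) (use that \<rho>U in auto)
      from ultra_ex[OF U eventually_conj[OF evT this]] show ?thesis by blast
    qed
    then show ?thesis unfolding \<kappa>(2)[OF es] by blast
  qed
  have e\<pi>: "sat N (e # d) \<pi>" using \<pi>(2)[OF es d] \<rho>U[OF d] ev\<delta> by simp
  obtain z where z: "z \<in> univ N s" "sat N [z] \<kappa>" "infinite {i. sat N (z # a' i) \<pi>}"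
    by (rule algebraic_type_transfer[OF alg s e Ys \<pi>(1) \<kappa>(1) d e\<pi> e\<kappa> a'])
  obtain I where I: "I \<subseteq> {i. sat N (z # a' i) \<pi>}" "finite I" "card I = k"
    using infinite_arbitrarily_large[OF z(3)] by blast
  then obtain h where h: "bij_betw h {..<k} I" using ex_bij_betw_nat_finite[of I] by (auto simp: atLeast0LessThan)
  define w where "w = (\<lambda>i. a' (h i))"
  have zs: "[z] \<in> tuples N [s]" using z(1) by simp
  have a'Ys: "a' i \<in> tuples N Ys" for i using a'[of i] by (simp add: sols_def)
  have hI: "h i \<in> I" if "i < k" for i using h that unfolding bij_betw_def by blast
  have "\<forall>i\<in>{..<k}. sat N (w i @ [z]) \<rho>"
  proof
    fix i assume "i \<in> {..<k}"
    then have "sat N ([z] @ a' (h i)) \<pi>" using hI I(1) by auto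
    then show "sat N (w i @ [z]) \<rho>" unfolding w_def \<pi>(2)[OF zs a'Ys] .
  qed
  moreover have "\<forall>i. w i \<in> tuples N Ys" using a'Ys by (simp add: w_def)
  ultimately obtain x where x: "x \<in> tuples N Xs" "\<forall>i\<in>{..<k}. sat N (x @ w i) \<delta>"
    using z(2) unfolding \<kappa>(2)[OF zs] by blast
  have "h ` {..<k} = I" using h by (simp add: bij_betw_def)
  then have "\<forall>i\<in>I. sat N (x @ a' i) \<delta>" using x(2) by (auto simp: w_def)
  then have "x \<in> sols N Xs {(\<delta>, a' i) | i. i \<in> I}" using x(1) unfolding sols_def by blast
  moreover have "sols N Xs {(\<delta>, a' i) | i. i \<in> I} = {}" using I(2,3) by (intro k conjI)
  ultimately show False by simp
qed

end

section \<open>Wide sets\<close>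

text \<open>\<open>wide T W S k n d X\<close>: there is a tree of height \<open>d\<close>, with \<open>n\<close> successors at every node, of
  instances \<open>S w\<close> such that siblings are \<open>k\<close>-inconsistent and every path is consistent with \<open>X\<close>.\<close>

primrec wide :: "'x set \<Rightarrow> 'w set \<Rightarrow> ('w \<Rightarrow> 'x \<Rightarrow> bool) \<Rightarrow> nat \<Rightarrow> nat \<Rightarrow> nat \<Rightarrow> 'x set \<Rightarrow> bool" where
  "wide T W S k n 0 X \<longleftrightarrow> X \<noteq> {}"
| "wide T W S k n (Suc d) X \<longleftrightarrow> (\<exists>w. (\<forall>j. w j \<in> W) \<and>
     ((\<forall>I\<in>{I. I \<subseteq> {..<n} \<and> card I = k}. \<not> (\<exists>x\<in>T. \<forall>i\<in>I. S (w i) x)) \<and>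
      (\<forall>j\<in>{..<n}. wide T W S k n d {x \<in> X. S (w j) x})))"

lemma wide_mono: "wide T W S k n d X \<Longrightarrow> X \<subseteq> Y \<Longrightarrow> wide T W S k n d Y"
proof (induction d arbitrary: X Y)
  case (Suc d)
  then obtain w where w: "\<forall>j. w j \<in> W"
      "\<forall>I\<in>{I. I \<subseteq> {..<n} \<and> card I = k}. \<not> (\<exists>x\<in>T. \<forall>i\<in>I. S (w i) x)"
      "\<forall>j\<in>{..<n}. wide T W S k n d {x \<in> X. S (w j) x}" by auto
  have "wide T W S k n d {x \<in> Y. S (w j) x}" if "j \<in> {..<n}" for j
    by (rule Suc.IH) (use w(3) that Suc.prems(2) in auto)
  with w(1,2) show ?case by (auto intro!: exI[of _ w])
qed auto

text \<open>The index set may be infinite because this is how the pigeonhole argument on conjugates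
  delivers the successors of a node.\<close>

lemma wide_reindex:
  assumes "\<And>j. w j \<in> W" and "\<And>I. I \<subseteq> J \<Longrightarrow> finite I \<Longrightarrow> card I = k \<Longrightarrow> \<not> (\<exists>x\<in>T. \<forall>i\<in>I. S (w i) x)"
    and "n \<le> card J \<or> infinite J" and "\<And>j. j \<in> J \<Longrightarrow> wide T W S k n d {x \<in> X. S (w j) x}"
  shows "wide T W S k n (Suc d) X"
proof -
  obtain J' where J': "J' \<subseteq> J" "card J' = n" "finite J'"
    using assms(3) infinite_arbitrarily_large[of J n] obtain_subset_with_card_n[of n J] by metis
  then obtain h where h: "bij_betw h {..<n} J'"
    using ex_bij_betw_nat_finite[of J'] by (auto simp: atLeast0LessThan)
  have hJ: "h j \<in> J" if "j < n" for j using h J'(1) that unfolding bij_betw_def by blast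
  have "\<not> (\<exists>x\<in>T. \<forall>i\<in>I. S (w (h i)) x)" if I: "I \<subseteq> {..<n}" "card I = k" for I
  proof -
    have "card (h ` I) = k" using h I by (metis bij_betw_def card_image inj_on_subset)
    moreover have "h ` I \<subseteq> J" using hJ I(1) by auto
    moreover have "finite (h ` I)" using I(1) finite_subset by blast
    ultimately have "\<not> (\<exists>x\<in>T. \<forall>i\<in>h ` I. S (w i) x)" using assms(2) by blast
    then show ?thesis by simp
  qed
  then show ?thesis using assms(1,4) hJ by (auto intro!: exI[of _ "\<lambda>j. w (h j)"])
qed

lemma wide_fewer: "wide T W S k m d X \<Longrightarrow> n \<le> m \<Longrightarrow> wide T W S k n d X"
proof (induction d arbitrary: X)
  case (Suc d)
  then obtain w where w: "\<forall>j. w j \<in> W"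
      "\<forall>I\<in>{I. I \<subseteq> {..<m} \<and> card I = k}. \<not> (\<exists>x\<in>T. \<forall>i\<in>I. S (w i) x)"
      "\<forall>j\<in>{..<m}. wide T W S k m d {x \<in> X. S (w j) x}" by auto
  show ?case by (rule wide_reindex[of w W "{..<m}"]) (use w Suc in auto)
qed simp

text \<open>Each of the \<open>2 * n\<close> successors stays wide on one of the two sides, by
  induction; so one side keeps at least \<open>n\<close> of them.\<close>

lemma wide_Un: "wide T W S k (2 * n) d (X \<union> Y) \<Longrightarrow> wide T W S k n d X \<or> wide T W S k n d Y"
proof (induction d arbitrary: X Y)
  case (Suc d)
  then obtain w where w: "\<forall>j. w j \<in> W"
      "\<forall>I\<in>{I. I \<subseteq> {..<2 * n} \<and> card I = k}. \<not> (\<exists>x\<in>T. \<forall>i\<in>I. S (w i) x)"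
      "\<forall>j\<in>{..<2 * n}. wide T W S k (2 * n) d {x \<in> X \<union> Y. S (w j) x}" by auto
  define J where "J = (\<lambda>X. {j \<in> {..<2 * n}. wide T W S k n d {x \<in> X. S (w j) x}})"
  have sub: "J Z \<subseteq> {..<2 * n}" and fin: "finite (J Z)" for Z by (auto simp: J_def)
  have "j \<in> J X \<union> J Y" if "j \<in> {..<2 * n}" for j
  proof -
    have "{x \<in> X \<union> Y. S (w j) x} = {x \<in> X. S (w j) x} \<union> {x \<in> Y. S (w j) x}" by auto
    then have "wide T W S k (2 * n) d ({x \<in> X. S (w j) x} \<union> {x \<in> Y. S (w j) x})"
      using bspec[OF w(3) that] by simp
    from Suc.IH[OF this] that show ?thesis by (auto simp: J_def)
  qed
  then have "{..<2 * n} \<subseteq> J X \<union> J Y" by blast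
  then have "card {..<2 * n} \<le> card (J X \<union> J Y)" using fin by (intro card_mono) auto
  then have "2 * n \<le> card (J X) + card (J Y)" using card_Un_le[of "J X" "J Y"] by simp
  then have "n \<le> card (J X) \<or> n \<le> card (J Y)" by linarith
  moreover have "wide T W S k n (Suc d) Z" if "n \<le> card (J Z)" for Z
  proof (rule wide_reindex[of w W "J Z"])
    show "\<not> (\<exists>x\<in>T. \<forall>i\<in>I. S (w i) x)" if "I \<subseteq> J Z" "card I = k" for I
      using w(2) that sub[of Z] by blast
  qed (use w(1) that in \<open>auto simp: J_def\<close>)
  ultimately show ?case by blast
qed auto

text \<open>Splitting off one set of the union halves the branching number, hence the factor
  \<open>2 ^ card F\<close>. The height is not affected.\<close>

lemma wide_UN:
  assumes "finite F" and "F \<noteq> {}" and "wide T W S k (2 ^ card F * n) d (\<Union>i\<in>F. X i)"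
  shows "\<exists>i\<in>F. wide T W S k n d (X i)"
  using assms
proof (induction F rule: finite_ne_induct)
  case (singleton i)
  then show ?case using wide_fewer[of T W S k "2 * n" d "X i" n] by simp
next
  case (insert i F)
  have "wide T W S k (2 * (2 ^ card F * n)) d (X i \<union> (\<Union>i\<in>F. X i))"
    using insert.prems insert.hyps by (simp add: mult.assoc)
  then consider "wide T W S k (2 ^ card F * n) d (X i)" | "wide T W S k (2 ^ card F * n) d (\<Union>i\<in>F. X i)"
    using wide_Un by blast
  then show ?case
  proof cases
    case 1
    then have "wide T W S k n d (X i)" by (rule wide_fewer) simp
    then show ?thesis by blast
  next
    case 2
    then show ?thesis using insert.IH by blast
  qed
qed

text \<open>The nested choices in \<open>wide\<close> flattened into one labelling of words, the
  form in which finite trees can be compared with each other and glued by compactness.\<close>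

definition tree_labels :: "'x set \<Rightarrow> 'w set \<Rightarrow> ('w \<Rightarrow> 'x \<Rightarrow> bool) \<Rightarrow> nat \<Rightarrow> nat \<Rightarrow> nat \<Rightarrow> 'x set
    \<Rightarrow> (nat list \<Rightarrow> 'w) \<Rightarrow> bool" where
  "tree_labels T W S k n d X b \<longleftrightarrow> (\<forall>\<sigma>. b \<sigma> \<in> W) \<and>
    (\<forall>\<sigma> I. length \<sigma> < d \<longrightarrow> set \<sigma> \<subseteq> {..<n} \<longrightarrow> I \<subseteq> {..<n} \<longrightarrow> card I = k \<longrightarrow>
      \<not> (\<exists>x\<in>T. \<forall>i\<in>I. S (b (\<sigma> @ [i])) x)) \<and>
    (\<forall>\<eta>. length \<eta> = d \<longrightarrow> set \<eta> \<subseteq> {..<n} \<longrightarrow> (\<exists>x\<in>X. \<forall>m<d. S (b (take (Suc m) \<eta>)) x))"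

lemma wide_tree:
  assumes "wide T W S k n d X" and "w0 \<in> W"
  shows "\<exists>b. tree_labels T W S k n d X b"
  using assms(1)
proof (induction d arbitrary: X)
  case 0
  then show ?case using assms(2) by (intro exI[of _ "\<lambda>_. w0"]) (auto simp: tree_labels_def)
next
  case (Suc d)
  then obtain w where w: "\<forall>j. w j \<in> W"
      "\<forall>I\<in>{I. I \<subseteq> {..<n} \<and> card I = k}. \<not> (\<exists>x\<in>T. \<forall>i\<in>I. S (w i) x)"
      "\<forall>j\<in>{..<n}. wide T W S k n d {x \<in> X. S (w j) x}" by auto
  have "\<forall>j\<in>{..<n}. \<exists>b. tree_labels T W S k n d {x \<in> X. S (w j) x} b"
    using Suc.IH w(3) by simp
  from bchoice[OF this] obtain B where
    B: "\<And>j. j < n \<Longrightarrow> tree_labels T W S k n d {x \<in> X. S (w j) x} (B j)" by auto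
  \<comment> \<open>The root carries no instance. The label \<open>w0\<close>, at the root and at
    words leaving the tree, matters only for the requirement that all labels lie in
    \<open>W\<close>.\<close>
  define b where "b = (\<lambda>\<sigma>. case \<sigma> of [] \<Rightarrow> w0 | j # \<tau> \<Rightarrow> if \<tau> = [] then w j else if j < n then B j \<tau> else w0)"
  show ?case
  proof (rule exI[of _ b], unfold tree_labels_def, intro conjI allI impI)
    fix \<sigma>
    have "B j \<tau> \<in> W" if "j < n" for j \<tau> using B[OF that] by (simp add: tree_labels_def)
    then show "b \<sigma> \<in> W" using w(1) assms(2) by (simp add: b_def split: list.split)
  next
    fix \<sigma> I assume \<sigma>: "length \<sigma> < Suc d" "set \<sigma> \<subseteq> {..<n}" and I: "I \<subseteq> {..<n}" "card I = k"
    show "\<not> (\<exists>x\<in>T. \<forall>i\<in>I. S (b (\<sigma> @ [i])) x)"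
    proof (cases \<sigma>)
      case Nil
      then show ?thesis using w(2) I by (simp add: b_def)
    next
      case (Cons j \<tau>)
      then have j: "j < n" "length \<tau> < d" "set \<tau> \<subseteq> {..<n}" using \<sigma> by auto
      then have "\<not> (\<exists>x\<in>T. \<forall>i\<in>I. S (B j (\<tau> @ [i])) x)"
        using B[OF j(1)] I unfolding tree_labels_def by simp
      then show ?thesis using Cons j(1) by (simp add: b_def)
    qed
  next
    fix \<eta> assume \<eta>: "length \<eta> = Suc d" "set \<eta> \<subseteq> {..<n}"
    then obtain j \<tau> where \<eta>': "\<eta> = j # \<tau>" by (cases \<eta>) auto
    then have j: "j < n" "length \<tau> = d" "set \<tau> \<subseteq> {..<n}" using \<eta> by auto
    then have "\<exists>x\<in>{x \<in> X. S (w j) x}. \<forall>m<d. S (B j (take (Suc m) \<tau>)) x"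
      using B[OF j(1)] unfolding tree_labels_def by simp
    then obtain x where x: "x \<in> X" "S (w j) x" "\<forall>m<d. S (B j (take (Suc m) \<tau>)) x" by blast
    have "S (b (take (Suc m) \<eta>)) x" if "m < Suc d" for m
    proof (cases m)
      case 0
      then show ?thesis using x(2) by (simp add: b_def \<eta>')
    next
      case (Suc m')
      then have "take (Suc m') \<tau> \<noteq> []" using that j(2) by (cases \<tau>) auto
      then show ?thesis using x(3) Suc that j(1) by (simp add: b_def \<eta>')
    qed
    then show "\<exists>x\<in>X. \<forall>m<Suc d. S (b (take (Suc m) \<eta>)) x" using x(1) by blast
  qed
qed


lemma tree_labels_siblings:
  "tree_labels T W S k n d X b \<Longrightarrow> length \<sigma> < d \<Longrightarrow> set \<sigma> \<subseteq> {..<n} \<Longrightarrow> I \<subseteq> {..<n} \<Longrightarrow> card I = k \<Longrightarrow>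
    \<not> (\<exists>x\<in>T. \<forall>i\<in>I. S (b (\<sigma> @ [i])) x)"
  by (simp add: tree_labels_def)

lemma tree_labels_path:
  "tree_labels T W S k n d X b \<Longrightarrow> length \<eta> = d \<Longrightarrow> set \<eta> \<subseteq> {..<n} \<Longrightarrow>
    \<exists>x\<in>X. \<forall>m<d. S (b (take (Suc m) \<eta>)) x"
  by (simp add: tree_labels_def)

section \<open>Simple theories\<close>

context rich
begin

lemma defn_common_solution:
  fixes \<Gamma> :: "nat \<Rightarrow> 's list"
  assumes "wff L (Xs @ Ws) \<psi>" and "finite V" and "\<And>v. v \<in> V \<Longrightarrow> \<Gamma> v = Ws" and "set Xs \<subseteq> Sorts L"
  shows "defn \<Gamma> (\<lambda>g. \<exists>x\<in>tuples N Xs. \<forall>v\<in>V. sat N (x @ g v) \<psi>)"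
proof -
  obtain i where i: "i \<notin> V" using ex_new_if_finite[OF infinite_UNIV_nat assms(2)] by blast
  have "defn (\<Gamma>(i := Xs)) (\<lambda>g. \<forall>v\<in>V. sat N (g i @ g v) \<psi>)"
  proof (rule defn_ball[OF assms(2)], rule defn_sat2)
    fix v assume "v \<in> V"
    then show "wff L ((\<Gamma>(i := Xs)) i @ (\<Gamma>(i := Xs)) v) \<psi>" using i assms(1,3) by auto
  qed
  then show ?thesis
  proof (rule defn_ex[where i = i and P = "\<lambda>g w. \<forall>v\<in>V. sat N (w @ g v) \<psi>"])
    fix g :: "nat \<Rightarrow> 'a list" and v
    have "(g(i := v)) u = g u" if "u \<in> V" for u using i that by auto
    then show "(\<lambda>w. \<forall>u\<in>V. sat N (w @ (g(i := v)) u) \<psi>) = (\<lambda>w. \<forall>v\<in>V. sat N (w @ g v) \<psi>)" by simp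
  qed (rule assms(4))
qed

abbreviation wide_inst where
  "wide_inst Xs Ws \<psi> \<equiv> wide (tuples N Xs) (tuples N Ws) (\<lambda>w x. sat N (x @ w) \<psi>)"

text \<open>Fixed branching and height make the condition first-order: inconsistency of siblings is
  a finite conjunction. In the induction on \<open>d\<close> the instance chosen at a node joins
  \<theta> and its parameters join the free variables, hence the generalization over
  \<open>Zs\<close> and \<theta>.\<close>

lemma wide_definable:
  assumes "wff L (Xs @ Ws) \<psi>" and "set Xs \<subseteq> Sorts L" and "set Ws \<subseteq> Sorts L" and "wff L (Xs @ Zs) \<theta>"
  shows "\<exists>\<tau>. wff L Zs \<tau> \<and> (\<forall>z\<in>tuples N Zs. sat N z \<tau> \<longleftrightarrow>
    wide_inst Xs Ws \<psi> k n d {x \<in> tuples N Xs. sat N (x @ z) \<theta>})"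
  using assms(4)
proof (induction d arbitrary: Zs \<theta>)
  case 0
  have "defn (blk [Zs]) (\<lambda>g. \<exists>x\<in>tuples N Xs. sat N (x @ g 0) \<theta>)"
    by (rule defn_ex[where i = 1], rule defn_sat2) (use 0 assms(2) in simp_all)
  then obtain \<tau> where "wff L Zs \<tau>"
    "\<And>z. z \<in> tuples N Zs \<Longrightarrow> sat N z \<tau> \<longleftrightarrow> (\<exists>x\<in>tuples N Xs. sat N (x @ z) \<theta>)"
    by (rule defn_fm1) simp
  then show ?case by (intro exI[of _ \<tau>]) auto
next
  case (Suc d)
  have "defn (blk [Xs, Ws, Zs]) (\<lambda>g. sat N (g 0 @ g 2) \<theta> \<and> sat N (g 0 @ g 1) \<psi>)"
    by (intro defn_conj defn_sat2) (use assms Suc.prems in simp_all)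
  then obtain \<theta>' where \<theta>': "wff L (Xs @ Ws @ Zs) \<theta>'"
    "\<And>x w z. x \<in> tuples N Xs \<Longrightarrow> w \<in> tuples N Ws \<Longrightarrow> z \<in> tuples N Zs \<Longrightarrow>
      sat N (x @ w @ z) \<theta>' \<longleftrightarrow> sat N (x @ z) \<theta> \<and> sat N (x @ w) \<psi>"
    by (rule defn_fm3) simp
  obtain \<tau>' where \<tau>': "wff L (Ws @ Zs) \<tau>'" "\<forall>z\<in>tuples N (Ws @ Zs). sat N z \<tau>' \<longleftrightarrow>
      wide_inst Xs Ws \<psi> k n d {x \<in> tuples N Xs. sat N (x @ z) \<theta>'}"
    using Suc.IH[OF \<theta>'(1)] by blast
  have fin: "finite {I. I \<subseteq> {..<n} \<and> card I = k}" by (rule finite_subset[of _ "Pow {..<n}"]) auto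
  let ?\<Gamma> = "\<lambda>m::nat. if m < 1 then blk [Zs] m else Ws"
  have "defn ?\<Gamma> (\<lambda>g. \<exists>x\<in>tuples N Xs. \<forall>i\<in>I. sat N (x @ g (1 + i)) \<psi>)" if "I \<subseteq> {..<n}" for I
  proof -
    have "defn ?\<Gamma> (\<lambda>g. \<exists>x\<in>tuples N Xs. \<forall>v\<in>(\<lambda>i. 1 + i) ` I. sat N (x @ g v) \<psi>)"
      by (rule defn_common_solution[OF assms(1)]) (use assms(2) finite_subset[OF that] in auto)
    then show ?thesis by simp
  qed
  then have "defn ?\<Gamma> (\<lambda>g. (\<forall>I\<in>{I. I \<subseteq> {..<n} \<and> card I = k}. \<not> (\<exists>x\<in>tuples N Xs. \<forall>i\<in>I. sat N (x @ g (1 + i)) \<psi>)) \<and>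
      (\<forall>j\<in>{..<n}. sat N (g (1 + j) @ g 0) \<tau>'))"
    by (intro defn_conj defn_ball[OF fin] defn_ball[OF finite_lessThan] defn_not defn_sat2) (use \<tau>'(1) in simp_all)
  then have "defn (blk [Zs]) (\<lambda>g. \<exists>w. (\<forall>j. w j \<in> tuples N Ws) \<and>
      ((\<forall>I\<in>{I. I \<subseteq> {..<n} \<and> card I = k}. \<not> (\<exists>x\<in>tuples N Xs. \<forall>i\<in>I. sat N (x @ w i) \<psi>)) \<and>
      (\<forall>j\<in>{..<n}. sat N (w j @ g 0) \<tau>')))"
    by (rule defn_ex_family[where n = 1]) (use assms(3) in simp_all)
  then obtain \<tau> where \<tau>: "wff L Zs \<tau>" "\<And>z. z \<in> tuples N Zs \<Longrightarrow> sat N z \<tau> \<longleftrightarrow>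
      (\<exists>w. (\<forall>j. w j \<in> tuples N Ws) \<and>
      ((\<forall>I\<in>{I. I \<subseteq> {..<n} \<and> card I = k}. \<not> (\<exists>x\<in>tuples N Xs. \<forall>i\<in>I. sat N (x @ w i) \<psi>)) \<and>
      (\<forall>j\<in>{..<n}. sat N (w j @ z) \<tau>')))"
    by (rule defn_fm1) (simp only: blk_Cons)
  have eq: "sat N (w @ z) \<tau>' \<longleftrightarrow> wide_inst Xs Ws \<psi> k n d {x \<in> {x \<in> tuples N Xs. sat N (x @ z) \<theta>}. sat N (x @ w) \<psi>}"
    if "w \<in> tuples N Ws" "z \<in> tuples N Zs" for w z
  proof -
    have "{x \<in> tuples N Xs. sat N (x @ w @ z) \<theta>'} = {x \<in> {x \<in> tuples N Xs. sat N (x @ z) \<theta>}. sat N (x @ w) \<psi>}"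
      using \<theta>'(2)[OF _ that] by auto
    then show ?thesis using \<tau>'(2) tuples_appendI[OF that] by simp
  qed
  have "sat N z \<tau> \<longleftrightarrow> wide_inst Xs Ws \<psi> k n (Suc d) {x \<in> tuples N Xs. sat N (x @ z) \<theta>}"
    if z: "z \<in> tuples N Zs" for z
    unfolding \<tau>(2)[OF z] wide.simps by (intro iff_exI conj_cong refl ball_cong) (simp add: eq[OF _ z])
  then show ?case using \<tau>(1) by blast
qed

text \<open>Compactness glues the trees of branching and height \<open>n\<close>, for all
  \<open>n\<close>, into one tree of infinite branching and height.\<close>

lemma tree_property_of_wide:
  assumes "wff L (Xs @ Ws) \<psi>" and "set Xs \<subseteq> Sorts L" and "set Ws \<subseteq> Sorts L"
    and wide: "\<And>n d. wide_inst Xs Ws \<psi> k n d (tuples N Xs)"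
  shows "tree_property N Xs Ws \<psi>"
proof -
  let ?\<Gamma> = "\<lambda>_::nat. Ws"
  let ?lab = "\<lambda>n. tree_labels (tuples N Xs) (tuples N Ws) (\<lambda>w x. sat N (x @ w) \<psi>) k n n (tuples N Xs)"
  \<comment> \<open>\<open>list_encode\<close> turns the nodes into block numbers. \<open>A\<close>
    collects the conditions on siblings, \<open>P\<close> those on finite paths.\<close>
  define A where "A = (\<lambda>(\<sigma>, I) g. \<not> (\<exists>x\<in>tuples N Xs. \<forall>i\<in>I. sat N (x @ g (list_encode (\<sigma> @ [i]))) \<psi>))"
  define P where "P = (\<lambda>\<tau> g. \<exists>x\<in>tuples N Xs. \<forall>m\<in>{..<length \<tau>}. sat N (x @ g (list_encode (take (Suc m) \<tau>))) \<psi>)"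
  define \<P> where "\<P> = A ` {(\<sigma>, I). finite I \<and> card I = k} \<union> range P"
  \<comment> \<open>A single condition involves finitely many nodes, so every labelling of a large
    enough tree meets it; finitely many conditions are then met by one tree.\<close>
  have bound: "\<exists>M. \<forall>n\<ge>M. \<forall>b. ?lab n b \<longrightarrow> Q (\<lambda>c. b (list_decode c))" if "Q \<in> \<P>" for Q
  proof -
    consider \<sigma> I where "Q = A (\<sigma>, I)" "finite I" "card I = k" | \<tau> where "Q = P \<tau>"
      using \<open>Q \<in> \<P>\<close> unfolding \<P>_def by auto
    then show ?thesis
    proof cases
      case 1
      then have "finite (insert (length \<sigma>) (set \<sigma> \<union> I))" by simp
      then obtain M where M: "\<forall>x\<in>insert (length \<sigma>) (set \<sigma> \<union> I). x < M" unfolding finite_nat_set_iff_bounded by blast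
      have "A (\<sigma>, I) (\<lambda>c. b (list_decode c))" if n: "M \<le> n" "?lab n b" for n b
      proof -
        have "length \<sigma> < n" "set \<sigma> \<subseteq> {..<n}" "I \<subseteq> {..<n}" using M n(1) by (auto intro: less_le_trans)
        from tree_labels_siblings[OF n(2) this 1(3)] show ?thesis by (simp add: A_def)
      qed
      then show ?thesis unfolding 1(1) by blast
    next
      case 2
      have "finite (insert (length \<tau>) (set \<tau>))" by simp
      then obtain M where M: "\<forall>x\<in>insert (length \<tau>) (set \<tau>). x < M" unfolding finite_nat_set_iff_bounded by blast
      have "P \<tau> (\<lambda>c. b (list_decode c))" if n: "M \<le> n" "?lab n b" for n b
      proof -
        have len: "length \<tau> < n" and sub: "set \<tau> \<subseteq> {..<n}" using M n(1) by (auto intro: less_le_trans)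
        \<comment> \<open>Only paths of full height are known to be consistent; zeros prolong
          \<open>\<tau>\<close> to such a path.\<close>
        let ?\<eta> = "\<tau> @ replicate (n - length \<tau>) 0"
        have "length ?\<eta> = n" "set ?\<eta> \<subseteq> {..<n}" using len sub by auto
        from tree_labels_path[OF n(2) this]
        obtain x where x: "x \<in> tuples N Xs" "\<forall>m<n. sat N (x @ b (take (Suc m) ?\<eta>)) \<psi>" by blast
        have "sat N (x @ b (take (Suc m) \<tau>)) \<psi>" if "m < length \<tau>" for m
          using x(2)[rule_format, of m] that len by simp
        then show ?thesis using x(1) by (auto simp: P_def)
      qed
      then show ?thesis unfolding 2 by blast
    qed
  qed
  obtain w0 where w0: "w0 \<in> tuples N Ws" using tuples_nonempty[OF assms(3)] by blast
  obtain g where g: "g \<in> envs ?\<Gamma>" "\<And>Q. Q \<in> \<P> \<Longrightarrow> Q g"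
  proof (rule compactness[of \<P> ?\<Gamma>])
    fix Q assume "Q \<in> \<P>"
    then consider \<sigma> I where "Q = A (\<sigma>, I)" "finite I" | \<tau> where "Q = P \<tau>"
      unfolding \<P>_def by auto
    then show "defn ?\<Gamma> Q"
    proof cases
      case 1
      then show ?thesis
        using defn_not[OF defn_common_solution[OF assms(1), of "(\<lambda>i. list_encode (\<sigma> @ [i])) ` I" ?\<Gamma>]] assms(2)
        by (simp add: A_def)
    next
      case 2
      then show ?thesis
        using defn_common_solution[OF assms(1), of "(\<lambda>m. list_encode (take (Suc m) \<tau>)) ` {..<length \<tau>}" ?\<Gamma>] assms(2)
        by (simp add: P_def)
    qed
  next
    fix F assume F: "finite F" "F \<subseteq> \<P>"
    then have "\<forall>Q\<in>F. \<exists>M. \<forall>n\<ge>M. \<forall>b. ?lab n b \<longrightarrow> Q (\<lambda>c. b (list_decode c))" using bound by blast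
    from bchoice[OF this] obtain M where
      M: "\<forall>Q\<in>F. \<forall>n\<ge>M Q. \<forall>b. ?lab n b \<longrightarrow> Q (\<lambda>c. b (list_decode c))" ..
    \<comment> \<open>The sum is a convenient upper bound for all \<open>M Q\<close> with
      \<open>Q\<close> in \<open>F\<close>.\<close>
    let ?n = "sum M F"
    obtain b where b: "?lab ?n b" using wide_tree[OF wide w0] by blast
    have "Q (\<lambda>c. b (list_decode c))" if "Q \<in> F" for Q
    proof -
      have "M Q \<le> ?n" by (rule member_le_sum[OF that _ F(1)]) simp
      then show ?thesis using M that b by blast
    qed
    moreover have "(\<lambda>c. b (list_decode c)) \<in> envs ?\<Gamma>" using b unfolding envs_def tree_labels_def by simp
    ultimately show "\<exists>g\<in>envs ?\<Gamma>. \<forall>Q\<in>F. Q g" by blast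
  qed (use assms(3) in auto)
  show ?thesis unfolding tree_property_def
  proof (intro exI[of _ "\<lambda>\<sigma>. g (list_encode \<sigma>)"] exI[of _ k] conjI allI impI)
    show "g (list_encode \<sigma>) \<in> tuples N Ws" for \<sigma> using g(1) unfolding envs_def by simp
    fix \<sigma> and I :: "nat set" assume "finite I \<and> card I = k"
    then have "A (\<sigma>, I) \<in> \<P>" unfolding \<P>_def by blast
    from g(2)[OF this] have no: "\<not> (\<exists>x\<in>tuples N Xs. \<forall>i\<in>I. sat N (x @ g (list_encode (\<sigma> @ [i]))) \<psi>)"
      by (simp add: A_def)
    have "x \<in> tuples N Xs \<and> (\<forall>i\<in>I. sat N (x @ g (list_encode (\<sigma> @ [i]))) \<psi>)"
      if "x \<in> sols N Xs {(\<psi>, g (list_encode (\<sigma> @ [i]))) |i. i \<in> I}" for x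
      using that by (auto simp: sols_def)
    with no show "sols N Xs {(\<psi>, g (list_encode (\<sigma> @ [i]))) |i. i \<in> I} = {}" by blast
  next
    fix \<eta> :: "nat \<Rightarrow> nat"
    let ?p = "\<lambda>n. (\<psi>, g (list_encode (map \<eta> [0..<n])))"
    show "consistent N Xs {?p n |n. 1 \<le> n}" unfolding consistent_def
    proof (intro allI impI, elim conjE)
      fix F assume F: "finite F" "F \<subseteq> {?p n |n. 1 \<le> n}"
      then have "F \<subseteq> ?p ` {1..}" by auto
      then obtain B where B: "B \<subseteq> {1..}" "finite B" "F = ?p ` B" by (meson F(1) finite_subset_image)
      obtain m where m: "\<forall>n\<in>B. n < m" using B(2) unfolding finite_nat_set_iff_bounded by blast
      have "P (map \<eta> [0..<m]) \<in> \<P>" unfolding \<P>_def by blast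
      from g(2)[OF this] obtain x where x: "x \<in> tuples N Xs"
        "\<forall>j\<in>{..<m}. sat N (x @ g (list_encode (take (Suc j) (map \<eta> [0..<m])))) \<psi>" unfolding P_def by auto
      have "sat N (x @ g (list_encode (map \<eta> [0..<n]))) \<psi>" if "n \<in> B" for n
      proof -
        have "n - 1 \<in> {..<m}" "Suc (n - 1) = n" "n \<le> m" using m B(1) that by force+
        moreover from this have "take (Suc (n - 1)) (map \<eta> [0..<m]) = map \<eta> [0..<n]" by (simp add: take_map)
        ultimately show ?thesis using bspec[OF x(2), of "n - 1"] by simp
      qed
      then have "x \<in> sols N Xs F" unfolding B(3) sols_def using x(1) by auto
      then show "sols N Xs F \<noteq> {}" by blast
    qed
  qed
qed

text \<open>A finite family of formulas is coded by a single one, distinguishing cases by the equality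
  of two additional variables.\<close>

lemma merge_formulas:
  assumes "finite G" and "\<And>\<delta> Ys. (\<delta>, Ys) \<in> G \<Longrightarrow> set Ys \<subseteq> Sorts L \<and> wff L (Xs @ Ys) \<delta>"
    and "s0 \<in> Sorts L" and "u \<in> univ N s0" and "v \<in> univ N s0" and "u \<noteq> v"
  shows "\<exists>Ws \<psi>. set Ws \<subseteq> Sorts L \<and> wff L (Xs @ Ws) \<psi> \<and> (\<forall>(\<delta>, Ys)\<in>G. \<forall>d\<in>tuples N Ys.
    \<exists>w\<in>tuples N Ws. \<forall>x\<in>tuples N Xs. sat N (x @ w) \<psi> \<longleftrightarrow> sat N (x @ d) \<delta>)"
  using assms(1,2)
proof (induction G rule: finite_induct)
  case empty
  obtain \<phi> where "wff L Xs \<phi>"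
    using defn_fm1[OF defn_const[of "blk [Xs]" True]] by metis
  then show ?case by (intro exI[of _ "[]"] exI[of _ \<phi>]) simp
next
  case (insert \<delta>Y G)
  obtain \<delta> Ys where \<delta>Y: "\<delta>Y = (\<delta>, Ys)" by (rule prod.exhaust)
  then have \<delta>: "set Ys \<subseteq> Sorts L" "wff L (Xs @ Ys) \<delta>" using insert.prems by auto
  have "\<exists>Ws \<psi>. set Ws \<subseteq> Sorts L \<and> wff L (Xs @ Ws) \<psi> \<and> (\<forall>(\<delta>, Ys)\<in>G. \<forall>d\<in>tuples N Ys.
    \<exists>w\<in>tuples N Ws. \<forall>x\<in>tuples N Xs. sat N (x @ w) \<psi> \<longleftrightarrow> sat N (x @ d) \<delta>)"
    by (rule insert.IH) (use insert.prems in blast)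
  then obtain Ws \<psi> where W: "set Ws \<subseteq> Sorts L" "wff L (Xs @ Ws) \<psi>" "\<forall>(\<delta>, Ys)\<in>G. \<forall>d\<in>tuples N Ys.
    \<exists>w\<in>tuples N Ws. \<forall>x\<in>tuples N Xs. sat N (x @ w) \<psi> \<longleftrightarrow> sat N (x @ d) \<delta>" by blast
  let ?l = "[Xs, Ys, Ws, [s0], [s0]]"
  have "defn (blk ?l) (\<lambda>g. (g 3 = g 4 \<longrightarrow> sat N (g 0 @ g 1) \<delta>) \<and> (\<not> g 3 = g 4 \<longrightarrow> sat N (g 0 @ g 2) \<psi>))"
    by (intro defn_conj defn_imp defn_not defn_eq defn_sat2) (use \<delta> W(1,2) assms(3) in simp_all)
  then obtain \<chi> where \<chi>: "wff L (concat ?l) \<chi>"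
    "\<And>es. list_all2 (\<lambda>e \<Gamma>. e \<in> tuples N \<Gamma>) es ?l \<Longrightarrow> sat N (concat es) \<chi> \<longleftrightarrow>
      (blk es 3 = blk es 4 \<longrightarrow> sat N (blk es 0 @ blk es 1) \<delta>) \<and>
      (\<not> blk es 3 = blk es 4 \<longrightarrow> sat N (blk es 0 @ blk es 2) \<psi>)"
    by (rule defn_fm) blast
  \<comment> \<open>Values for the parameter block of whichever of the two formulas is not
    selected.\<close>
  obtain y0 w0 where dummy: "y0 \<in> tuples N Ys" "w0 \<in> tuples N Ws"
    using tuples_nonempty[OF \<delta>(1)] tuples_nonempty[OF W(1)] by blast
  let ?Ws = "Ys @ Ws @ [s0, s0]"
  have \<chi>1: "sat N (x @ d @ w @ [u, u]) \<chi> \<longleftrightarrow> sat N (x @ d) \<delta>"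
    and \<chi>2: "sat N (x @ d @ w @ [u, v]) \<chi> \<longleftrightarrow> sat N (x @ w) \<psi>"
    if "x \<in> tuples N Xs" "d \<in> tuples N Ys" "w \<in> tuples N Ws" for x d w
    using \<chi>(2)[of "[x, d, w, [u], [u]]"] \<chi>(2)[of "[x, d, w, [u], [v]]"] that assms(3-6) by simp_all
  have mem: "d @ w @ [u, p] \<in> tuples N ?Ws" if "d \<in> tuples N Ys" "w \<in> tuples N Ws" "p \<in> {u, v}" for d w p
    using that assms(4,5) by (intro tuples_appendI) auto
  have "\<exists>w\<in>tuples N ?Ws. \<forall>x\<in>tuples N Xs. sat N (x @ w) \<chi> \<longleftrightarrow> sat N (x @ d) \<delta>'"
    if G: "(\<delta>', Ys') \<in> insert \<delta>Y G" "d \<in> tuples N Ys'" for \<delta>' Ys' d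
  proof (cases "(\<delta>', Ys') = \<delta>Y")
    case True
    then have "d \<in> tuples N Ys" "\<delta>' = \<delta>" using G \<delta>Y by auto
    then show ?thesis using \<chi>1 mem[OF _ dummy(2), of d u] dummy(2) by (intro bexI[of _ "d @ w0 @ [u, u]"]) auto
  next
    case False
    then have "(\<delta>', Ys') \<in> G" using G by blast
    then obtain w where w: "w \<in> tuples N Ws" "\<forall>x\<in>tuples N Xs. sat N (x @ w) \<psi> \<longleftrightarrow> sat N (x @ d) \<delta>'"
      using W(3) G(2) by blast
    then show ?thesis using \<chi>2 mem[OF dummy(1) w(1), of v] dummy(1) by (intro bexI[of _ "y0 @ w @ [u, v]"]) auto
  qed
  then show ?case using \<chi>(1) \<delta>(1) W(1) assms(3) by (intro exI[of _ ?Ws] exI[of _ \<chi>]) auto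
qed

text \<open>Stated for all \<open>z\<close> and \<open>y\<close>, not just for the code and the
  parameters at hand, because the property is carried over to their conjugates. Fixing the numbers
  \<open>l\<close>, \<open>n\<close> and \<open>d\<close> is what makes it first-order.\<close>

lemma wide_family_definable:
  assumes \<psi>: "wff L (Xs @ Ws) \<psi>" and Xs: "set Xs \<subseteq> Sorts L" and Ws: "set Ws \<subseteq> Sorts L"
    and \<phi>: "wff L (Xs @ Ys) \<phi>" and Ys: "set Ys \<subseteq> Sorts L" and \<rho>: "wff L (Ys @ [s]) \<rho>"
    and \<delta>: "wff L (Xs @ Vs) \<delta>"
  shows "\<exists>\<pi>. wff L ([s] @ Vs) \<pi> \<and> (\<forall>z\<in>univ N s. \<forall>y\<in>tuples N Vs. sat N (z # y) \<pi> \<longleftrightarrow>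
    (\<forall>\<beta>. (\<forall>i::nat. \<beta> i \<in> tuples N Ys) \<longrightarrow> (\<forall>i<l. sat N (\<beta> i @ [z]) \<rho>) \<longrightarrow>
      wide_inst Xs Ws \<psi> k n d {x \<in> tuples N Xs. (\<forall>i<l. sat N (x @ \<beta> i) \<phi>) \<and> sat N (x @ y) \<delta>}))"
proof -
  let ?l = "Xs # Vs # replicate l Ys"
  have "defn (blk ?l) (\<lambda>g. (\<forall>i\<in>{..<l}. sat N (g 0 @ g (i + 2)) \<phi>) \<and> sat N (g 0 @ g 1) \<delta>)"
    by (intro defn_conj defn_ball defn_sat2) (use \<phi> \<delta> in \<open>simp_all add: blk_def\<close>)
  then obtain \<theta> where \<theta>: "wff L (concat ?l) \<theta>"
    "\<And>es. list_all2 (\<lambda>e \<Gamma>. e \<in> tuples N \<Gamma>) es ?l \<Longrightarrow> sat N (concat es) \<theta> \<longleftrightarrow>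
      (\<forall>i\<in>{..<l}. sat N (blk es 0 @ blk es (i + 2)) \<phi>) \<and> sat N (blk es 0 @ blk es 1) \<delta>"
    by (rule defn_fm) blast
  let ?Zs = "Vs @ concat (replicate l Ys)"
  have "wff L (Xs @ ?Zs) \<theta>" using \<theta>(1) by simp
  from wide_definable[OF \<psi> Xs Ws this] obtain \<tau> where \<tau>: "wff L ?Zs \<tau>" "\<forall>z\<in>tuples N ?Zs. sat N z \<tau> \<longleftrightarrow>
    wide_inst Xs Ws \<psi> k n d {x \<in> tuples N Xs. sat N (x @ z) \<theta>}" by blast
  let ?\<Gamma> = "\<lambda>m::nat. if m < 2 then blk [[s], Vs] m else Ys"
  have "defn ?\<Gamma> (\<lambda>g. (\<forall>i\<in>{..<l}. sat N (g (2 + i) @ g 0) \<rho>) \<and>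
      \<not> sat N (concat (map g (1 # map (\<lambda>i. 2 + i) [0..<l]))) \<tau>)"
  proof (intro defn_conj defn_ball defn_not defn_sat2 defn_sat)
    have "map ?\<Gamma> (map (\<lambda>i. 2 + i) [0..<l]) = replicate l Ys" by (intro nth_equalityI) simp_all
    then show "wff L (concat (map ?\<Gamma> (1 # map (\<lambda>i. 2 + i) [0..<l]))) \<tau>" using \<tau>(1) by (simp del: map_map)
  qed (use \<rho> in simp_all)
  then have "defn ?\<Gamma> (\<lambda>g. (\<forall>i\<in>{..<l}. sat N (g (2 + i) @ g 0) \<rho>) \<and>
      \<not> sat N (g 1 @ concat (map (\<lambda>i. g (2 + i)) [0..<l])) \<tau>)"
    by (simp add: comp_def)
  then have "defn (blk [[s], Vs]) (\<lambda>g. \<exists>\<beta>. (\<forall>i. \<beta> i \<in> tuples N Ys) \<and>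
      ((\<forall>i\<in>{..<l}. sat N (\<beta> i @ g 0) \<rho>) \<and> \<not> sat N (g 1 @ concat (map (\<lambda>i. \<beta> i) [0..<l])) \<tau>))"
    by (rule defn_ex_family[where n = 2]) (use Ys in simp_all)
  from defn_not[OF this] obtain \<pi> where \<pi>: "wff L ([s] @ Vs) \<pi>"
    "\<And>z y. z \<in> tuples N [s] \<Longrightarrow> y \<in> tuples N Vs \<Longrightarrow> sat N (z @ y) \<pi> \<longleftrightarrow> \<not> (\<exists>\<beta>. (\<forall>i. \<beta> i \<in> tuples N Ys) \<and>
      ((\<forall>i\<in>{..<l}. sat N (\<beta> i @ z) \<rho>) \<and> \<not> sat N (y @ concat (map (\<lambda>i. \<beta> i) [0..<l])) \<tau>))"
    by (rule defn_fm2) (simp only: blk_Cons blk_1)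
  have \<tau>': "sat N (y @ concat (map (\<lambda>i. \<beta> i) [0..<l])) \<tau> \<longleftrightarrow>
      wide_inst Xs Ws \<psi> k n d {x \<in> tuples N Xs. (\<forall>i<l. sat N (x @ \<beta> i) \<phi>) \<and> sat N (x @ y) \<delta>}"
    if y: "y \<in> tuples N Vs" and \<beta>: "\<And>i. \<beta> i \<in> tuples N Ys" for y \<beta>
  proof -
    let ?\<beta> = "map (\<lambda>i. \<beta> i) [0..<l]"
    have rep: "map (\<lambda>_. Ys) [0..<l] = replicate l Ys" by (simp add: map_replicate_const)
    have "concat ?\<beta> \<in> tuples N (concat (map (\<lambda>_. Ys) [0..<l]))" by (rule tuples_concat) (rule \<beta>)
    then have "y @ concat ?\<beta> \<in> tuples N ?Zs" using y unfolding rep by (intro tuples_appendI)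
    moreover have "sat N (x @ y @ concat ?\<beta>) \<theta> \<longleftrightarrow> (\<forall>i<l. sat N (x @ \<beta> i) \<phi>) \<and> sat N (x @ y) \<delta>"
      if x: "x \<in> tuples N Xs" for x
    proof -
      have "list_all2 (\<lambda>e \<Gamma>. e \<in> tuples N \<Gamma>) ?\<beta> (replicate l Ys)"
        using \<beta> by (simp add: list_all2_conv_all_nth)
      then have "list_all2 (\<lambda>e \<Gamma>. e \<in> tuples N \<Gamma>) (x # y # ?\<beta>) ?l" using x y by simp
      from \<theta>(2)[OF this] show ?thesis by (simp add: blk_def Ball_def)
    qed
    then have "{x \<in> tuples N Xs. sat N (x @ y @ concat ?\<beta>) \<theta>} =
        {x \<in> tuples N Xs. (\<forall>i<l. sat N (x @ \<beta> i) \<phi>) \<and> sat N (x @ y) \<delta>}" by blast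
    ultimately show ?thesis using \<tau>(2) by simp
  qed
  have "sat N (z # y) \<pi> \<longleftrightarrow> (\<forall>\<beta>. (\<forall>i::nat. \<beta> i \<in> tuples N Ys) \<longrightarrow> (\<forall>i<l. sat N (\<beta> i @ [z]) \<rho>) \<longrightarrow>
      wide_inst Xs Ws \<psi> k n d {x \<in> tuples N Xs. (\<forall>i<l. sat N (x @ \<beta> i) \<phi>) \<and> sat N (x @ y) \<delta>})"
    if "z \<in> univ N s" "y \<in> tuples N Vs" for z y
  proof -
    have "[z] \<in> tuples N [s]" using that(1) by simp
    from \<pi>(2)[OF this that(2)] show ?thesis using \<tau>'[OF that(2)] by (simp add: Ball_def) blast
  qed
  then show ?thesis using \<pi>(1) by blast
qed

end


section \<open>The rank argument for simple theories\<close>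

context rich
begin

text \<open>\<open>Gen z n d l\<close> says that any \<open>l\<close> instances of \<phi> with
  parameters in the set coded by \<open>z\<close> have a wide intersection, for branching
  \<open>n\<close> and height \<open>d\<close>. At \<open>e\<close> this holds up to some largest
  height \<open>h\<close>. One of the dividing formulas covering \<phi>(x, b) preserves height
  \<open>h\<close> on all these intersections. Infinitely many conjugates of its parameter do so
  relative to one and the same conjugate \<open>z\<close> of \<open>e\<close>; being
  \<open>k\<close>-inconsistent, they provide a further level. Thus \<open>z\<close> reaches height
  \<open>Suc h\<close>, although it inherits from \<open>e\<close> the failure at that
  height.\<close>

lemma simple_stable_nonforking:
  assumes simple: "simple_theory L N" and Xs: "set Xs \<subseteq> Sorts L" and "good A"
    and stable: "stable_formula N Xs Ys \<phi>" and \<phi>: "wff L (Xs @ Ys) \<phi>" and Ys: "set Ys \<subseteq> Sorts L"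
    and b: "b \<in> tuples N Ys" and "forks L N Xs A {(\<phi>, b)}"
    and U: "ultra U" and evT: "eventually (\<lambda>x. x \<in> tuples N Xs) U"
    and ev\<phi>: "eventually (\<lambda>x. sat N (x @ b) \<phi>) U"
    and nothorn: "\<And>\<psi>. thorn_divides L N Xs A \<psi> \<Longrightarrow> \<not> eventually (\<lambda>x. x \<in> sols N Xs {\<psi>}) U"
    and two: "s0 \<in> Sorts L" "u \<in> univ N s0" "v \<in> univ N s0" "u \<noteq> v"
  shows False
proof -
  let ?T = "tuples N Xs"
  obtain F where F: "finite F" "\<forall>\<psi>\<in>F. divides L N Xs A \<psi>" "sols N Xs {(\<phi>, b)} \<subseteq> (\<Union>\<psi>\<in>F. sols N Xs {\<psi>})"
    using assms(8) unfolding forks_def by blast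
  define witness where "witness = (\<lambda>f Vs (a'::nat \<Rightarrow> 'a list) k. set Vs \<subseteq> Sorts L \<and> snd f \<in> tuples N Vs \<and>
    wff L (Xs @ Vs) (fst f) \<and> (\<forall>i. a' i \<in> sols N Vs (tp L N Vs A (snd f))) \<and>
    (\<forall>I. finite I \<and> card I = k \<longrightarrow> sols N Xs {(fst f, a' i) | i. i \<in> I} = {}))"
  have "\<forall>f\<in>F. \<exists>Vs a' k. witness f Vs a' k"
  proof
    fix f assume "f \<in> F"
    then have "divides L N Xs A f" using F(2) by blast
    then show "\<exists>Vs a' k. witness f Vs a' k"
      unfolding witness_def divides_def case_prod_beta
      by (elim exE conjE, intro exI conjI) assumption+
  qed
  then obtain V a' kk where wit: "\<And>f. f \<in> F \<Longrightarrow> witness f (V f) (a' f) (kk f)" by metis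
  have V: "set (V f) \<subseteq> Sorts L" and d: "snd f \<in> tuples N (V f)" and \<delta>: "wff L (Xs @ V f) (fst f)"
    and a': "a' f i \<in> sols N (V f) (tp L N (V f) A (snd f))"
    and incons: "\<forall>I. finite I \<and> card I = kk f \<longrightarrow> sols N Xs {(fst f, a' f i) | i. i \<in> I} = {}"
    if "f \<in> F" for f i
    using wit[OF that] unfolding witness_def by (elim conjE, simp)+
  have a'V: "a' f i \<in> tuples N (V f)" if "f \<in> F" for f i using a'[OF that, of i] by (simp add: sols_def)
  \<comment> \<open>A common bound for all disjuncts: inconsistency of all sets of
    \<open>kk f\<close> indices passes to all sets of \<open>k\<close> indices, as
    \<open>kk f\<close> is smaller.\<close>
  obtain k where k: "\<forall>f\<in>F. kk f < k"
    using finite_imageI[OF F(1), of kk] unfolding finite_nat_set_iff_bounded by blast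
  have kinc: "\<not> (\<exists>x\<in>?T. \<forall>i\<in>I. sat N (x @ a' f i) (fst f))" if "f \<in> F" "finite I" "card I = k" for f I
  proof -
    have "kk f \<le> card I" using k that by auto
    then obtain I' where I': "I' \<subseteq> I" "card I' = kk f" "finite I'" by (rule obtain_subset_with_card_n)
    then have "sols N Xs {(fst f, a' f i) | i. i \<in> I'} = {}" using incons[OF that(1)] by blast
    moreover have "x \<in> sols N Xs {(fst f, a' f i) | i. i \<in> I'}"
      if "x \<in> ?T" "\<forall>i\<in>I. sat N (x @ a' f i) (fst f)" for x
      using that I'(1) by (auto simp: sols_def)
    ultimately show ?thesis by blast
  qed
  \<comment> \<open>Trees and the tree property concern one formula, whereas the disjuncts have
    different ones; a single \<psi> is needed whose instances include all conjugates of all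
    disjuncts.\<close>
  define G where "G = (\<lambda>f. (fst f, V f)) ` F"
  have "\<exists>Ws \<psi>. set Ws \<subseteq> Sorts L \<and> wff L (Xs @ Ws) \<psi> \<and> (\<forall>(\<delta>, Ys)\<in>G. \<forall>d\<in>tuples N Ys.
    \<exists>w\<in>tuples N Ws. \<forall>x\<in>tuples N Xs. sat N (x @ w) \<psi> \<longleftrightarrow> sat N (x @ d) \<delta>)"
    by (rule merge_formulas[OF _ _ two]) (use F(1) V \<delta> in \<open>auto simp: G_def\<close>)
  then obtain Ws \<psi> where Ws: "set Ws \<subseteq> Sorts L" and \<psi>: "wff L (Xs @ Ws) \<psi>"
    and merge: "\<forall>(\<delta>, Ys)\<in>G. \<forall>d\<in>tuples N Ys. \<exists>w\<in>tuples N Ws. \<forall>x\<in>?T. sat N (x @ w) \<psi> \<longleftrightarrow> sat N (x @ d) \<delta>"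
    by blast
  have "\<exists>w\<in>tuples N Ws. \<forall>x\<in>?T. sat N (x @ w) \<psi> \<longleftrightarrow> sat N (x @ a' f i) (fst f)" if "f \<in> F" for f i
  proof -
    have "(fst f, V f) \<in> G" using that by (simp add: G_def)
    from bspec[OF merge this] show ?thesis using a'V[OF that] by simp
  qed
  then obtain cw where cw: "\<And>f i. f \<in> F \<Longrightarrow> cw f i \<in> tuples N Ws"
    "\<And>f i x. f \<in> F \<Longrightarrow> x \<in> ?T \<Longrightarrow> sat N (x @ cw f i) \<psi> \<longleftrightarrow> sat N (x @ a' f i) (fst f)" by metis
  let ?wide = "wide_inst Xs Ws \<psi> k"
  have "\<not> tree_property N Xs Ws \<psi>" using simple \<psi> Xs Ws unfolding simple_theory_def by simp
  then obtain n0 d0 where narrow: "\<not> ?wide n0 d0 ?T" using tree_property_of_wide[OF \<psi> Xs Ws] by blast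
  have sorts: "set (Xs @ Ys) \<subseteq> Sorts L" using Xs Ys by simp
  obtain s e \<rho> where s: "s \<in> Sorts L" and e: "e \<in> univ N s" and \<rho>: "wff L (Ys @ [s]) \<rho>"
    and \<rho>U: "\<And>b. b \<in> tuples N Ys \<Longrightarrow> sat N (b @ [e]) \<rho> \<longleftrightarrow> eventually (\<lambda>x. sat N (x @ b) \<phi>) U"
    and alg: "algebraic N [s] (tp L N [s] A [e])"
    by (rule code_algebraic[OF stable \<phi> sorts U evT assms(3) nothorn]) blast+
  define fam where "fam = (\<lambda>z l \<beta>. (\<forall>i::nat. \<beta> i \<in> tuples N Ys) \<and> (\<forall>i<l. sat N (\<beta> i @ [z]) \<rho>))"
  define X where "X = (\<lambda>l (\<beta>::nat \<Rightarrow> 'a list). {x \<in> ?T. \<forall>i<l. sat N (x @ \<beta> i) \<phi>})"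
  define Gen where "Gen = (\<lambda>z n d l. \<forall>\<beta>. fam z l \<beta> \<longrightarrow> ?wide n d (X l \<beta>))"
  have Gen0: "Gen e n 0 l" for n l
  proof -
    have "X l \<beta> \<noteq> {}" if "fam e l \<beta>" for \<beta>
    proof -
      have "eventually (\<lambda>x. \<forall>i\<in>{..<l}. sat N (x @ \<beta> i) \<phi>) U"
        by (rule eventually_ball_finite) (use that \<rho>U in \<open>auto simp: fam_def\<close>)
      from ultra_ex[OF U eventually_conj[OF evT this]] show ?thesis unfolding X_def by blast
    qed
    then show ?thesis by (simp add: Gen_def)
  qed
  have "\<not> Gen e n0 d0 0"
  proof
    assume "Gen e n0 d0 0"
    moreover have "fam e 0 (\<lambda>_. b)" using b by (simp add: fam_def)
    ultimately have "?wide n0 d0 (X 0 (\<lambda>_. b))" unfolding Gen_def by blast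
    then show False using narrow by (simp add: X_def)
  qed
  then have "\<exists>n l. \<not> Gen e n d0 l" by blast
  moreover have "\<not> (\<exists>n l. \<not> Gen e n 0 l)" using Gen0 by blast
  \<comment> \<open>\<open>h\<close> is the rank of the positive \<phi>-part of \<open>U\<close>:
    all finite intersections are wide of height \<open>h\<close> for every branching, but not of
    height \<open>Suc h\<close>. It exists because height 0 is always reached and \<open>d0\<close>
    is not.\<close>
  ultimately obtain h where h: "\<forall>n l. Gen e n h l" "\<exists>n l. \<not> Gen e n (Suc h) l"
    using ex_least_nat_less[of "\<lambda>d. \<exists>n l. \<not> Gen e n d l" d0] by blast
  then obtain n1 l1 where n1: "\<not> Gen e n1 (Suc h) l1" by blast
  define H where "H = (\<lambda>z (f::('s, 'f, 'r, 'a) inst) y n l. \<forall>\<beta>. fam z l \<beta> \<longrightarrow> ?wide n h {x \<in> X l \<beta>. sat N (x @ y) (fst f)})"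
  \<comment> \<open>Otherwise each disjunct has a family on which it loses width. The union of these
    families still has a wide intersection, covered by the disjuncts; one disjunct stays wide on it,
    and by monotonicity also on its own family.\<close>
  have "\<exists>f\<in>F. \<forall>n l. H e f (snd f) n l"
  proof (rule ccontr)
    assume "\<not> ?thesis"
    define bad where "bad = (\<lambda>f n l \<beta>. fam e l \<beta> \<and> \<not> ?wide n h {x \<in> X l \<beta>. sat N (x @ snd f) (fst f)})"
    have "\<forall>f\<in>F. \<exists>n l \<beta>. bad f n l \<beta>"
    proof
      fix f assume "f \<in> F"
      then obtain n l where "\<not> H e f (snd f) n l" using \<open>\<not> (\<exists>f\<in>F. \<forall>n l. H e f (snd f) n l)\<close> by blast
      then show "\<exists>n l \<beta>. bad f n l \<beta>" unfolding H_def bad_def not_all not_imp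
        by (elim exE) (intro exI)
    qed
    then obtain nf lf \<beta>f where "\<And>f. f \<in> F \<Longrightarrow> bad f (nf f) (lf f) (\<beta>f f)" by metis
    then have bad: "fam e (lf f) (\<beta>f f)" "\<not> ?wide (nf f) h {x \<in> X (lf f) (\<beta>f f). sat N (x @ snd f) (fst f)}"
      if "f \<in> F" for f using that by (simp_all add: bad_def)
    \<comment> \<open>\<open>b\<close> is included so that the intersection consists of solutions of
      \<phi>(x, b), which the disjuncts cover.\<close>
    define B where "B = insert b (\<Union>f\<in>F. \<beta>f f ` {..<lf f})"
    have "finite B" using F(1) by (simp add: B_def)
    then obtain g where g: "bij_betw g {..<card B} B"
      using ex_bij_betw_nat_finite by (auto simp: atLeast0LessThan)
    define \<beta> where "\<beta> = (\<lambda>i. if i < card B then g i else b)"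
    have range: "\<beta> ` {..<card B} = B" using g by (auto simp: \<beta>_def bij_betw_def)
    have B: "y \<in> tuples N Ys \<and> sat N (y @ [e]) \<rho>" if yB: "y \<in> B" for y
    proof (cases "y = b")
      case True
      then show ?thesis using b \<rho>U[OF b] ev\<phi> by simp
    next
      case False
      then obtain f i where "f \<in> F" "i < lf f" "y = \<beta>f f i" using yB unfolding B_def by blast
      then show ?thesis using bad(1) unfolding fam_def by blast
    qed
    have "\<beta> i \<in> B" for i
    proof (cases "i < card B")
      case True
      then have "\<beta> i \<in> \<beta> ` {..<card B}" by simp
      then show ?thesis unfolding range .
    qed (simp add: \<beta>_def B_def)
    then have fam: "fam e (card B) \<beta>" using B by (simp add: fam_def)
    have wideX: "?wide n h (X (card B) \<beta>)" for n
    proof -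
      have "Gen e n h (card B)" using h(1) by blast
      then show ?thesis using fam by (simp add: Gen_def)
    qed
    have "(\<forall>i<card B. sat N (x @ \<beta> i) \<phi>) \<longleftrightarrow> (\<forall>y\<in>\<beta> ` {..<card B}. sat N (x @ y) \<phi>)" for x by auto
    then have X: "X (card B) \<beta> = {x \<in> ?T. \<forall>y\<in>B. sat N (x @ y) \<phi>}"
      unfolding X_def range by simp
    have "b \<in> B" by (simp add: B_def)
    have sub: "X (card B) \<beta> \<subseteq> (\<Union>f\<in>F. {x \<in> X (card B) \<beta>. sat N (x @ snd f) (fst f)})"
    proof
      fix x assume x: "x \<in> X (card B) \<beta>"
      then have "x \<in> ?T" "sat N (x @ b) \<phi>" unfolding X using \<open>b \<in> B\<close> by simp_all
      then have "x \<in> sols N Xs {(\<phi>, b)}" by (simp add: sols_def)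
      then have "x \<in> (\<Union>\<psi>\<in>F. sols N Xs {\<psi>})" using F(3) by (rule rev_subsetD)
      then obtain f where "f \<in> F" "x \<in> sols N Xs {f}" by (rule UN_E)
      then show "x \<in> (\<Union>f\<in>F. {x \<in> X (card B) \<beta>. sat N (x @ snd f) (fst f)})"
        using x unfolding sols_def by (auto simp: case_prod_beta)
    qed
    have "F \<noteq> {}"
    proof -
      obtain x where "x \<in> ?T \<and> sat N (x @ b) \<phi>" using ultra_ex[OF U eventually_conj[OF evT ev\<phi>]] ..
      then have "x \<in> sols N Xs {(\<phi>, b)}" by (simp add: sols_def)
      then have "x \<in> (\<Union>\<psi>\<in>F. sols N Xs {\<psi>})" using F(3) by (rule rev_subsetD)
      then obtain \<psi> where "\<psi> \<in> F" by (rule UN_E)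
      then show ?thesis by (metis empty_iff)
    qed
    \<comment> \<open>\<open>sum nf F\<close> dominates the branching number of each disjunct's
      counterexample.\<close>
    have "\<exists>f\<in>F. ?wide (sum nf F) h {x \<in> X (card B) \<beta>. sat N (x @ snd f) (fst f)}"
      by (rule wide_UN[OF F(1) \<open>F \<noteq> {}\<close> wide_mono[OF wideX sub]])
    then obtain f where f: "f \<in> F" "?wide (sum nf F) h {x \<in> X (card B) \<beta>. sat N (x @ snd f) (fst f)}" by blast
    have "nf f \<le> sum nf F" by (rule member_le_sum[OF f(1) _ F(1)]) simp
    from wide_fewer[OF f(2) this]
    have "?wide (nf f) h {x \<in> X (card B) \<beta>. sat N (x @ snd f) (fst f)}" .
    moreover have "{x \<in> X (card B) \<beta>. sat N (x @ snd f) (fst f)} \<subseteq> {x \<in> X (lf f) (\<beta>f f). sat N (x @ snd f) (fst f)}"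
    proof -
      have "\<beta>f f i \<in> B" if "i < lf f" for i using f(1) that unfolding B_def by blast
      then have "X (card B) \<beta> \<subseteq> X (lf f) (\<beta>f f)" unfolding X unfolding X_def by auto
      then show ?thesis by auto
    qed
    ultimately have "?wide (nf f) h {x \<in> X (lf f) (\<beta>f f). sat N (x @ snd f) (fst f)}" by (rule wide_mono)
    then show False using bad(2)[OF f(1)] by blast
  qed
  then obtain f where f: "f \<in> F" and Hf: "\<And>n l. H e f (snd f) n l" by blast
  obtain \<pi> where \<pi>: "wff L ([s] @ V f) \<pi>" and "\<forall>z\<in>univ N s. \<forall>y\<in>tuples N (V f). sat N (z # y) \<pi> \<longleftrightarrow>
    (\<forall>\<beta>. (\<forall>i::nat. \<beta> i \<in> tuples N Ys) \<longrightarrow> (\<forall>i<l1. sat N (\<beta> i @ [z]) \<rho>) \<longrightarrow>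
      ?wide n1 h {x \<in> ?T. (\<forall>i<l1. sat N (x @ \<beta> i) \<phi>) \<and> sat N (x @ y) (fst f)})"
    using wide_family_definable[OF \<psi> Xs Ws \<phi> Ys \<rho> \<delta>[OF f], of l1 k n1 h] by (elim exE conjE) blast
  then have \<pi>H: "sat N (z # y) \<pi> \<longleftrightarrow> H z f y n1 l1" if "z \<in> univ N s" "y \<in> tuples N (V f)" for z y
    using that unfolding H_def fam_def X_def by (simp add: conj_assoc imp_conjL)
  \<comment> \<open>A tautology in place of the additional instance makes the definability lemma
    speak of the bare intersections.\<close>
  obtain tt where tt: "wff L Xs tt" "\<And>x. x \<in> ?T \<Longrightarrow> sat N x tt"
    using defn_fm1[OF defn_const[of "blk [Xs]" True]] by metis
  have tt0: "wff L (Xs @ []) tt" using tt(1) by simp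
  obtain \<kappa> where \<kappa>: "wff L ([s] @ []) \<kappa>" and "\<forall>z\<in>univ N s. \<forall>y\<in>tuples N []. sat N (z # y) \<kappa> \<longleftrightarrow>
    (\<forall>\<beta>. (\<forall>i::nat. \<beta> i \<in> tuples N Ys) \<longrightarrow> (\<forall>i<l1. sat N (\<beta> i @ [z]) \<rho>) \<longrightarrow>
      ?wide n1 (Suc h) {x \<in> ?T. (\<forall>i<l1. sat N (x @ \<beta> i) \<phi>) \<and> sat N (x @ y) tt})"
    using wide_family_definable[OF \<psi> Xs Ws \<phi> Ys \<rho> tt0, of l1 k n1 "Suc h"] by (elim exE conjE) blast
  moreover have "{x \<in> ?T. (\<forall>i<l1. sat N (x @ \<beta> i) \<phi>) \<and> sat N (x @ []) tt} = X l1 \<beta>" for \<beta>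
    using tt(2) unfolding X_def by auto
  ultimately have \<kappa>G: "sat N [z] \<kappa> \<longleftrightarrow> Gen z n1 (Suc h) l1" if "z \<in> univ N s" for z
    using that unfolding Gen_def fam_def by (simp add: imp_conjL del: wide.simps)
  have e\<kappa>: "sat N [e] (Neg \<kappa>)" using \<kappa>G[OF e] n1 by simp
  have e\<pi>: "sat N (e # snd f) \<pi>" using \<pi>H[OF e d[OF f]] Hf by simp
  have \<kappa>': "wff L [s] (Neg \<kappa>)" using \<kappa> by simp
  obtain z where z: "z \<in> univ N s" "sat N [z] (Neg \<kappa>)" "infinite {i. sat N (z # a' f i) \<pi>}"
    by (rule algebraic_type_transfer[OF alg s e V[OF f] \<pi> \<kappa>' d[OF f] e\<pi> e\<kappa> a'[OF f]])
  have "Gen z n1 (Suc h) l1" unfolding Gen_def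
  proof (intro allI impI)
    fix \<beta> assume \<beta>: "fam z l1 \<beta>"
    show "?wide n1 (Suc h) (X l1 \<beta>)"
    proof (rule wide_reindex[of "cw f" _ "{i. sat N (z # a' f i) \<pi>}"])
      show "cw f j \<in> tuples N Ws" for j by (rule cw(1)[OF f])
      show "\<not> (\<exists>x\<in>?T. \<forall>i\<in>I. sat N (x @ cw f i) \<psi>)" if "finite I" "card I = k" for I
        using kinc[OF f that] cw(2)[OF f] by simp
      show "n1 \<le> card {i. sat N (z # a' f i) \<pi>} \<or> infinite {i. sat N (z # a' f i) \<pi>}" using z(3) by simp
      fix j assume "j \<in> {i. sat N (z # a' f i) \<pi>}"
      then have "H z f (a' f j) n1 l1" using \<pi>H[OF z(1) a'V[OF f]] by simp
      then have "?wide n1 h {x \<in> X l1 \<beta>. sat N (x @ a' f j) (fst f)}" using \<beta> unfolding H_def by blast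
      moreover have "{x \<in> X l1 \<beta>. sat N (x @ a' f j) (fst f)} = {x \<in> X l1 \<beta>. sat N (x @ cw f j) \<psi>}"
        using cw(2)[OF f] unfolding X_def by blast
      ultimately show "?wide n1 h {x \<in> X l1 \<beta>. sat N (x @ cw f j) \<psi>}" by simp
    qed
  qed
  then show False using z(2) \<kappa>G[OF z(1)] by simp
qed

end


section \<open>Realizing ultrafilters on sequences in the monster model\<close>

lemma home_ctx_eq: "\<Gamma> = home_ctx (length \<Gamma>)"
  by (simp add: replicate_length_same)

locale monster =
  fixes L :: "(unit, 'f, 'r) signature" and C :: "(unit, 'f, 'r, 'a) struct"
  assumes sorts: "Sorts L = UNIV" and saturated: "saturated L C"
    and uncountable: "|UNIV :: nat set| <o |points L C|"
begin

lemma points_univ: "points L C = univ C ()"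
  by (auto simp: points_def sorts)

lemma infinite_univ: "infinite (univ C ())"
proof -
  have "|UNIV :: nat set| \<le>o |univ C ()|" using ordLess_imp_ordLeq[OF uncountable] points_univ by simp
  then show ?thesis using card_of_ordLeq_infinite infinite_UNIV_nat by blast
qed

sublocale home: mstruct L C
  using infinite_univ by unfold_locales (auto simp: sorts)

lemma realize_type:
  assumes "B \<subseteq> univ C ()" and "|B| <o |univ C ()|" and "p \<in> complete_types L C [()] B"
  shows "\<exists>a\<in>univ C (). [a] \<in> sols C [()] p"
proof -
  have "small L C B" using assms(1,2) by (simp add: small_def points_univ)
  then have "sols C [()] p \<noteq> {}" using saturated assms(3) by (simp add: saturated_def sorts)
  then obtain x where "x \<in> sols C [()] p" by blast
  moreover from this obtain a where "a \<in> univ C ()" "x = [a]" by (auto simp: sols_def)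
  ultimately show ?thesis by blast
qed

text \<open>\<open>us\<close> has over \<open>B\<close> the type of the initial segments of sequences according to \<open>U\<close>.\<close>

definition follows :: "(nat \<Rightarrow> 'a) filter \<Rightarrow> 'a set \<Rightarrow> 'a list \<Rightarrow> bool" where
  "follows U B us \<longleftrightarrow> us \<in> tuples C (home_ctx (length us)) \<and>
    (\<forall>c \<phi>. set c \<subseteq> B \<longrightarrow> wff L (home_ctx (length us) @ home_ctx (length c)) \<phi> \<longrightarrow>
      eventually (\<lambda>u. sat C (map u [0..<length us] @ c) \<phi>) U \<longrightarrow> sat C (us @ c) \<phi>)"

lemma tuples_home: "set c \<subseteq> univ C () \<Longrightarrow> c \<in> tuples C (home_ctx (length c))"
  by (auto simp: tuples_def list_all2_conv_all_nth)

lemma set_tuples_home: "c \<in> tuples C \<Gamma> \<Longrightarrow> set c \<subseteq> univ C ()"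
  using tuples_points[of \<Gamma> L c C] points_univ sorts by auto

text \<open>Saturation realizes types in one variable only. The type of the next coordinate over
  \<open>B\<close> and \<open>us\<close> is read off from \<open>U\<close>. Finitely many of its
  formulas are consistent: that they have a common solution holds eventually for the initial
  segments, and therefore for \<open>us\<close>.\<close>

lemma follows_step:
  assumes U: "ultra U" and evU: "eventually (\<lambda>u. \<forall>i. u i \<in> univ C ()) U"
    and B: "B \<subseteq> univ C ()" "|B| <o |univ C ()|" and us: "follows U B us"
  shows "\<exists>a. follows U B (us @ [a])"
proof -
  let ?n = "length us"
  let ?B = "B \<union> set us"
  have usT: "us \<in> tuples C (home_ctx ?n)" using us by (simp add: follows_def)
  have B': "?B \<subseteq> univ C ()" using B(1) set_tuples_home[OF usT] by simp
  have "|set us| <o |univ C ()|"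
    using finite_ordLess_infinite[OF card_of_Well_order card_of_Well_order, of "set us" "univ C ()"] infinite_univ
    by (simp add: Field_card_of)
  then have card: "|?B| <o |univ C ()|" by (intro card_of_Un_ordLess_infinite[OF infinite_univ B(2)])
  \<comment> \<open>\<phi>' is \<phi> with the parameters taken from \<open>us\<close> turned into
    variables; only in this form can it be evaluated along the sequences of
    \<open>U\<close>.\<close>
  define good where "good = (\<lambda>\<phi> b \<phi>' d'. set d' \<subseteq> B \<and>
    wff L ([()] @ home_ctx ?n @ home_ctx (length d')) \<phi>' \<and>
    (\<forall>e\<in>tuples C [()]. sat C (e @ us @ d') \<phi>' \<longleftrightarrow> sat C (e @ b) \<phi>))"
  define ev where "ev = (\<lambda>\<phi>' d'. eventually (\<lambda>u. sat C ([u ?n] @ map u [0..<?n] @ d') \<phi>') U)"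
  define p where "p = {(\<phi>, b) \<in> insts L C [()] ?B. \<exists>\<phi>' d'. good \<phi> b \<phi>' d' \<and> ev \<phi>' d'}"
  have good_ex: "\<exists>\<phi>' d'. good \<phi> b \<phi>' d'" if inst: "(\<phi>, b) \<in> insts L C [()] ?B" for \<phi> b
  proof -
    obtain Zs where Zs: "set b \<subseteq> ?B" "b \<in> tuples C Zs" "wff L ([()] @ Zs) \<phi>"
      using inst by (auto simp: insts_def)
    obtain \<phi>' d' Zs' where "d' \<in> tuples C Zs'" "set d' \<subseteq> B" "wff L ([()] @ home_ctx ?n @ Zs') \<phi>'"
      "\<And>e. e \<in> tuples C [()] \<Longrightarrow> sat C (e @ us @ d') \<phi>' \<longleftrightarrow> sat C (e @ b) \<phi>"
      by (rule home.reparametrize[OF Zs(3,2) _ usT _ Zs(1)]) (auto simp: sorts)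
    moreover have "Zs' = home_ctx (length d')"
      using home_ctx_eq[of Zs'] tuples_length[OF calculation(1)] by simp
    ultimately show ?thesis unfolding good_def by (intro exI[of _ \<phi>'] exI[of _ d']) simp
  qed
  have "consistent C [()] p" unfolding consistent_def
  proof (intro allI impI, elim conjE)
    fix F assume F: "finite F" "F \<subseteq> p"
    have "\<forall>f\<in>F. \<exists>\<phi>' d'. good (fst f) (snd f) \<phi>' d' \<and> ev \<phi>' d'"
    proof
      fix f assume "f \<in> F"
      then have "f \<in> p" using F(2) by blast
      moreover obtain \<phi> b where "f = (\<phi>, b)" by (rule prod.exhaust)
      ultimately show "\<exists>\<phi>' d'. good (fst f) (snd f) \<phi>' d' \<and> ev \<phi>' d'" by (simp add: p_def)
    qed
    then obtain \<Phi> D where g: "\<And>f. f \<in> F \<Longrightarrow> good (fst f) (snd f) (\<Phi> f) (D f)"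
      and e: "\<And>f. f \<in> F \<Longrightarrow> ev (\<Phi> f) (D f)" by metis
    obtain fs where fs: "set fs = F" using finite_list[OF F(1)] by blast
    let ?m = "length fs"
    let ?l = "home_ctx ?n # map (\<lambda>f. home_ctx (length (D f))) fs"
    have "home.defn (blk ?l) (\<lambda>g. \<exists>v\<in>tuples C [()]. \<forall>i\<in>{..<?m}. sat C (v @ g 0 @ g (Suc i)) (\<Phi> (fs ! i)))"
    proof (rule home.defn_ex[where i = "Suc ?m"], rule home.defn_ball[OF finite_lessThan], rule home.defn_sat3)
      fix i assume "i \<in> {..<?m}"
      then show "wff L (((blk ?l)(Suc ?m := [()])) (Suc ?m) @ ((blk ?l)(Suc ?m := [()])) 0 @
          ((blk ?l)(Suc ?m := [()])) (Suc i)) (\<Phi> (fs ! i))"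
        using g[of "fs ! i"] fs nth_mem[of i fs] by (simp add: good_def blk_def)
    next
      fix g :: "nat \<Rightarrow> 'a list" and v
      have "(g(Suc ?m := v)) (Suc i) = g (Suc i)" "(g(Suc ?m := v)) 0 = g 0" if "i \<in> {..<?m}" for i using that by auto
      then show "(\<lambda>w. \<forall>i\<in>{..<?m}. sat C (w @ (g(Suc ?m := v)) 0 @ (g(Suc ?m := v)) (Suc i)) (\<Phi> (fs ! i))) =
          (\<lambda>w. \<forall>i\<in>{..<?m}. sat C (w @ g 0 @ g (Suc i)) (\<Phi> (fs ! i)))" by simp
    qed (simp add: sorts)
    then obtain \<chi> where \<chi>: "wff L (concat ?l) \<chi>"
      "\<And>es. list_all2 (\<lambda>e \<Gamma>. e \<in> tuples C \<Gamma>) es ?l \<Longrightarrow> sat C (concat es) \<chi> \<longleftrightarrow>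
        (\<exists>v\<in>tuples C [()]. \<forall>i\<in>{..<?m}. sat C (v @ blk es 0 @ blk es (Suc i)) (\<Phi> (fs ! i)))"
      by (rule home.defn_fm) blast
    let ?c = "concat (map D fs)"
    have DB: "set (D f) \<subseteq> B" if "f \<in> F" for f using g[OF that] by (simp add: good_def)
    then have cB: "set ?c \<subseteq> B" using fs by auto
    have "D f \<in> tuples C (home_ctx (length (D f)))" if "f \<in> F" for f
      using DB[OF that] B(1) by (intro tuples_home) blast
    then have all: "list_all2 (\<lambda>e \<Gamma>. e \<in> tuples C \<Gamma>) (map D fs) (map (\<lambda>f. home_ctx (length (D f))) fs)"
      unfolding fs[symmetric] by (simp add: list_all2_conv_all_nth)
    have \<chi>c: "sat C (w @ ?c) \<chi> \<longleftrightarrow> (\<exists>v\<in>tuples C [()]. \<forall>f\<in>F. sat C (v @ w @ D f) (\<Phi> f))"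
      if w: "w \<in> tuples C (home_ctx ?n)" for w
    proof -
      have "list_all2 (\<lambda>e \<Gamma>. e \<in> tuples C \<Gamma>) (w # map D fs) ?l" using w all by simp
      from \<chi>(2)[OF this] have "sat C (w @ ?c) \<chi> \<longleftrightarrow>
        (\<exists>v\<in>tuples C [()]. \<forall>i\<in>{..<?m}. sat C (v @ w @ D (fs ! i)) (\<Phi> (fs ! i)))" by (simp add: blk_def)
      moreover have "(\<forall>i\<in>{..<?m}. sat C (v @ w @ D (fs ! i)) (\<Phi> (fs ! i))) \<longleftrightarrow>
          (\<forall>f\<in>F. sat C (v @ w @ D f) (\<Phi> f))" for v
        unfolding fs[symmetric] all_set_conv_all_nth by (simp add: Ball_def)
      ultimately show ?thesis by simp
    qed
    have "eventually (\<lambda>u. \<forall>f\<in>F. sat C ([u ?n] @ map u [0..<?n] @ D f) (\<Phi> f)) U"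
      using e F(1) by (intro eventually_ball_finite) (auto simp: ev_def)
    with evU have "eventually (\<lambda>u. sat C (map u [0..<?n] @ ?c) \<chi>) U"
    proof eventually_elim
      case (elim u)
      then have "map u [0..<?n] \<in> tuples C (home_ctx ?n)" using tuples_home[of "map u [0..<?n]"] by auto
      then show ?case unfolding \<chi>c[OF \<open>map u [0..<?n] \<in> tuples C (home_ctx ?n)\<close>]
        using elim by (intro bexI[of _ "[u ?n]"]) simp_all
    qed
    moreover have "wff L (home_ctx ?n @ home_ctx (length ?c)) \<chi>"
      using \<chi>(1) home_ctx_eq[of "concat (map (\<lambda>f. home_ctx (length (D f))) fs)"]
      by (simp add: length_concat comp_def)
    ultimately have "sat C (us @ ?c) \<chi>" using us cB by (simp add: follows_def)
    then obtain v where v: "v \<in> tuples C [()]" "\<forall>f\<in>F. sat C (v @ us @ D f) (\<Phi> f)" using \<chi>c[OF usT] by blast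
    have "sat C (v @ snd f) (fst f)" if "f \<in> F" for f
      using g[OF that] v that unfolding good_def by blast
    then have "v \<in> sols C [()] F" using v(1) by (auto simp: sols_def)
    then show "sols C [()] F \<noteq> {}" by blast
  qed
  moreover have "(\<phi>, b) \<in> p \<or> (Neg \<phi>, b) \<in> p" if \<phi>: "(\<phi>, b) \<in> insts L C [()] ?B" for \<phi> b
  proof -
    obtain \<phi>' d' where g: "good \<phi> b \<phi>' d'" using good_ex[OF \<phi>] by blast
    then have g': "good (Neg \<phi>) b (Neg \<phi>') d'" by (simp add: good_def)
    have N: "(Neg \<phi>, b) \<in> insts L C [()] ?B" using \<phi> by (auto simp: insts_def)
    have "ev \<phi>' d' \<or> ev (Neg \<phi>') d'" using ultra_not[OF U] by (simp add: ev_def)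
    then show ?thesis using \<phi> N g g' by (auto simp: p_def)
  qed
  then have "\<forall>(\<phi>, b)\<in>insts L C [()] ?B. (\<phi>, b) \<in> p \<or> (Neg \<phi>, b) \<in> p" by blast
  moreover have "p \<subseteq> insts L C [()] ?B" by (auto simp: p_def)
  ultimately have "p \<in> complete_types L C [()] ?B" by (simp add: complete_types_def)
  from realize_type[OF B' card this] obtain a where a: "a \<in> univ C ()" "[a] \<in> sols C [()] p" by blast
  have "follows U B (us @ [a])" unfolding follows_def
  proof (intro conjI allI impI)
    show "us @ [a] \<in> tuples C (home_ctx (length (us @ [a])))"
      using a(1) B' by (intro tuples_home) auto
    fix c \<phi> assume c: "set c \<subseteq> B" and \<phi>: "wff L (home_ctx (length (us @ [a])) @ home_ctx (length c)) \<phi>"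
      and evc: "eventually (\<lambda>u. sat C (map u [0..<length (us @ [a])] @ c) \<phi>) U"
    have cT: "c \<in> tuples C (home_ctx (length c))" using c B(1) by (intro tuples_home) blast
    have ctx: "home_ctx (length (us @ [a])) = home_ctx ?n @ [()]" by (simp add: replicate_append_same)
    have \<phi>n: "wff L (home_ctx ?n @ [()] @ home_ctx (length c)) \<phi>"
      using \<phi> unfolding ctx by (simp only: append_assoc)
    \<comment> \<open>The type \<open>p\<close> has the new coordinate in front, whereas in
      \<open>us @ [a]\<close> it comes last.\<close>
    obtain \<psi> where \<psi>: "wff L ([()] @ home_ctx ?n @ home_ctx (length c)) \<psi>"
      "\<And>v w z. v \<in> tuples C [()] \<Longrightarrow> w \<in> tuples C (home_ctx ?n) \<Longrightarrow> z \<in> tuples C (home_ctx (length c)) \<Longrightarrow>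
        sat C (v @ w @ z) \<psi> \<longleftrightarrow> sat C (w @ v @ z) \<phi>"
      by (rule home.defn_fm3[OF home.defn_sat3[of "blk [[()], home_ctx ?n, home_ctx (length c)]" 1 0 2 \<phi>]])
        (use \<phi>n in \<open>simp_all del: tuples_singleton\<close>)
    have aT: "[a] \<in> tuples C [()]" using a(1) by simp
    have "(\<psi>, us @ c) \<in> insts L C [()] ?B"
      unfolding insts_def using \<psi>(1) usT cT c
      by (auto simp: sorts intro!: exI[of _ "home_ctx ?n @ home_ctx (length c)"] tuples_appendI)
    moreover have "good \<psi> (us @ c) \<psi> c" using c \<psi>(1) by (simp add: good_def)
    moreover have "ev \<psi> c" unfolding ev_def using evc evU
    proof eventually_elim
      case (elim u)
      have "map u [0..<?n] \<in> tuples C (home_ctx ?n)" using elim(2) tuples_home[of "map u [0..<?n]"] by auto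
      moreover have "[u ?n] \<in> tuples C [()]" using elim(2) by simp
      ultimately show ?case using \<psi>(2)[of "[u ?n]" "map u [0..<?n]" c] cT elim(1) by simp
    qed
    ultimately have "(\<psi>, us @ c) \<in> p" by (auto simp: p_def)
    then have "sat C ([a] @ us @ c) \<psi>" using a(2) by (auto simp: sols_def)
    then show "sat C ((us @ [a]) @ c) \<phi>" using \<psi>(2)[OF aT usT cT] by simp
  qed
  then show ?thesis by blast
qed

text \<open>Compactness with infinitely many blocks requires a whole sequence, built coordinate by
  coordinate. This is enough because a formula sees only an initial segment.\<close>

lemma realize_sequence:
  assumes U: "ultra U" and evU: "eventually (\<lambda>u. \<forall>i. u i \<in> univ C ()) U"
    and B: "B \<subseteq> univ C ()" "|B| <o |univ C ()|"
  obtains u :: "nat \<Rightarrow> 'a" where "\<And>i. u i \<in> univ C ()"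
    and "\<And>vs c \<phi>. set c \<subseteq> B \<Longrightarrow> wff L (home_ctx (length vs + length c)) \<phi> \<Longrightarrow>
      eventually (\<lambda>u'. sat C (map u' vs @ c) \<phi>) U \<Longrightarrow> sat C (map u vs @ c) \<phi>"
proof -
  define f where "f = rec_nat [] (\<lambda>_ us. us @ [SOME a. follows U B (us @ [a])])"
  have f0: "f 0 = []" and fS: "f (Suc n) = f n @ [SOME a. follows U B (f n @ [a])]" for n by (simp_all add: f_def)
  have len: "length (f n) = n" for n by (induction n) (simp_all add: f0 fS)
  have fol: "follows U B (f n)" for n
  proof (induction n)
    case 0
    show ?case by (auto simp: f0 follows_def dest: ultra_ex[OF U])
  next
    case (Suc n)
    show ?case unfolding fS by (rule someI_ex[OF follows_step[OF U evU B Suc]])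
  qed
  define u where "u = (\<lambda>i. f (Suc i) ! i)"
  have fu: "f n = map u [0..<n]" for n
  proof (induction n)
    case (Suc n)
    have "u n = (SOME a. follows U B (f n @ [a]))" using len[of n] by (simp add: u_def fS nth_append)
    then show ?case using Suc fS[of n] by simp
  qed (simp add: f0)
  show thesis
  proof (rule that[of u])
    show "u i \<in> univ C ()" for i
      using set_tuples_home[of "f (Suc i)"] fol[of "Suc i"] unfolding follows_def fu by auto
    fix vs c \<phi> assume c: "set c \<subseteq> B" and \<phi>: "wff L (home_ctx (length vs + length c)) \<phi>"
      and ev: "eventually (\<lambda>u'. sat C (map u' vs @ c) \<phi>) U"
    obtain n where n: "\<forall>i\<in>set vs. i < n" using finite_nat_set_iff_bounded[of "set vs"] by auto
    define js where "js = vs @ [n..<n + length c]"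
    have "set js \<subseteq> {..<length (home_ctx n @ home_ctx (length c))}"
      using n by (auto simp: js_def intro: less_le_trans)
    moreover have "map ((!) (home_ctx n @ home_ctx (length c))) js = home_ctx (length vs + length c)"
      by (rule nth_equalityI) (simp_all add: js_def)
    ultimately obtain \<phi>' where \<phi>': "wff L (home_ctx n @ home_ctx (length c)) \<phi>'"
      "\<And>e. sat C e \<phi>' \<longleftrightarrow> sat C (map ((!) e) js) \<phi>"
      using rename_fm[OF \<phi>] by metis
    have "map ((!) (map u' [0..<n] @ c)) js = map u' vs @ c" for u'
      using n by (auto simp: js_def nth_append intro!: nth_equalityI)
    then have eq: "sat C (map u' [0..<n] @ c) \<phi>' \<longleftrightarrow> sat C (map u' vs @ c) \<phi>" for u' using \<phi>'(2) by simp
    have "sat C (f n @ c) \<phi>'" using fol[of n] c \<phi>'(1) ev unfolding follows_def by (simp add: len eq)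
    then show "sat C (map u vs @ c) \<phi>" using eq by (simp add: fu)
  qed
qed

end


section \<open>Representatives of imaginaries\<close>

fun rep_len :: "('f, 'r) eq_sort \<Rightarrow> nat" where
  "rep_len Home = 1"
| "rep_len (Quot n E) = n"

abbreviation rep_lens :: "('f, 'r) eq_sort list \<Rightarrow> nat" where
  "rep_lens \<Gamma> \<equiv> sum_list (map rep_len \<Gamma>)"

fun class_of :: "(unit, 'f, 'r, 'a) struct \<Rightarrow> ('f, 'r) eq_sort \<Rightarrow> 'a list \<Rightarrow> ('a, 'f, 'r) eq_elem" where
  "class_of C Home u = Real (hd u)"
| "class_of C (Quot n E) u = Imag n E (eq_class C n E u)"

fun classes :: "(unit, 'f, 'r, 'a) struct \<Rightarrow> ('f, 'r) eq_sort list \<Rightarrow> 'a list \<Rightarrow> ('a, 'f, 'r) eq_elem list" where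
  "classes C [] u = []"
| "classes C (s # \<Gamma>) u = class_of C s (take (rep_len s) u) # classes C \<Gamma> (drop (rep_len s) u)"

lemma length_classes [simp]: "length (classes C \<Gamma> u) = length \<Gamma>"
  by (induction \<Gamma> arbitrary: u) auto

lemma classes_append:
  "length u = rep_lens \<Gamma> \<Longrightarrow> classes C (\<Gamma> @ \<Delta>) (u @ v) = classes C \<Gamma> u @ classes C \<Delta> v"
  by (induction \<Gamma> arbitrary: u) auto

lemma nth_classes:
  "i < length \<Gamma> \<Longrightarrow>
    classes C \<Gamma> u ! i = class_of C (\<Gamma> ! i) (take (rep_len (\<Gamma> ! i)) (drop (rep_lens (take i \<Gamma>)) u))"
proof (induction \<Gamma> arbitrary: u i)
  case (Cons s \<Gamma>)
  then show ?case by (cases i) (auto simp: add.commute)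
qed simp

lemma rep_lens_nth: "i < length \<Gamma> \<Longrightarrow> rep_lens (take i \<Gamma>) + rep_len (\<Gamma> ! i) \<le> rep_lens \<Gamma>"
proof (induction \<Gamma> arbitrary: i)
  case (Cons s \<Gamma>)
  then show ?case by (cases i) auto
qed simp

lemma tuples_home_add: "length u = k \<Longrightarrow> u @ v \<in> tuples C (home_ctx (k + l)) \<longleftrightarrow>
    u \<in> tuples C (home_ctx k) \<and> v \<in> tuples C (home_ctx l)"
  by (simp add: replicate_add tuples_append_iff)

lemma tuples_home_split:
  assumes "u \<in> tuples C (home_ctx (k + l))"
  obtains v w where "u = v @ w" and "v \<in> tuples C (home_ctx k)" and "w \<in> tuples C (home_ctx l)"
  using assms unfolding replicate_add by (rule tuples_append_split)

lemma univ_eq_struct: "univ (eq_struct C) s = class_of C s ` tuples C (home_ctx (rep_len s))"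
proof (cases s)
  case Home
  have "class_of C Home ` tuples C (home_ctx 1) = Real ` univ C ()" by (force simp: image_iff)
  then show ?thesis using Home by (simp add: eq_struct_def eq_univ_def)
next
  case (Quot n E)
  have "set a \<subseteq> univ C ()" if "a \<in> tuples C (home_ctx n)" for a
    using that by (auto simp: tuples_def list_all2_conv_all_nth in_set_conv_nth)
  then show ?thesis using Quot by (auto simp: eq_struct_def eq_univ_def)
qed

lemma classes_in_tuples:
  "u \<in> tuples C (home_ctx (rep_lens \<Gamma>)) \<Longrightarrow> classes C \<Gamma> u \<in> tuples (eq_struct C) \<Gamma>"
proof (induction \<Gamma> arbitrary: u)
  case (Cons s \<Gamma>)
  then obtain v w where u: "u = v @ w" "v \<in> tuples C (home_ctx (rep_len s))" "w \<in> tuples C (home_ctx (rep_lens \<Gamma>))"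
    by (auto elim: tuples_home_split)
  then show ?case using Cons.IH[OF u(3)] tuples_length[OF u(2)] by (simp add: univ_eq_struct)
qed simp

lemma classes_surj:
  assumes "e \<in> tuples (eq_struct C) \<Gamma>"
  shows "\<exists>u\<in>tuples C (home_ctx (rep_lens \<Gamma>)). classes C \<Gamma> u = e"
  using assms
proof (induction \<Gamma> arbitrary: e)
  case (Cons s \<Gamma>)
  from Cons.prems obtain x e' where e: "e = x # e'" "x \<in> univ (eq_struct C) s" "e' \<in> tuples (eq_struct C) \<Gamma>"
    by (rule tuples_Cons_split)
  obtain v where v: "v \<in> tuples C (home_ctx (rep_len s))" "x = class_of C s v"
    using e(2) by (auto simp: univ_eq_struct)
  obtain w where w: "w \<in> tuples C (home_ctx (rep_lens \<Gamma>))" "classes C \<Gamma> w = e'" using Cons.IH[OF e(3)] by blast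
  have "v @ w \<in> tuples C (home_ctx (rep_lens (s # \<Gamma>)))"
    using v(1) w(1) tuples_length[OF v(1)] by (simp add: tuples_home_add)
  moreover have "classes C (s # \<Gamma>) (v @ w) = e" using v(2) w(2) e(1) tuples_length[OF v(1)] by simp
  ultimately show ?case by blast
qed simp

locale monster_eq = monster L C
  for L :: "(unit, 'f, 'r) signature" and C :: "(unit, 'f, 'r, 'a) struct" +
  assumes signature: "is_signature L" and is_struct: "is_structure L C"
begin

abbreviation Leq where "Leq \<equiv> eq_sig L C"
abbreviation Ceq where "Ceq \<equiv> eq_struct C"
abbreviation H where "H n \<equiv> tuples C (home_ctx n)"

lemma Leq_simps [simp]:
  "Sorts Leq = insert Home {Quot n E | n E. definable_equiv L C n E}"
  "Funs Leq = Base ` Funs L \<union> {Proj n E | n E. definable_equiv L C n E}"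
  "fun_dom Leq (Base g) = map (\<lambda>_. Home) (fun_dom L g)" "fun_dom Leq (Proj n E) = replicate n Home"
  "fun_cod Leq (Base g) = Home" "fun_cod Leq (Proj n E) = Quot n E"
  "Rels Leq = Rels L" "rel_dom Leq r = map (\<lambda>_. Home) (rel_dom L r)"
  by (simp_all add: eq_sig_def)

lemma Ceq_simps [simp]:
  "fun_int Ceq (Base g) xs = Real (fun_int C g (map the_real xs))"
  "fun_int Ceq (Proj n E) xs = Imag n E (eq_class C n E (map the_real xs))"
  "rel_int Ceq r xs = rel_int C r (map the_real xs)"
  by (simp_all add: eq_struct_def)

lemma sort_determined:
  assumes "x \<in> univ Ceq s" and "x \<in> univ Ceq t"
  shows "s = t"
  using assms by (cases s; cases t) (auto simp: univ_eq_struct)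

sublocale eq: mstruct Leq Ceq
proof
  fix s assume "s \<in> Sorts Leq"
  obtain u where "u \<in> H (rep_len s)" using home.tuples_nonempty[of "home_ctx (rep_len s)"] sorts by auto
  then show "univ Ceq s \<noteq> {}" by (auto simp: univ_eq_struct)
qed (auto dest: sort_determined)

lemma unit_list_all2: "list_all2 P ts (ds :: unit list) \<longleftrightarrow> length ts = length ds \<and> (\<forall>t\<in>set ts. P t ())"
  by (auto simp: list_all2_conv_all_nth all_set_conv_all_nth)

lemma home_terms_list:
  assumes "\<forall>t\<in>set ts. \<exists>t'. has_sort L \<Delta> t' () \<and> (\<forall>u\<in>S. val Ceq (r u) t = Real (val C u t'))"
  obtains ts' where "length ts' = length ts" and "\<And>t'. t' \<in> set ts' \<Longrightarrow> has_sort L \<Delta> t' ()"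
    and "\<And>u. u \<in> S \<Longrightarrow> map the_real (map (val Ceq (r u)) ts) = map (val C u) ts'"
proof -
  from bchoice[OF assms] obtain f where
    f: "\<forall>t\<in>set ts. has_sort L \<Delta> (f t) () \<and> (\<forall>u\<in>S. val Ceq (r u) t = Real (val C u (f t)))" ..
  show thesis by (rule that[of "map f ts"]) (use f in auto)
qed

text \<open>No function accepts arguments of a quotient sort, and projections end in quotient sorts.
  So a home term is built from base functions and home variables, each of which is the only entry of
  its segment.\<close>

lemma translate_home_term:
  assumes "has_sort Leq \<Gamma> t s" and "s = Home"
  shows "\<exists>t'. has_sort L (home_ctx (rep_lens \<Gamma>)) t' () \<and>
    (\<forall>u\<in>H (rep_lens \<Gamma>). val Ceq (classes C \<Gamma> u) t = Real (val C u t'))"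
  using assms
proof (induction rule: has_sort.induct)
  case (Var i)
  let ?o = "rep_lens (take i \<Gamma>)"
  have o: "?o < rep_lens \<Gamma>" using rep_lens_nth[OF Var(1)] Var(2) by simp
  have "val Ceq (classes C \<Gamma> u) (Var i) = Real (val C u (Var ?o))" if "u \<in> H (rep_lens \<Gamma>)" for u
  proof -
    have "length u = rep_lens \<Gamma>" using tuples_length[OF that] by simp
    then have "hd (take 1 (drop ?o u)) = u ! ?o" using o by (simp add: hd_drop_conv_nth take_Suc drop_eq_Nil)
    then show ?thesis using nth_classes[OF Var(1), of C u] Var(2) by simp
  qed
  moreover have "has_sort L (home_ctx (rep_lens \<Gamma>)) (Var ?o) ()"
    using has_sort.Var[of ?o "home_ctx (rep_lens \<Gamma>)" L] o by simp
  ultimately show ?case by blast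
next
  case (App f ts)
  from App(1,3) obtain g where g: "f = Base g" "g \<in> Funs L" by auto
  have "\<forall>t\<in>set ts. \<exists>t'. has_sort L (home_ctx (rep_lens \<Gamma>)) t' () \<and>
      (\<forall>u\<in>H (rep_lens \<Gamma>). val Ceq (classes C \<Gamma> u) t = Real (val C u t'))"
    using App(2) g by (auto simp: list_all2_conv_all_nth in_set_conv_nth)
  then obtain ts' where ts': "length ts' = length ts" "\<And>t'. t' \<in> set ts' \<Longrightarrow> has_sort L (home_ctx (rep_lens \<Gamma>)) t' ()"
    "\<And>u. u \<in> H (rep_lens \<Gamma>) \<Longrightarrow> map the_real (map (val Ceq (classes C \<Gamma> u)) ts) = map (val C u) ts'"
    by (rule home_terms_list) blast
  have "length ts = length (fun_dom L g)" using App(2) g by (simp add: list_all2_lengthD)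
  then have "list_all2 (has_sort L (home_ctx (rep_lens \<Gamma>))) ts' (fun_dom L g)"
    using ts'(1,2) by (simp add: unit_list_all2)
  from has_sort.App[OF g(2) this] have "has_sort L (home_ctx (rep_lens \<Gamma>)) (App g ts') ()" by simp
  moreover have "val Ceq (classes C \<Gamma> u) (App f ts) = Real (val C u (App g ts'))" if "u \<in> H (rep_lens \<Gamma>)" for u
    using ts'(3)[OF that] g by (simp del: map_map)
  ultimately show ?case by blast
qed

text \<open>For want of functions on quotient sorts, such a term is a variable or one projection
  applied to home terms; in both cases its value is the class of a tuple of home terms.\<close>

lemma translate_quot_term:
  assumes "has_sort Leq \<Gamma> t (Quot n E)"
  shows "\<exists>ts. length ts = n \<and> (\<forall>t'\<in>set ts. has_sort L (home_ctx (rep_lens \<Gamma>)) t' ()) \<and>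
    (\<forall>u\<in>H (rep_lens \<Gamma>). val Ceq (classes C \<Gamma> u) t = Imag n E (eq_class C n E (map (val C u) ts)))"
  using assms
proof cases
  case (Var i)
  let ?o = "rep_lens (take i \<Gamma>)"
  have o: "?o + n \<le> rep_lens \<Gamma>" using rep_lens_nth[OF Var(3)] Var(2)[symmetric] by simp
  have "val Ceq (classes C \<Gamma> u) t = Imag n E (eq_class C n E (map (val C u) (map Var [?o..<?o + n])))"
    if "u \<in> H (rep_lens \<Gamma>)" for u
  proof -
    have "length u = rep_lens \<Gamma>" using tuples_length[OF that] by simp
    then have "take n (drop ?o u) = map (val C u) (map Var [?o..<?o + n])"
      using o by (intro nth_equalityI) auto
    then show ?thesis using nth_classes[OF Var(3), of C u] Var(1) Var(2)[symmetric] by simp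
  qed
  moreover have "has_sort L (home_ctx (rep_lens \<Gamma>)) (Var j) ()" if "j < ?o + n" for j
    using has_sort.Var[of j "home_ctx (rep_lens \<Gamma>)" L] o that by simp
  ultimately show ?thesis by (intro exI[of _ "map Var [?o..<?o + n]"]) auto
next
  case (App f ts)
  from App(2,3) have f: "f = Proj n E" by auto
  have "\<forall>t\<in>set ts. has_sort Leq \<Gamma> t Home" using App(4) f by (auto simp: list_all2_conv_all_nth in_set_conv_nth)
  then have "\<forall>t\<in>set ts. \<exists>t'. has_sort L (home_ctx (rep_lens \<Gamma>)) t' () \<and>
      (\<forall>u\<in>H (rep_lens \<Gamma>). val Ceq (classes C \<Gamma> u) t = Real (val C u t'))"
    using translate_home_term by blast
  then obtain ts' where ts': "length ts' = length ts" "\<And>t'. t' \<in> set ts' \<Longrightarrow> has_sort L (home_ctx (rep_lens \<Gamma>)) t' ()"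
    "\<And>u. u \<in> H (rep_lens \<Gamma>) \<Longrightarrow> map the_real (map (val Ceq (classes C \<Gamma> u)) ts) = map (val C u) ts'"
    by (rule home_terms_list) blast
  have "length ts = n" using App(4) f by (simp add: list_all2_lengthD)
  moreover have "val Ceq (classes C \<Gamma> u) t = Imag n E (eq_class C n E (map (val C u) ts'))"
    if "u \<in> H (rep_lens \<Gamma>)" for u
    using ts'(3)[OF that] App(1) f by (simp del: map_map)
  ultimately show ?thesis using ts'(1,2) by (intro exI[of _ ts']) auto
qed

lemma val_in_univ: "has_sort L \<Delta> t s \<Longrightarrow> u \<in> tuples C \<Delta> \<Longrightarrow> val C u t \<in> univ C ()"
proof (induction rule: has_sort.induct)
  case (Var i)
  then show ?case by (auto simp: tuples_def list_all2_conv_all_nth)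
next
  case (App f ts)
  then have "map (val C u) ts \<in> tuples C (fun_dom L f)"
    by (auto simp: tuples_def list_all2_conv_all_nth)
  then show ?case using is_struct App(1) unfolding is_structure_def by simp
qed

lemma eq_class_eq_iff:
  assumes "definable_equiv L C n E" and "a \<in> H n" and "b \<in> H n"
  shows "eq_class C n E a = eq_class C n E b \<longleftrightarrow> sat C (a @ b) E"
proof -
  let ?R = "{(a, b). a \<in> H n \<and> b \<in> H n \<and> sat C (a @ b) E}"
  have eqv: "equiv (H n) ?R" using assms(1) by (simp add: definable_equiv_def)
  have cl: "eq_class C n E c = ?R `` {c}" if "c \<in> H n" for c using that by (auto simp: eq_class_def)
  show ?thesis using eq_equiv_class_iff[OF eqv assms(2,3)] cl assms(2,3) by simp
qed

text \<open>A variable of a quotient sort becomes a block of home variables for a representative.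
  Every imaginary has a representative and only classes are evaluated, so quantifiers correspond;
  equality in \<open>Quot n E\<close> becomes \<open>E\<close> itself.\<close>

lemma translate_fm:
  assumes "set \<Gamma> \<subseteq> Sorts Leq" and "wff Leq \<Gamma> \<phi>"
  shows "\<exists>\<phi>'. wff L (home_ctx (rep_lens \<Gamma>)) \<phi>' \<and>
    (\<forall>u\<in>H (rep_lens \<Gamma>). sat C u \<phi>' \<longleftrightarrow> sat Ceq (classes C \<Gamma> u) \<phi>)"
  using assms
proof (induction \<phi> arbitrary: \<Gamma>)
  case (Eql t1 t2)
  then obtain s where s: "s \<in> Sorts Leq" "has_sort Leq \<Gamma> t1 s" "has_sort Leq \<Gamma> t2 s" by auto
  show ?case
  proof (cases s)
    case Home
    obtain t1' t2' where "has_sort L (home_ctx (rep_lens \<Gamma>)) t1' ()" "has_sort L (home_ctx (rep_lens \<Gamma>)) t2' ()"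
      "\<forall>u\<in>H (rep_lens \<Gamma>). val Ceq (classes C \<Gamma> u) t1 = Real (val C u t1')"
      "\<forall>u\<in>H (rep_lens \<Gamma>). val Ceq (classes C \<Gamma> u) t2 = Real (val C u t2')"
      using translate_home_term[OF s(2) Home] translate_home_term[OF s(3) Home] by blast
    then show ?thesis by (intro exI[of _ "Eql t1' t2'"]) (auto simp: sorts)
  next
    case (Quot n E)
    then have E: "definable_equiv L C n E" using s(1) by auto
    let ?k = "rep_lens \<Gamma>"
    obtain ts1 where ts1: "length ts1 = n" "\<forall>t'\<in>set ts1. has_sort L (home_ctx ?k) t' ()"
      "\<forall>u\<in>H ?k. val Ceq (classes C \<Gamma> u) t1 = Imag n E (eq_class C n E (map (val C u) ts1))"
      using translate_quot_term[of \<Gamma> t1 n E] s(2) Quot by blast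
    obtain ts2 where ts2: "length ts2 = n" "\<forall>t'\<in>set ts2. has_sort L (home_ctx ?k) t' ()"
      "\<forall>u\<in>H ?k. val Ceq (classes C \<Gamma> u) t2 = Imag n E (eq_class C n E (map (val C u) ts2))"
      using translate_quot_term[of \<Gamma> t2 n E] s(3) Quot by blast
    let ?ts = "ts1 @ ts2"
    \<comment> \<open>Only renaming of variables is available, not substitution of terms. So
      \<open>E\<close> is applied to a quantified tuple \<open>z\<close>, and these equations force
      \<open>z\<close> to be the values of the terms.\<close>
    define at where "at = (\<lambda>i. Eql (Var i) (ren_tm (\<lambda>j. n + n + j) (?ts ! i)) :: (unit, 'f, 'r) fm)"
    have has: "has_sort L (home_ctx ?k) (?ts ! i) ()" if "i < n + n" for i
      using ts1(1,2) ts2(1,2) that nth_mem[of i ?ts] by auto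
    have wff_at: "wff L (home_ctx (n + n) @ home_ctx ?k) (at i)" if "i < n + n" for i
    proof -
      have "has_sort L (home_ctx (n + n) @ home_ctx ?k) (ren_tm (\<lambda>j. n + n + j) (?ts ! i)) ()"
        by (rule has_sort_ren[OF has[OF that]]) (auto simp: nth_append)
      moreover have "has_sort L (home_ctx (n + n) @ home_ctx ?k) (Var i) ()"
        using has_sort.Var[of i "home_ctx (n + n) @ home_ctx ?k" L] that by simp
      ultimately show ?thesis by (auto simp: at_def sorts)
    qed
    have sat_at: "sat C (z @ u) (at i) \<longleftrightarrow> z ! i = val C u (?ts ! i)"
      if "z \<in> H (n + n)" "u \<in> H ?k" "i < n + n" for z u i
    proof -
      have len: "length z = n + n" using tuples_length[OF that(1)] by simp
      have "val C (z @ u) (ren_tm (\<lambda>j. n + n + j) (?ts ! i)) = val C u (?ts ! i)"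
        by (rule val_ren[OF has[OF that(3)]]) (simp add: nth_append len)
      then show ?thesis using len that(3) by (simp add: at_def nth_append)
    qed
    have "home.defn (blk [home_ctx ?k]) (\<lambda>g. \<exists>z\<in>H (n + n). sat C z E \<and> (\<forall>i\<in>{..<n + n}. sat C (z @ g 0) (at i)))"
      by (rule home.defn_ex[where i = 1], intro home.defn_conj home.defn_ball home.defn_sat1 home.defn_sat2)
        (use E wff_at in \<open>simp_all add: definable_equiv_def replicate_add sorts\<close>)
    then obtain \<chi> where \<chi>: "wff L (home_ctx ?k) \<chi>" "\<And>u. u \<in> H ?k \<Longrightarrow> sat C u \<chi> \<longleftrightarrow>
        (\<exists>z\<in>H (n + n). sat C z E \<and> (\<forall>i\<in>{..<n + n}. sat C (z @ u) (at i)))"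
      by (rule home.defn_fm1) (simp only: blk_Cons)
    have "sat C u \<chi> \<longleftrightarrow> sat Ceq (classes C \<Gamma> u) (Eql t1 t2)" if u: "u \<in> H ?k" for u
    proof -
      let ?a = "map (val C u) ts1" and ?b = "map (val C u) ts2"
      have "val C u t \<in> univ C ()" if "t \<in> set ?ts" for t
        using val_in_univ[OF _ u] ts1(2) ts2(2) that by auto
      then have ab: "?a \<in> H n" "?b \<in> H n" "?a @ ?b \<in> H (n + n)"
        using tuples_home[of ?a] tuples_home[of ?b] tuples_home[of "?a @ ?b"] ts1(1) ts2(1) by auto
      have nth: "(?a @ ?b) ! i = val C u (?ts ! i)" if "i < n + n" for i
        using that ts1(1) ts2(1) nth_map[of i ?ts "val C u"] by simp
      have "(\<forall>i\<in>{..<n + n}. sat C (z @ u) (at i)) \<longleftrightarrow> z = ?a @ ?b" if z: "z \<in> H (n + n)" for z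
      proof
        assume *: "\<forall>i\<in>{..<n + n}. sat C (z @ u) (at i)"
        show "z = ?a @ ?b"
          by (rule nth_equalityI) (use * sat_at[OF z u] nth tuples_length[OF z] ts1(1) ts2(1) in auto)
      qed (use sat_at[OF z u] nth in auto)
      then have "sat C u \<chi> \<longleftrightarrow> sat C (?a @ ?b) E" using \<chi>(2)[OF u] ab(3) by blast
      also have "\<dots> \<longleftrightarrow> sat Ceq (classes C \<Gamma> u) (Eql t1 t2)"
        using eq_class_eq_iff[OF E ab(1,2)] ts1(3) ts2(3) u by simp
      finally show ?thesis .
    qed
    then show ?thesis using \<chi>(1) by blast
  qed
next
  case (Pred r ts)
  have "\<forall>t\<in>set ts. has_sort Leq \<Gamma> t Home"
    using Pred.prems(2) by (auto simp: list_all2_conv_all_nth in_set_conv_nth)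
  then have "\<forall>t\<in>set ts. \<exists>t'. has_sort L (home_ctx (rep_lens \<Gamma>)) t' () \<and>
      (\<forall>u\<in>H (rep_lens \<Gamma>). val Ceq (classes C \<Gamma> u) t = Real (val C u t'))"
    using translate_home_term by blast
  then obtain ts' where ts': "length ts' = length ts" "\<And>t'. t' \<in> set ts' \<Longrightarrow> has_sort L (home_ctx (rep_lens \<Gamma>)) t' ()"
    "\<And>u. u \<in> H (rep_lens \<Gamma>) \<Longrightarrow> map the_real (map (val Ceq (classes C \<Gamma> u)) ts) = map (val C u) ts'"
    by (rule home_terms_list) blast
  have "length ts = length (rel_dom L r)" "r \<in> Rels L" using Pred.prems(2) by (auto dest: list_all2_lengthD)
  then have "wff L (home_ctx (rep_lens \<Gamma>)) (Pred r ts')" using ts'(1,2) by (simp add: unit_list_all2)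
  moreover have "sat C u (Pred r ts') \<longleftrightarrow> sat Ceq (classes C \<Gamma> u) (Pred r ts)" if "u \<in> H (rep_lens \<Gamma>)" for u
    using ts'(3)[OF that] by (simp del: map_map)
  ultimately show ?case by blast
next
  case (Neg \<phi>)
  then obtain \<phi>' where "wff L (home_ctx (rep_lens \<Gamma>)) \<phi>'"
    "\<forall>u\<in>H (rep_lens \<Gamma>). sat C u \<phi>' \<longleftrightarrow> sat Ceq (classes C \<Gamma> u) \<phi>" by fastforce
  then show ?case by (intro exI[of _ "Neg \<phi>'"]) simp
next
  case (And \<phi> \<psi>)
  obtain \<phi>' where "wff L (home_ctx (rep_lens \<Gamma>)) \<phi>'"
    "\<forall>u\<in>H (rep_lens \<Gamma>). sat C u \<phi>' \<longleftrightarrow> sat Ceq (classes C \<Gamma> u) \<phi>"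
    using And.IH(1)[OF And.prems(1)] And.prems(2) by auto
  moreover obtain \<psi>' where "wff L (home_ctx (rep_lens \<Gamma>)) \<psi>'"
    "\<forall>u\<in>H (rep_lens \<Gamma>). sat C u \<psi>' \<longleftrightarrow> sat Ceq (classes C \<Gamma> u) \<psi>"
    using And.IH(2)[OF And.prems(1)] And.prems(2) by auto
  ultimately show ?case by (intro exI[of _ "And \<phi>' \<psi>'"]) simp
next
  case (Exists s \<phi>)
  have "set (s # \<Gamma>) \<subseteq> Sorts Leq" "wff Leq (s # \<Gamma>) \<phi>" using Exists.prems by simp_all
  from Exists.IH[OF this] obtain \<phi>' where \<phi>': "wff L (home_ctx (rep_lens (s # \<Gamma>))) \<phi>'"
    "\<forall>u\<in>H (rep_lens (s # \<Gamma>)). sat C u \<phi>' \<longleftrightarrow> sat Ceq (classes C (s # \<Gamma>) u) \<phi>" by blast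
  let ?S = "home_ctx (rep_len s)"
  have "wff L (home_ctx (rep_lens \<Gamma>)) (exs ?S \<phi>')"
    by (rule wff_exs) (use \<phi>'(1) in \<open>simp_all add: replicate_add sorts\<close>)
  moreover have "sat C u (exs ?S \<phi>') \<longleftrightarrow> sat Ceq (classes C \<Gamma> u) (Exists s \<phi>)" if u: "u \<in> H (rep_lens \<Gamma>)" for u
  proof -
    have "sat C (a @ u) \<phi>' \<longleftrightarrow> sat Ceq (class_of C s a # classes C \<Gamma> u) \<phi>" if a: "a \<in> H (rep_len s)" for a
    proof -
      have "a @ u \<in> H (rep_lens (s # \<Gamma>))" using a u tuples_length[OF a] by (simp add: tuples_home_add)
      then show ?thesis using \<phi>'(2) tuples_length[OF a] by simp
    qed
    then show ?thesis by (simp add: sat_exs univ_eq_struct)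
  qed
  ultimately show ?case by blast
qed

end


section \<open>The expansion by imaginaries\<close>

primrec lift_fm :: "(unit, 'f, 'r) fm \<Rightarrow> (('f, 'r) eq_sort, ('f, 'r) eq_fun, 'r) fm" where
  "lift_fm (Eql t u) = Eql (map_tm Base t) (map_tm Base u)"
| "lift_fm (Pred r ts) = Pred r (map (map_tm Base) ts)"
| "lift_fm (Neg \<phi>) = Neg (lift_fm \<phi>)"
| "lift_fm (And \<phi> \<psi>) = And (lift_fm \<phi>) (lift_fm \<psi>)"
| "lift_fm (Exists s \<phi>) = Exists Home (lift_fm \<phi>)"

context monster_eq
begin

lemma lift_tm_sort: "has_sort L \<Delta> t s \<Longrightarrow> has_sort Leq (map (\<lambda>_. Home) \<Delta>) (map_tm Base t) Home"
proof (induction rule: has_sort.induct)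
  case (Var i)
  then show ?case using has_sort.Var[of i "map (\<lambda>_. Home) \<Delta>" Leq] by simp
next
  case (App f ts)
  have "list_all2 (has_sort Leq (map (\<lambda>_. Home) \<Delta>)) (map (map_tm Base) ts) (fun_dom Leq (Base f))"
    using App(2) by (simp add: list_all2_conv_all_nth)
  then show ?case using has_sort.App[of "Base f" Leq] App(1) by simp
qed

lemma lift_tm_val:
  "has_sort L \<Delta> t s \<Longrightarrow> length u = length \<Delta> \<Longrightarrow> val Ceq (map Real u) (map_tm Base t) = Real (val C u t)"
proof (induction rule: has_sort.induct)
  case (App f ts)
  then have "map the_real (map (val Ceq (map Real u)) (map (map_tm Base) ts)) = map (val C u) ts"
    by (auto simp: list_all2_conv_all_nth in_set_conv_nth)
  then show ?case by (simp del: map_map)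
qed simp

lemma lift_fm_wff: "wff L \<Delta> \<phi> \<Longrightarrow> wff Leq (map (\<lambda>_. Home) \<Delta>) (lift_fm \<phi>)"
proof (induction \<phi> arbitrary: \<Delta>)
  case (Eql t u)
  then show ?case using lift_tm_sort by fastforce
next
  case (Pred r ts)
  then show ?case using lift_tm_sort by (auto simp: list_all2_conv_all_nth)
next
  case (Exists s \<phi>)
  then show ?case using Exists.IH[of "s # \<Delta>"] by simp
qed auto

lemma lift_fm_sat:
  "wff L \<Delta> \<phi> \<Longrightarrow> length u = length \<Delta> \<Longrightarrow> sat Ceq (map Real u) (lift_fm \<phi>) \<longleftrightarrow> sat C u \<phi>"
proof (induction \<phi> arbitrary: \<Delta> u)
  case (Eql t1 t2)
  then show ?case by (auto simp: lift_tm_val)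
next
  case (Pred r ts)
  then have "map the_real (map (val Ceq (map Real u)) (map (map_tm Base) ts)) = map (val C u) ts"
    using lift_tm_val[of \<Delta> _ _ u] by (auto simp: list_all2_conv_all_nth in_set_conv_nth)
  then show ?case by (simp del: map_map)
next
  case (Neg \<phi>)
  then show ?case using Neg.IH[of \<Delta> u] by simp
next
  case (And \<phi> \<psi>)
  then show ?case using And.IH(1)[of \<Delta> u] And.IH(2)[of \<Delta> u] by simp
next
  case (Exists s \<phi>)
  have "sat Ceq (map Real (a # u)) (lift_fm \<phi>) \<longleftrightarrow> sat C (a # u) \<phi>" for a
    by (rule Exists.IH[of "s # \<Delta>"]) (use Exists.prems in simp_all)
  then show ?case by (simp add: eq_struct_def eq_univ_def)
qed

definition rep_tm :: "('f, 'r) eq_sort \<Rightarrow> nat \<Rightarrow> (('f, 'r) eq_fun) tm" where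
  "rep_tm s i = (case s of Home \<Rightarrow> Var i | Quot n E \<Rightarrow> App (Proj n E) (map Var [i..<i + n]))"

lemma rep_tm_sort:
  assumes "s \<in> Sorts Leq" and "\<And>j. i \<le> j \<Longrightarrow> j < i + rep_len s \<Longrightarrow> j < length \<Delta> \<and> \<Delta> ! j = Home"
  shows "has_sort Leq \<Delta> (rep_tm s i) s"
proof (cases s)
  case Home
  then show ?thesis using has_sort.Var[of i \<Delta> Leq] assms(2)[of i] by (simp add: rep_tm_def)
next
  case (Quot n E)
  have "has_sort Leq \<Delta> (Var j) Home" if "i \<le> j" "j < i + n" for j
    using has_sort.Var[of j \<Delta> Leq] assms(2)[of j] that Quot by simp
  then have "list_all2 (has_sort Leq \<Delta>) (map Var [i..<i + n]) (fun_dom Leq (Proj n E))"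
    by (simp add: list_all2_conv_all_nth)
  then show ?thesis using has_sort.App[of "Proj n E" Leq \<Delta>] assms(1) Quot by (auto simp: rep_tm_def)
qed

lemma rep_tm_val:
  assumes "\<And>j. j < rep_len s \<Longrightarrow> z ! (i + j) = Real (v ! j)" and "length v = rep_len s"
  shows "val Ceq z (rep_tm s i) = class_of C s v"
proof (cases s)
  case Home
  then show ?thesis using assms(1)[of 0] assms(2) by (cases v) (simp_all add: rep_tm_def)
next
  case (Quot n E)
  have "map the_real (map (val Ceq z) (map Var [i..<i + n])) = v"
    using assms Quot by (intro nth_equalityI) auto
  then show ?thesis using Quot by (simp add: rep_tm_def del: map_map)
qed

lemma tuples_Home: "w \<in> tuples Ceq (replicate k Home) \<longleftrightarrow> w \<in> map Real ` H k"
proof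
  assume w: "w \<in> tuples Ceq (replicate k Home)"
  then have "\<forall>i<k. w ! i \<in> Real ` univ C ()" and len: "length w = k"
    by (auto simp: tuples_def list_all2_conv_all_nth eq_struct_def eq_univ_def)
  then have "\<forall>i<k. the_real (w ! i) \<in> univ C () \<and> w ! i = Real (the_real (w ! i))" by auto
  then have "map the_real w \<in> H k" "w = map Real (map the_real w)"
    using len by (auto simp: tuples_def list_all2_conv_all_nth intro: nth_equalityI)
  then show "w \<in> map Real ` H k" by blast
next
  assume "w \<in> map Real ` H k"
  then show "w \<in> tuples Ceq (replicate k Home)"
    by (auto simp: tuples_def list_all2_conv_all_nth eq_struct_def eq_univ_def)
qed

text \<open>With \<open>\<Gamma> = Ys @ [Quot n E]\<close> this yields the formula that identifies a coded set by its code.\<close>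

lemma image_definable:
  assumes \<Gamma>: "set \<Gamma> \<subseteq> Sorts Leq" and \<delta>: "wff L (home_ctx (rep_lens \<Gamma>)) \<delta>"
  obtains \<rho> where "wff Leq \<Gamma> \<rho>"
    and "\<And>e. e \<in> tuples Ceq \<Gamma> \<Longrightarrow> sat Ceq e \<rho> \<longleftrightarrow> (\<exists>u\<in>H (rep_lens \<Gamma>). e = classes C \<Gamma> u \<and> sat C u \<delta>)"
proof -
  let ?k = "rep_lens \<Gamma>" and ?n = "length \<Gamma>"
  let ?K = "replicate ?k Home"
  \<comment> \<open>The home block follows the \<open>?n\<close> entries of \<open>\<Gamma>\<close>,
    hence the offset in front of the segment of entry \<open>i\<close>.\<close>
  define at where "at = (\<lambda>i. Eql (Var i) (rep_tm (\<Gamma> ! i) (?n + rep_lens (take i \<Gamma>))) ::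
    (('f, 'r) eq_sort, ('f, 'r) eq_fun, 'r) fm)"
  have wff_at: "wff Leq (\<Gamma> @ ?K) (at i)" if i: "i < ?n" for i
  proof -
    have s: "\<Gamma> ! i \<in> Sorts Leq" using \<Gamma> i nth_mem by blast
    have "has_sort Leq (\<Gamma> @ ?K) (rep_tm (\<Gamma> ! i) (?n + rep_lens (take i \<Gamma>))) (\<Gamma> ! i)"
      by (rule rep_tm_sort[OF s]) (use rep_lens_nth[OF i] in \<open>auto simp: nth_append\<close>)
    moreover have "has_sort Leq (\<Gamma> @ ?K) (Var i) (\<Gamma> ! i)"
      using has_sort.Var[of i "\<Gamma> @ ?K" Leq] i by (simp add: nth_append)
    ultimately show ?thesis using s unfolding at_def wff.simps by blast
  qed
  have sat_at: "sat Ceq (e @ map Real u) (at i) \<longleftrightarrow> e ! i = classes C \<Gamma> u ! i"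
    if e: "e \<in> tuples Ceq \<Gamma>" and u: "u \<in> H ?k" and i: "i < ?n" for e u i
  proof -
    have len: "length e = ?n" "length u = ?k" using tuples_length[OF e] tuples_length[OF u] by simp_all
    have "val Ceq (e @ map Real u) (rep_tm (\<Gamma> ! i) (?n + rep_lens (take i \<Gamma>))) =
        class_of C (\<Gamma> ! i) (take (rep_len (\<Gamma> ! i)) (drop (rep_lens (take i \<Gamma>)) u))"
      by (rule rep_tm_val) (use rep_lens_nth[OF i] len in \<open>auto simp: nth_append\<close>)
    then show ?thesis using nth_classes[OF i, of C u] i len by (simp add: at_def nth_append)
  qed
  have \<delta>': "wff Leq ?K (lift_fm \<delta>)" using lift_fm_wff[OF \<delta>] by (simp add: map_replicate_const)
  have setK: "set ?K \<subseteq> Sorts Leq" by (auto simp: in_set_replicate)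
  have "eq.defn (blk [\<Gamma>]) (\<lambda>g. \<exists>w\<in>tuples Ceq ?K. sat Ceq w (lift_fm \<delta>) \<and> (\<forall>i\<in>{..<?n}. sat Ceq (g 0 @ w) (at i)))"
    by (rule eq.defn_ex[where i = 1], intro eq.defn_conj eq.defn_ball eq.defn_sat1 eq.defn_sat2)
      (use wff_at \<delta>' setK in simp_all)
  then obtain \<rho> where \<rho>: "wff Leq \<Gamma> \<rho>" "\<And>e. e \<in> tuples Ceq \<Gamma> \<Longrightarrow> sat Ceq e \<rho> \<longleftrightarrow>
      (\<exists>w\<in>tuples Ceq ?K. sat Ceq w (lift_fm \<delta>) \<and> (\<forall>i\<in>{..<?n}. sat Ceq (e @ w) (at i)))"
    by (rule eq.defn_fm1) (simp only: blk_Cons)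
  show thesis
  proof (rule that[OF \<rho>(1)])
    fix e assume e: "e \<in> tuples Ceq \<Gamma>"
    have "tuples Ceq ?K = map Real ` H ?k" by (intro set_eqI) (rule tuples_Home)
    then have 0: "sat Ceq e \<rho> \<longleftrightarrow> (\<exists>u\<in>H ?k. sat Ceq (map Real u) (lift_fm \<delta>) \<and>
        (\<forall>i\<in>{..<?n}. sat Ceq (e @ map Real u) (at i)))" unfolding \<rho>(2)[OF e] by simp
    show "sat Ceq e \<rho> \<longleftrightarrow> (\<exists>u\<in>H ?k. e = classes C \<Gamma> u \<and> sat C u \<delta>)"
      unfolding 0
    proof (rule bex_cong[OF refl])
      fix u assume u: "u \<in> H ?k"
      have 1: "sat Ceq (map Real u) (lift_fm \<delta>) \<longleftrightarrow> sat C u \<delta>"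
        by (rule lift_fm_sat[OF \<delta>]) (rule tuples_length[OF u])
      have "(\<forall>i\<in>{..<?n}. sat Ceq (e @ map Real u) (at i)) \<longleftrightarrow> (\<forall>i<?n. e ! i = classes C \<Gamma> u ! i)"
        using sat_at[OF e u] by (simp add: Ball_def)
      also have "\<dots> \<longleftrightarrow> e = classes C \<Gamma> u" using tuples_length[OF e] by (simp add: list_eq_iff_nth_eq)
      finally show "sat Ceq (map Real u) (lift_fm \<delta>) \<and> (\<forall>i\<in>{..<?n}. sat Ceq (e @ map Real u) (at i)) \<longleftrightarrow>
          e = classes C \<Gamma> u \<and> sat C u \<delta>" using 1 by (simp only: conj_commute)
    qed
  qed
qed

text \<open>Call two tuples of representatives equivalent if they define the same set; this relation
  is definable, and the class of the given parameters is the code. Membership in the coded set does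
  not depend on the representative, and distinct classes define distinct sets.\<close>

lemma code_exists:
  assumes Ys: "set Ys \<subseteq> Sorts Leq" and Zs: "set Zs \<subseteq> Sorts Leq" and \<phi>: "wff Leq (Ys @ Zs) \<phi>"
    and m: "m \<in> tuples Ceq Zs"
  shows "\<exists>s\<in>Sorts Leq. \<exists>e\<in>univ Ceq s. \<exists>\<rho>. wff Leq (Ys @ [s]) \<rho> \<and>
        (\<forall>y\<in>tuples Ceq Ys. sat Ceq (y @ [e]) \<rho> \<longleftrightarrow> sat Ceq (y @ m) \<phi>) \<and>
        (\<forall>e1\<in>univ Ceq s. \<forall>e2\<in>univ Ceq s.
          (\<forall>y\<in>tuples Ceq Ys. sat Ceq (y @ [e1]) \<rho> \<longleftrightarrow> sat Ceq (y @ [e2]) \<rho>) \<longrightarrow> e1 = e2)"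
proof -
  let ?k = "rep_lens Ys" and ?n = "rep_lens Zs"
  have "set (Ys @ Zs) \<subseteq> Sorts Leq" using Ys Zs by simp
  from translate_fm[OF this \<phi>] obtain \<phi>' where \<phi>': "wff L (home_ctx (?k + ?n)) \<phi>'"
    "\<forall>u\<in>H (?k + ?n). sat C u \<phi>' \<longleftrightarrow> sat Ceq (classes C (Ys @ Zs) u) \<phi>" by auto
  have sat\<phi>': "sat C (u @ v) \<phi>' \<longleftrightarrow> sat Ceq (classes C Ys u @ classes C Zs v) \<phi>"
    if "u \<in> H ?k" "v \<in> H ?n" for u v
  proof -
    have len: "length u = ?k" using tuples_length[OF that(1)] by simp
    then have "u @ v \<in> H (?k + ?n)" using that by (simp add: tuples_home_add)
    then show ?thesis using \<phi>'(2) classes_append[OF len, of C Zs v] by simp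
  qed
  have "home.defn (blk [home_ctx ?n, home_ctx ?n]) (\<lambda>g. \<forall>u\<in>H ?k. sat C (u @ g 0) \<phi>' \<longleftrightarrow> sat C (u @ g 1) \<phi>')"
    by (rule home.defn_all[where i = 2], intro home.defn_iff home.defn_sat2)
      (use \<phi>'(1) in \<open>simp_all add: replicate_add sorts\<close>)
  then obtain E where E: "wff L (home_ctx ?n @ home_ctx ?n) E"
    "\<And>v w. v \<in> H ?n \<Longrightarrow> w \<in> H ?n \<Longrightarrow> sat C (v @ w) E \<longleftrightarrow> (\<forall>u\<in>H ?k. sat C (u @ v) \<phi>' \<longleftrightarrow> sat C (u @ w) \<phi>')"
    by (rule home.defn_fm2) (simp only: blk_Cons blk_1)
  have "equiv (H ?n) {(a, b). a \<in> H ?n \<and> b \<in> H ?n \<and> sat C (a @ b) E}"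
    by (rule equivI) (auto simp: refl_on_def sym_def trans_def E(2))
  then have dE: "definable_equiv L C ?n E" using E(1) by (simp add: definable_equiv_def)
  let ?s = "Quot ?n E"
  have s: "?s \<in> Sorts Leq" using dE by simp
  have lens: "rep_lens (Ys @ [?s]) = ?k + ?n" by simp
  have "set (Ys @ [?s]) \<subseteq> Sorts Leq" using Ys s by simp
  moreover have "wff L (home_ctx (rep_lens (Ys @ [?s]))) \<phi>'" using \<phi>'(1) lens by simp
  ultimately obtain \<rho> where \<rho>: "wff Leq (Ys @ [?s]) \<rho>" "\<And>e. e \<in> tuples Ceq (Ys @ [?s]) \<Longrightarrow>
      sat Ceq e \<rho> \<longleftrightarrow> (\<exists>u\<in>H (rep_lens (Ys @ [?s])). e = classes C (Ys @ [?s]) u \<and> sat C u \<phi>')"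
    by (rule image_definable) blast
  have key: "sat Ceq (y @ [class_of C ?s v]) \<rho> \<longleftrightarrow> sat Ceq (y @ classes C Zs v) \<phi>"
    if y: "y \<in> tuples Ceq Ys" and v: "v \<in> H ?n" for y v
  proof -
    have sv: "class_of C ?s v \<in> univ Ceq ?s" using v by (auto simp: univ_eq_struct)
    then have "y @ [class_of C ?s v] \<in> tuples Ceq (Ys @ [?s])" using y by (intro tuples_appendI) auto
    from \<rho>(2)[OF this] have iff: "sat Ceq (y @ [class_of C ?s v]) \<rho> \<longleftrightarrow>
      (\<exists>u\<in>H (?k + ?n). y @ [class_of C ?s v] = classes C (Ys @ [?s]) u \<and> sat C u \<phi>')" unfolding lens .
    show ?thesis
    proof
      assume "sat Ceq (y @ [class_of C ?s v]) \<rho>"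
      then obtain u where u: "u \<in> H (?k + ?n)" "y @ [class_of C ?s v] = classes C (Ys @ [?s]) u" "sat C u \<phi>'"
        using iff by blast
      obtain u1 w where uw: "u = u1 @ w" "u1 \<in> H ?k" "w \<in> H ?n" using u(1) by (rule tuples_home_split)
      have "length u1 = ?k" "length w = ?n" using tuples_length[OF uw(2)] tuples_length[OF uw(3)] by simp_all
      then have "y = classes C Ys u1" "eq_class C ?n E v = eq_class C ?n E w"
        using u(2) classes_append[of u1 Ys C "[?s]" w] uw(1) by simp_all
      then have "sat C (v @ w) E" using eq_class_eq_iff[OF dE v uw(3)] by simp
      then have "sat C (u1 @ v) \<phi>'" using E(2)[OF v uw(3)] u(3) uw(1,2) by simp
      then show "sat Ceq (y @ classes C Zs v) \<phi>" using sat\<phi>'[OF uw(2) v] \<open>y = classes C Ys u1\<close> by simp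
    next
      assume *: "sat Ceq (y @ classes C Zs v) \<phi>"
      obtain u where u: "u \<in> H ?k" "classes C Ys u = y" using classes_surj[OF y] by blast
      have len: "length u = ?k" "length v = ?n" using tuples_length[OF u(1)] tuples_length[OF v] by simp_all
      have "u @ v \<in> H (?k + ?n)" using u(1) v len by (simp add: tuples_home_add)
      moreover have "y @ [class_of C ?s v] = classes C (Ys @ [?s]) (u @ v)"
        using classes_append[OF len(1), of C "[?s]" v] u(2) len by simp
      moreover have "sat C (u @ v) \<phi>'" using sat\<phi>'[OF u(1) v] u(2) * by simp
      ultimately show "sat Ceq (y @ [class_of C ?s v]) \<rho>" using iff by blast
    qed
  qed
  obtain m' where m': "m' \<in> H ?n" "classes C Zs m' = m" using classes_surj[OF m] by blast
  have "e1 = e2" if e12: "e1 \<in> univ Ceq ?s" "e2 \<in> univ Ceq ?s"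
    and eq: "\<forall>y\<in>tuples Ceq Ys. sat Ceq (y @ [e1]) \<rho> \<longleftrightarrow> sat Ceq (y @ [e2]) \<rho>" for e1 e2
  proof -
    obtain v where v: "v \<in> H ?n" "e1 = class_of C ?s v" using e12(1) by (auto simp: univ_eq_struct)
    obtain w where w: "w \<in> H ?n" "e2 = class_of C ?s w" using e12(2) by (auto simp: univ_eq_struct)
    have "sat C (u @ v) \<phi>' \<longleftrightarrow> sat C (u @ w) \<phi>'" if u: "u \<in> H ?k" for u
    proof -
      have y: "classes C Ys u \<in> tuples Ceq Ys" by (rule classes_in_tuples[OF u])
      show ?thesis using bspec[OF eq y] key[OF y v(1)] key[OF y w(1)] sat\<phi>'[OF u v(1)] sat\<phi>'[OF u w(1)] v(2) w(2)
        by simp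
    qed
    then have "sat C (v @ w) E" using E(2)[OF v(1) w(1)] by blast
    then show ?thesis using eq_class_eq_iff[OF dE v(1) w(1)] v(2) w(2) by simp
  qed
  moreover have "class_of C ?s m' \<in> univ Ceq ?s" using m'(1) by (auto simp: univ_eq_struct)
  moreover have "\<forall>y\<in>tuples Ceq Ys. sat Ceq (y @ [class_of C ?s m']) \<rho> \<longleftrightarrow> sat Ceq (y @ m) \<phi>"
    using key[OF _ m'(1)] m'(2) by blast
  ultimately show ?thesis using s \<rho>(1) by blast
qed

text \<open>Smallness is measured by the home elements needed for representatives, because
  realizations are found in the home sort after parameters have been replaced by
  representatives.\<close>

definition small_eq :: "('a, 'f, 'r) eq_elem set \<Rightarrow> bool" where
  "small_eq B \<longleftrightarrow> (\<exists>D. D \<subseteq> univ C () \<and> |D| <o |univ C ()| \<and> B \<subseteq> eq_set L C D)"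

lemma eq_set_rep:
  assumes "D \<subseteq> univ C ()" and "x \<in> eq_set L C D" and "x \<in> univ Ceq s"
  shows "\<exists>v\<in>H (rep_len s). set v \<subseteq> D \<and> class_of C s v = x"
proof -
  obtain t where t: "x \<in> eq_univ C D t" using assms(2) by (auto simp: eq_set_def)
  have "eq_univ C D t \<subseteq> univ Ceq t" using assms(1)
    by (cases t) (auto simp: eq_struct_def eq_univ_def)
  then have "t = s" using sort_determined assms(3) t by blast
  then show ?thesis using t assms(1)
    by (cases s) (fastforce simp: eq_univ_def intro: bexI[of _ "[_]"])+
qed

lemma eq_set_rep_tuple:
  assumes "D \<subseteq> univ C ()" and "c \<in> tuples Ceq Zs" and "set c \<subseteq> eq_set L C D"
  shows "\<exists>v\<in>H (rep_lens Zs). set v \<subseteq> D \<and> classes C Zs v = c"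
  using assms(2,3)
proof (induction Zs arbitrary: c)
  case (Cons s Zs)
  from Cons.prems(1) obtain x c' where c: "c = x # c'" "x \<in> univ Ceq s" "c' \<in> tuples Ceq Zs"
    by (rule tuples_Cons_split)
  obtain v where v: "v \<in> H (rep_len s)" "set v \<subseteq> D" "class_of C s v = x"
    using eq_set_rep[OF assms(1) _ c(2)] Cons.prems(2) c(1) by auto
  obtain w where w: "w \<in> H (rep_lens Zs)" "set w \<subseteq> D" "classes C Zs w = c'"
    using Cons.IH[OF c(3)] Cons.prems(2) c(1) by auto
  have "v @ w \<in> H (rep_lens (s # Zs))" using v(1) w(1) tuples_length[OF v(1)] by (simp add: tuples_home_add)
  moreover have "classes C (s # Zs) (v @ w) = c" using v(3) w(3) c(1) tuples_length[OF v(1)] by simp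
  ultimately show ?case using v(2) w(2) by (intro bexI[of _ "v @ w"]) auto
qed simp

lemma points_eq_set: "points Leq Ceq = eq_set L C (univ C ())"
  by (simp add: points_def eq_set_def eq_struct_def)

lemma eq_set_mono: "D \<subseteq> D' \<Longrightarrow> eq_set L C D \<subseteq> eq_set L C D'"
  by (fastforce simp: eq_set_def eq_univ_def split: eq_sort.splits)

lemma eq_set_finite_support: "x \<in> points Leq Ceq \<Longrightarrow> \<exists>D. finite D \<and> D \<subseteq> univ C () \<and> x \<in> eq_set L C D"
  unfolding points_eq_set
proof -
  assume "x \<in> eq_set L C (univ C ())"
  then obtain s where s: "s \<in> Sorts Leq" "x \<in> eq_univ C (univ C ()) s" by (auto simp: eq_set_def)
  show ?thesis
  proof (cases s)
    case Home
    then obtain a where "a \<in> univ C ()" "x = Real a" using s(2) by (auto simp: eq_univ_def)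
    then show ?thesis by (intro exI[of _ "{a}"]) (auto simp: eq_set_def eq_univ_def intro!: bexI[of _ Home])
  next
    case (Quot n E)
    then obtain a where a: "x = Imag n E (eq_class C n E a)" "a \<in> H n" "set a \<subseteq> univ C ()"
      using s(2) by (auto simp: eq_univ_def)
    then have "x \<in> eq_univ C (set a) s" using Quot by (auto simp: eq_univ_def)
    then show ?thesis using a(3) s(1) unfolding eq_set_def by (intro exI[of _ "set a"]) blast
  qed
qed

lemma small_eq_Un:
  assumes "small_eq B" and "finite F" and "F \<subseteq> points Leq Ceq"
  shows "small_eq (B \<union> F)"
proof -
  obtain D where D: "D \<subseteq> univ C ()" "|D| <o |univ C ()|" "B \<subseteq> eq_set L C D"
    using assms(1) unfolding small_eq_def by blast
  have "\<forall>x\<in>F. \<exists>D. finite D \<and> D \<subseteq> univ C () \<and> x \<in> eq_set L C D" using eq_set_finite_support assms(3) by blast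
  from bchoice[OF this] obtain d where d: "\<forall>x\<in>F. finite (d x) \<and> d x \<subseteq> univ C () \<and> x \<in> eq_set L C (d x)" ..
  let ?D = "D \<union> (\<Union>x\<in>F. d x)"
  have "finite (\<Union>x\<in>F. d x)" using d assms(2) by blast
  then have "|\<Union>x\<in>F. d x| <o |univ C ()|"
    using finite_ordLess_infinite[OF card_of_Well_order card_of_Well_order, of "\<Union>x\<in>F. d x" "univ C ()"] infinite_univ
    by (simp add: Field_card_of)
  then have "|?D| <o |univ C ()|" by (intro card_of_Un_ordLess_infinite[OF infinite_univ D(2)])
  moreover have "?D \<subseteq> univ C ()" using D(1) d by blast
  moreover have "eq_set L C D \<subseteq> eq_set L C ?D" by (rule eq_set_mono) blast
  moreover have "x \<in> eq_set L C ?D" if "x \<in> F" for x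
  proof -
    have "eq_set L C (d x) \<subseteq> eq_set L C ?D" by (rule eq_set_mono) (use that in blast)
    then show ?thesis using d that by blast
  qed
  ultimately show ?thesis unfolding small_eq_def using D(3) by (intro exI[of _ ?D]) blast
qed

text \<open>Replace every environment by representatives, lay these out as one sequence of home
  elements, and realize the image of the ultrafilter there; the classes of the realization form the
  required family. The translation of formulas carries satisfaction across.\<close>

lemma realize_eq:
  fixes \<Gamma> :: "nat \<Rightarrow> ('f, 'r) eq_sort list"
  assumes "small_eq B" and U: "ultra U" and evE: "eventually (\<lambda>g. g \<in> eq.envs \<Gamma>) U"
    and \<Gamma>: "\<And>i. set (\<Gamma> i) \<subseteq> Sorts Leq"
  shows "\<exists>g\<in>eq.envs \<Gamma>. \<forall>vs Zs \<phi> c. set c \<subseteq> B \<longrightarrow> set Zs \<subseteq> Sorts Leq \<longrightarrow> c \<in> tuples Ceq Zs \<longrightarrow>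
        wff Leq (concat (map \<Gamma> vs) @ Zs) \<phi> \<longrightarrow>
        eventually (\<lambda>g. sat Ceq (concat (map g vs) @ c) \<phi>) U \<longrightarrow> sat Ceq (concat (map g vs) @ c) \<phi>"
proof -
  obtain D where D: "D \<subseteq> univ C ()" "|D| <o |univ C ()|" "B \<subseteq> eq_set L C D"
    using assms(1) unfolding small_eq_def by blast
  obtain a0 where a0: "a0 \<in> univ C ()" using infinite_univ by fastforce
  define r where "r = (\<lambda>g i. SOME u. u \<in> H (rep_lens (\<Gamma> i)) \<and> classes C (\<Gamma> i) u = g i)"
  have r: "r g i \<in> H (rep_lens (\<Gamma> i)) \<and> classes C (\<Gamma> i) (r g i) = g i" if "g \<in> eq.envs \<Gamma>" for g i
  proof -
    have "g i \<in> tuples Ceq (\<Gamma> i)" using that by (simp add: eq.envs_def)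
    from classes_surj[OF this] have "\<exists>u. u \<in> H (rep_lens (\<Gamma> i)) \<and> classes C (\<Gamma> i) u = g i" by blast
    then show ?thesis unfolding r_def by (rule someI_ex)
  qed
  \<comment> \<open>\<open>a0\<close> fills the places beyond the length of a block, which
    \<open>pos\<close> never reads.\<close>
  define flat where "flat = (\<lambda>g n. case prod_decode n of (i, j) \<Rightarrow> if j < rep_lens (\<Gamma> i) then r g i ! j else a0)"
  define pos where "pos = (\<lambda>i. map (\<lambda>j. prod_encode (i, j)) [0..<rep_lens (\<Gamma> i)])"
  have len_pos: "length (pos i) = rep_lens (\<Gamma> i)" for i by (simp add: pos_def)
  have flat_pos: "map (flat g) (pos i) = r g i" if "g \<in> eq.envs \<Gamma>" for g i
  proof -
    have "length (r g i) = rep_lens (\<Gamma> i)" using r[OF that, of i] tuples_length by fastforce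
    then show ?thesis by (intro nth_equalityI) (simp_all add: pos_def flat_def)
  qed
  have flat_univ: "flat g n \<in> univ C ()" if "g \<in> eq.envs \<Gamma>" for g n
  proof -
    obtain i j where n: "prod_decode n = (i, j)" by force
    have "set (r g i) \<subseteq> univ C ()" using r[OF that, of i] set_tuples_home by blast
    moreover have "length (r g i) = rep_lens (\<Gamma> i)" using r[OF that, of i] tuples_length by fastforce
    ultimately show ?thesis using n a0 nth_mem[of j "r g i"] by (auto simp: flat_def)
  qed
  let ?U = "filtermap flat U"
  have evU: "eventually (\<lambda>u. \<forall>i. u i \<in> univ C ()) ?U"
    unfolding eventually_filtermap using evE by eventually_elim (use flat_univ in blast)
  obtain u where u: "\<And>i. u i \<in> univ C ()" "\<And>vs c \<phi>. set c \<subseteq> D \<Longrightarrow> wff L (home_ctx (length vs + length c)) \<phi> \<Longrightarrow>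
      eventually (\<lambda>u'. sat C (map u' vs @ c) \<phi>) ?U \<Longrightarrow> sat C (map u vs @ c) \<phi>"
    by (rule realize_sequence[OF ultra_filtermap[OF U] evU D(1,2)]) blast
  define g where "g = (\<lambda>i. classes C (\<Gamma> i) (map u (pos i)))"
  have "map u (pos i) \<in> H (rep_lens (\<Gamma> i))" for i
    using tuples_home[of "map u (pos i)"] u(1) by (simp add: len_pos image_subset_iff)
  then have gE: "g \<in> eq.envs \<Gamma>" unfolding eq.envs_def g_def using classes_in_tuples by blast
  have conc: "classes C (concat (map \<Gamma> vs)) (concat (map (\<lambda>i. map f (pos i)) vs)) =
      concat (map (\<lambda>i. classes C (\<Gamma> i) (map f (pos i))) vs)" for f vs
  proof (induction vs)
    case (Cons i vs)
    then show ?case using classes_append[of "map f (pos i)" "\<Gamma> i"] len_pos by simp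
  qed simp
  have len_conc: "length (concat (map pos vs)) = rep_lens (concat (map \<Gamma> vs))" for vs
    by (induction vs) (simp_all add: len_pos)
  have map_conc: "map f (concat (map pos vs)) = concat (map (\<lambda>i. map f (pos i)) vs)" for f :: "nat \<Rightarrow> 'a" and vs
    by (induction vs) simp_all
  have "sat Ceq (concat (map g vs) @ c) \<phi>"
    if c: "set c \<subseteq> B" "set Zs \<subseteq> Sorts Leq" "c \<in> tuples Ceq Zs" and \<phi>: "wff Leq (concat (map \<Gamma> vs) @ Zs) \<phi>"
      and ev: "eventually (\<lambda>g. sat Ceq (concat (map g vs) @ c) \<phi>) U" for vs Zs \<phi> c
  proof -
    let ?V = "concat (map \<Gamma> vs)" and ?P = "concat (map pos vs)"
    have "set c \<subseteq> eq_set L C D" using c(1) D(3) by blast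
    from eq_set_rep_tuple[OF D(1) c(3) this] obtain c' where
      c': "c' \<in> H (rep_lens Zs)" "set c' \<subseteq> D" "classes C Zs c' = c" by blast
    have "set (?V @ Zs) \<subseteq> Sorts Leq" using \<Gamma> c(2) by auto
    from translate_fm[OF this \<phi>] obtain \<phi>' where \<phi>': "wff L (home_ctx (rep_lens (?V @ Zs))) \<phi>'"
      "\<forall>u\<in>H (rep_lens (?V @ Zs)). sat C u \<phi>' \<longleftrightarrow> sat Ceq (classes C (?V @ Zs) u) \<phi>" by blast
    have lenc: "length c' = rep_lens Zs" using tuples_length[OF c'(1)] by simp
    have tr: "sat C (map f ?P @ c') \<phi>' \<longleftrightarrow>
        sat Ceq (concat (map (\<lambda>i. classes C (\<Gamma> i) (map f (pos i))) vs) @ c) \<phi>" if f: "\<And>i. f i \<in> univ C ()" for f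
    proof -
      have "map f ?P \<in> H (rep_lens ?V)" using tuples_home[of "map f ?P"] f by (simp add: len_conc image_subset_iff)
      then have "map f ?P @ c' \<in> H (rep_lens (?V @ Zs))" using c'(1) by (simp add: tuples_home_add len_conc)
      then have "sat C (map f ?P @ c') \<phi>' \<longleftrightarrow> sat Ceq (classes C (?V @ Zs) (map f ?P @ c')) \<phi>" using \<phi>'(2) by blast
      also have "classes C (?V @ Zs) (map f ?P @ c') = classes C ?V (map f ?P) @ c"
        using classes_append[of "map f ?P" ?V C Zs c'] c'(3) len_conc[of vs] by simp
      also have "classes C ?V (map f ?P) = concat (map (\<lambda>i. classes C (\<Gamma> i) (map f (pos i))) vs)"
        unfolding map_conc by (rule conc)
      finally show ?thesis .
    qed
    have "eventually (\<lambda>u'. sat C (map u' ?P @ c') \<phi>') ?U"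
      unfolding eventually_filtermap using ev evE
    proof eventually_elim
      case (elim g')
      have "(\<lambda>i. classes C (\<Gamma> i) (map (flat g') (pos i))) = g'" using flat_pos[OF elim(2)] r[OF elim(2)] by auto
      then show ?case using tr[of "flat g'"] flat_univ[OF elim(2)] elim(1) by simp
    qed
    moreover have "wff L (home_ctx (length ?P + length c')) \<phi>'" using \<phi>'(1) by (simp add: len_conc lenc)
    ultimately have "sat C (map u ?P @ c') \<phi>'" using u(2)[OF c'(2)] by blast
    then show ?thesis using tr[of u] u(1) unfolding g_def by blast
  qed
  then show ?thesis using gE by blast
qed

lemma small_eq_empty: "small_eq {}"
proof -
  have "|{} :: 'a set| <o |univ C ()|"
    using finite_ordLess_infinite[OF card_of_Well_order card_of_Well_order, of "{}" "univ C ()"] infinite_univ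
    by (simp add: Field_card_of)
  then show ?thesis unfolding small_eq_def by blast
qed

sublocale eq: rich Leq Ceq small_eq
  by unfold_locales (fact small_eq_empty small_eq_Un realize_eq code_exists)+

end


section \<open>Transfer of stability and simplicity to the imaginaries\<close>

context monster_eq
begin

lemma translate_split_fm:
  assumes "set (Xs @ Ys) \<subseteq> Sorts Leq" and "wff Leq (Xs @ Ys) \<phi>"
  obtains \<phi>' where "wff L (home_ctx (rep_lens Xs) @ home_ctx (rep_lens Ys)) \<phi>'"
    and "\<And>u v. u \<in> H (rep_lens Xs) \<Longrightarrow> v \<in> H (rep_lens Ys) \<Longrightarrow>
      sat C (u @ v) \<phi>' \<longleftrightarrow> sat Ceq (classes C Xs u @ classes C Ys v) \<phi>"
proof -
  obtain \<phi>' where \<phi>': "wff L (home_ctx (rep_lens (Xs @ Ys))) \<phi>'"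
    "\<forall>u\<in>H (rep_lens (Xs @ Ys)). sat C u \<phi>' \<longleftrightarrow> sat Ceq (classes C (Xs @ Ys) u) \<phi>"
    using translate_fm[OF assms] by blast
  show thesis
  proof (rule that[of \<phi>'])
    show "wff L (home_ctx (rep_lens Xs) @ home_ctx (rep_lens Ys)) \<phi>'" using \<phi>'(1) by (simp add: replicate_add)
    fix u v assume u: "u \<in> H (rep_lens Xs)" and v: "v \<in> H (rep_lens Ys)"
    have len: "length u = rep_lens Xs" using tuples_length[OF u] by simp
    then have "u @ v \<in> H (rep_lens (Xs @ Ys))" using u v by (simp add: tuples_home_add)
    then show "sat C (u @ v) \<phi>' \<longleftrightarrow> sat Ceq (classes C Xs u @ classes C Ys v) \<phi>"
      using \<phi>'(2) classes_append[OF len, of C Ys v] by simp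
  qed
qed

lemma choose_reps:
  assumes "\<And>i. a i \<in> tuples Ceq \<Gamma>"
  obtains a' where "\<And>i. a' i \<in> H (rep_lens \<Gamma>)" and "\<And>i. classes C \<Gamma> (a' i) = a i"
  using classes_surj[OF assms] by metis

lemma stable_eq:
  assumes "stable_theory L C"
  shows "stable_theory Leq Ceq"
  unfolding stable_theory_def
proof (intro allI impI)
  fix Xs Ys \<phi> assume \<phi>: "set (Xs @ Ys) \<subseteq> Sorts Leq \<and> wff Leq (Xs @ Ys) \<phi>"
  obtain \<phi>' where \<phi>': "wff L (home_ctx (rep_lens Xs) @ home_ctx (rep_lens Ys)) \<phi>'"
    "\<And>u v. u \<in> H (rep_lens Xs) \<Longrightarrow> v \<in> H (rep_lens Ys) \<Longrightarrow>
      sat C (u @ v) \<phi>' \<longleftrightarrow> sat Ceq (classes C Xs u @ classes C Ys v) \<phi>"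
    by (rule translate_split_fm[of Xs Ys \<phi>]) (use \<phi> in blast)+
  have stable: "stable_formula C (home_ctx (rep_lens Xs)) (home_ctx (rep_lens Ys)) \<phi>'"
    using assms \<phi>'(1) sorts unfolding stable_theory_def by simp
  show "stable_formula Ceq Xs Ys \<phi>" unfolding stable_formula_def
  proof (intro notI, elim exE conjE)
    fix a b assume ab: "\<forall>i. a i \<in> tuples Ceq Xs" "\<forall>i. b i \<in> tuples Ceq Ys"
      and ladder: "\<forall>i j::nat. sat Ceq (a i @ b j) \<phi> \<longleftrightarrow> i < j"
    obtain a' where a': "\<And>i. a' i \<in> H (rep_lens Xs)" "\<And>i. classes C Xs (a' i) = a i"
      by (rule choose_reps[of a Xs]) (use ab(1) in blast)+
    obtain b' where b': "\<And>i. b' i \<in> H (rep_lens Ys)" "\<And>i. classes C Ys (b' i) = b i"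
      by (rule choose_reps[of b Ys]) (use ab(2) in blast)+
    have "sat C (a' i @ b' j) \<phi>' \<longleftrightarrow> i < j" for i j
      using \<phi>'(2)[OF a'(1) b'(1)] ladder a'(2) b'(2) by simp
    then have "\<not> stable_formula C (home_ctx (rep_lens Xs)) (home_ctx (rep_lens Ys)) \<phi>'"
      unfolding stable_formula_def not_not using a'(1) b'(1) by (intro exI[of _ a'] exI[of _ b'] conjI allI)
    then show False using stable by blast
  qed
qed

text \<open>Inconsistency of siblings pulls back because the classes of a home solution are a
  solution; consistency of paths pulls back because every solution has representatives.\<close>

lemma simple_eq:
  assumes "simple_theory L C"
  shows "simple_theory Leq Ceq"
  unfolding simple_theory_def
proof (intro allI impI notI)
  fix Xs Ys \<phi> assume \<phi>: "set (Xs @ Ys) \<subseteq> Sorts Leq \<and> wff Leq (Xs @ Ys) \<phi>"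
    and tree: "tree_property Ceq Xs Ys \<phi>"
  obtain \<phi>' where \<phi>': "wff L (home_ctx (rep_lens Xs) @ home_ctx (rep_lens Ys)) \<phi>'"
    "\<And>u v. u \<in> H (rep_lens Xs) \<Longrightarrow> v \<in> H (rep_lens Ys) \<Longrightarrow>
      sat C (u @ v) \<phi>' \<longleftrightarrow> sat Ceq (classes C Xs u @ classes C Ys v) \<phi>"
    by (rule translate_split_fm[of Xs Ys \<phi>]) (use \<phi> in blast)+
  obtain b k where b: "\<forall>\<sigma>::nat list. b \<sigma> \<in> tuples Ceq Ys"
    and sib: "\<forall>\<sigma> I. finite I \<and> card I = k \<longrightarrow> sols Ceq Xs {(\<phi>, b (\<sigma> @ [i])) | i. i \<in> I} = {}"
    and path: "\<forall>\<eta> :: nat \<Rightarrow> nat. consistent Ceq Xs {(\<phi>, b (map \<eta> [0..<n])) | n. n \<ge> 1}"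
    using tree unfolding tree_property_def by (elim exE conjE)
  obtain b' where b': "\<And>\<sigma>. b' \<sigma> \<in> H (rep_lens Ys)" "\<And>\<sigma>. classes C Ys (b' \<sigma>) = b \<sigma>"
    by (rule choose_reps[of b Ys]) (use b in blast)+
  have sat': "sat C (u @ b' \<sigma>) \<phi>' \<longleftrightarrow> sat Ceq (classes C Xs u @ b \<sigma>) \<phi>" if "u \<in> H (rep_lens Xs)" for u \<sigma>
    using \<phi>'(2)[OF that b'(1)] b'(2) by simp
  have "tree_property C (home_ctx (rep_lens Xs)) (home_ctx (rep_lens Ys)) \<phi>'" unfolding tree_property_def
  proof (intro exI[of _ b'] exI[of _ k] conjI allI impI)
    show "b' \<sigma> \<in> H (rep_lens Ys)" for \<sigma> by (rule b'(1))
    fix \<sigma> and I :: "nat set" assume I: "finite I \<and> card I = k"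
    have "classes C Xs u \<in> sols Ceq Xs {(\<phi>, b (\<sigma> @ [i])) | i. i \<in> I}"
      if "u \<in> sols C (home_ctx (rep_lens Xs)) {(\<phi>', b' (\<sigma> @ [i])) | i. i \<in> I}" for u
    proof -
      have u: "u \<in> H (rep_lens Xs)" "\<And>i. i \<in> I \<Longrightarrow> sat C (u @ b' (\<sigma> @ [i])) \<phi>'" using that by (auto simp: sols_def)
      then show ?thesis using classes_in_tuples[OF u(1)] sat'[OF u(1)] by (auto simp: sols_def)
    qed
    then show "sols C (home_ctx (rep_lens Xs)) {(\<phi>', b' (\<sigma> @ [i])) | i. i \<in> I} = {}" using sib I by blast
  next
    fix \<eta> :: "nat \<Rightarrow> nat"
    let ?p = "\<lambda>n. (\<phi>, b (map \<eta> [0..<n]))" and ?p' = "\<lambda>n. (\<phi>', b' (map \<eta> [0..<n]))"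
    show "consistent C (home_ctx (rep_lens Xs)) {?p' n |n. 1 \<le> n}" unfolding consistent_def
    proof (intro allI impI, elim conjE)
      fix F assume F: "finite F" "F \<subseteq> {?p' n |n. 1 \<le> n}"
      then have "F \<subseteq> ?p' ` {1..}" by auto
      then obtain B where B: "B \<subseteq> {1..}" "finite B" "F = ?p' ` B" by (meson F(1) finite_subset_image)
      have "finite (?p ` B)" "?p ` B \<subseteq> {?p n |n. 1 \<le> n}" using B(1,2) by auto
      then have "sols Ceq Xs (?p ` B) \<noteq> {}" using path unfolding consistent_def by blast
      then obtain x where x: "x \<in> tuples Ceq Xs" "\<And>n. n \<in> B \<Longrightarrow> sat Ceq (x @ b (map \<eta> [0..<n])) \<phi>"
        by (auto simp: sols_def)
      obtain u where u: "u \<in> H (rep_lens Xs)" "classes C Xs u = x" using classes_surj[OF x(1)] by blast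
      have "u \<in> sols C (home_ctx (rep_lens Xs)) F" unfolding B(3) sols_def
        using u x(2) sat'[OF u(1)] by auto
      then show "sols C (home_ctx (rep_lens Xs)) F \<noteq> {}" by blast
    qed
  qed
  moreover have "\<not> tree_property C (home_ctx (rep_lens Xs)) (home_ctx (rep_lens Ys)) \<phi>'"
    using assms \<phi>'(1) sorts unfolding simple_theory_def by simp
  ultimately show False by blast
qed

end

section \<open>The number of imaginaries\<close>

lemma card_of_lists_infinite:
  assumes "infinite A"
  shows "|lists A| \<le>o |A|"
proof -
  have inf: "infinite (Field |A| )" using assms by (simp add: Field_card_of)
  have step: "|{xs \<in> lists A. length xs = n}| \<le>o |A|" for n
  proof (induction n)
    case 0
    have "{xs \<in> lists A. length xs = 0} = {[]}" by auto
    then show ?case using assms card_of_singl_ordLeq[of A "[]"] by (metis finite.emptyI)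
  next
    case (Suc n)
    have "{xs \<in> lists A. length xs = Suc n} = (\<lambda>(x, xs). x # xs) ` (A \<times> {xs \<in> lists A. length xs = n})"
      by (force simp: length_Suc_conv image_iff)
    moreover have "|A \<times> {xs \<in> lists A. length xs = n}| \<le>o |A|"
      by (rule card_of_Times_ordLeq_infinite_Field[OF inf ordLeq_refl[OF card_of_Card_order] Suc card_of_Card_order])
    ultimately show ?case using ordLeq_transitive[OF card_of_image] by simp
  qed
  have "|UNIV :: nat set| \<le>o |A|" using assms infinite_iff_card_of_nat by blast
  then have "|\<Union>n\<in>UNIV. {xs \<in> lists A. length xs = n}| \<le>o |A|"
    by (intro card_of_UNION_ordLeq_infinite_Field[OF inf card_of_Card_order]) (use step in auto)
  moreover have "(\<Union>n\<in>UNIV. {xs \<in> lists A. length xs = n}) = lists A" by auto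
  ultimately show ?thesis by simp
qed

text \<open>A prefix code, so that concatenations decode uniquely. The number of arguments is stored
  because raw terms may apply a symbol to any number of them.\<close>

primrec enc_tm :: "'f tm \<Rightarrow> (nat + 'f + 'r) list" where
  "enc_tm (Var i) = [Inl 0, Inl i]"
| "enc_tm (App f ts) = [Inl 1, Inr (Inl f), Inl (length ts)] @ concat (map enc_tm ts)"

primrec enc_fm :: "(unit, 'f, 'r) fm \<Rightarrow> (nat + 'f + 'r) list" where
  "enc_fm (Eql t u) = Inl 0 # enc_tm t @ enc_tm u"
| "enc_fm (Pred r ts) = [Inl 1, Inr (Inr r), Inl (length ts)] @ concat (map enc_tm ts)"
| "enc_fm (Neg \<phi>) = Inl 2 # enc_fm \<phi>"
| "enc_fm (And \<phi> \<psi>) = Inl 3 # enc_fm \<phi> @ enc_fm \<psi>"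
| "enc_fm (Exists s \<phi>) = Inl 4 # enc_fm \<phi>"

lemma concat_prefix_code:
  assumes "\<And>t t' xs ys. t \<in> set ts \<Longrightarrow> f t @ xs = f t' @ ys \<Longrightarrow> t = t' \<and> xs = ys"
    and "length ts = length ts'" and "concat (map f ts) @ xs = concat (map f ts') @ ys"
  shows "ts = ts' \<and> xs = ys"
  using assms(2,1,3)
proof (induction ts ts' rule: list_induct2)
  case (Cons t ts t' ts')
  have "t = t' \<and> concat (map f ts) @ xs = concat (map f ts') @ ys"
    by (rule Cons.prems(1)) (use Cons.prems(2) in simp_all)
  then show ?case using Cons.IH Cons.prems(1) by (metis list.set_intros(2))
qed simp

lemma enc_tm_prefix: "enc_tm t @ xs = enc_tm t' @ ys \<Longrightarrow> t = t' \<and> xs = ys"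
proof (induction t arbitrary: t' xs ys)
  case (Var i)
  then show ?case by (cases t') auto
next
  case (App f ts)
  then obtain ts' where t': "t' = App f ts'" "length ts = length ts'"
      "concat (map enc_tm ts) @ xs = concat (map enc_tm ts') @ ys"
    by (cases t') auto
  have "ts = ts' \<and> xs = ys" by (rule concat_prefix_code[OF _ t'(2,3)]) (rule App.IH)
  then show ?case using t'(1) by simp
qed

lemma enc_fm_prefix: "enc_fm \<phi> @ xs = enc_fm \<psi> @ ys \<Longrightarrow> \<phi> = \<psi> \<and> xs = ys"
proof (induction \<phi> arbitrary: \<psi> xs ys)
  case (Eql t u)
  note prem = Eql.prems
  show ?case
  proof (cases \<psi>)
    case (Eql t' u')
    then have "enc_tm t @ (enc_tm u @ xs) = enc_tm t' @ (enc_tm u' @ ys)" using prem by simp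
    then have "t = t'" and "enc_tm u @ xs = enc_tm u' @ ys" using enc_tm_prefix by blast+
    from this(1) enc_tm_prefix[OF this(2)] show ?thesis using Eql by simp
  qed (use prem in simp_all)
next
  case (Pred r ts)
  note prem = Pred.prems
  show ?case
  proof (cases \<psi>)
    case (Pred r' ts')
    then have ts': "r = r'" "length ts = length ts'"
        "concat (map enc_tm ts) @ xs = concat (map enc_tm ts') @ ys" using prem by simp_all
    have "ts = ts' \<and> xs = ys" by (rule concat_prefix_code[OF _ ts'(2,3)]) (rule enc_tm_prefix)
    then show ?thesis using Pred ts'(1) by simp
  qed (use prem in simp_all)
next
  case (Neg \<phi>)
  note prem = Neg.prems and IH = Neg.IH
  show ?case
  proof (cases \<psi>)
    case (Neg \<phi>')
    then have "enc_fm \<phi> @ xs = enc_fm \<phi>' @ ys" using prem by simp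
    from IH[OF this] show ?thesis using Neg by simp
  qed (use prem in simp_all)
next
  case (And \<phi>1 \<phi>2)
  note prem = And.prems and IH = And.IH
  show ?case
  proof (cases \<psi>)
    case (And \<psi>1 \<psi>2)
    then have "enc_fm \<phi>1 @ (enc_fm \<phi>2 @ xs) = enc_fm \<psi>1 @ (enc_fm \<psi>2 @ ys)" using prem by simp
    from IH(1)[OF this] have "\<phi>1 = \<psi>1" and "enc_fm \<phi>2 @ xs = enc_fm \<psi>2 @ ys" by blast+
    from this(1) IH(2)[OF this(2)] show ?thesis using And by simp
  qed (use prem in simp_all)
next
  case (Exists s \<phi>)
  note prem = Exists.prems and IH = Exists.IH
  show ?case
  proof (cases \<psi>)
    case (Exists s' \<phi>')
    then have "enc_fm \<phi> @ xs = enc_fm \<phi>' @ ys" using prem by simp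
    from IH[OF this] show ?thesis using Exists by simp
  qed (use prem in simp_all)
qed

lemma enc_tm_symbols: "has_sort L \<Gamma> t s \<Longrightarrow> set (enc_tm t) \<subseteq> UNIV <+> (Funs L <+> R)"
proof (induction rule: has_sort.induct)
  case (App f ts)
  from App(2) have "\<forall>t\<in>set ts. set (enc_tm t) \<subseteq> UNIV <+> (Funs L <+> R)"
    by (induction rule: list_all2_induct) auto
  then show ?case using App(1) by auto
qed auto

text \<open>Only well-formed formulas can be counted by the size of the language: the types of
  symbols may be much larger than the sets of symbols of \<open>L\<close>.\<close>

lemma enc_fm_symbols: "wff L \<Gamma> \<phi> \<Longrightarrow> set (enc_fm \<phi>) \<subseteq> UNIV <+> (Funs L <+> Rels L)"
proof (induction \<phi> arbitrary: \<Gamma>)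
  case (Eql t u)
  then obtain s where "has_sort L \<Gamma> t s" "has_sort L \<Gamma> u s" by auto
  from this[THEN enc_tm_symbols[where R = "Rels L"]] show ?case by auto
next
  case (Pred r ts)
  then have "list_all2 (has_sort L \<Gamma>) ts (rel_dom L r)" by simp
  then have "\<forall>t\<in>set ts. \<exists>s. has_sort L \<Gamma> t s" by (induction rule: list_all2_induct) auto
  then have "\<forall>t\<in>set ts. set (enc_tm t) \<subseteq> UNIV <+> (Funs L <+> Rels L)" using enc_tm_symbols[of L \<Gamma> _ _ "Rels L"] by blast
  then show ?case using Pred by auto
next
  case (Neg \<phi>)
  then show ?case using Neg.IH[of \<Gamma>] by auto
next
  case (And \<phi> \<psi>)
  then show ?case using And.IH(1)[of \<Gamma>] And.IH(2)[of \<Gamma>] by auto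
next
  case (Exists s \<phi>)
  then show ?case using Exists.IH[of "s # \<Gamma>"] by auto
qed

context monster_eq
begin

text \<open>An imaginary over \<open>D\<close> is determined by a number, a formula and a list from
  \<open>D\<close>, so the cardinality of the language enters beside that of
  \<open>D\<close>.\<close>

lemma card_eq_set:
  assumes lang: "|Funs L <+> Rels L| <o |univ C ()|" and "D \<subseteq> univ C ()" and D: "|D| <o |univ C ()|"
  shows "|eq_set L C D| <o |univ C ()|"
proof -
  let ?K = "(UNIV :: nat set) <+> (Funs L <+> Rels L)"
  \<comment> \<open>One infinite set below the monster model that bounds all pieces. Estimating
    every union against it, and not against the monster model, avoids any appeal to
    regularity.\<close>
  let ?Z = "?K <+> D"
  have "|UNIV :: nat set| <o |univ C ()|" using uncountable points_univ by simp
  then have "|?K| <o |univ C ()|" by (rule card_of_Plus_ordLess_infinite[OF infinite_univ _ lang])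
  then have Z: "|?Z| <o |univ C ()|" by (rule card_of_Plus_ordLess_infinite[OF infinite_univ _ D])
  have infK: "infinite ?K" by (simp add: finite_Plus_iff)
  then have infZ: "infinite ?Z" by (simp add: finite_Plus_iff)
  then have inf: "infinite (Field |?Z| )" by (simp add: Field_card_of)
  have KZ: "|?K| \<le>o |?Z|" by (rule card_of_Plus1)
  have DZ: "|D| \<le>o |?Z|" by (rule card_of_Plus2)
  let ?W = "{E. \<exists>n. definable_equiv L C n E}"
  have "|?W| \<le>o |lists ?K|"
  proof (rule card_of_ordLeqI[of enc_fm])
    show "inj_on enc_fm ?W" using enc_fm_prefix[of _ "[]" _ "[]"] by (auto simp: inj_on_def)
    fix E assume "E \<in> ?W"
    then obtain n where "wff L (home_ctx n @ home_ctx n) E" by (auto simp: definable_equiv_def)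
    from enc_fm_symbols[OF this] show "enc_fm E \<in> lists ?K" by (simp add: lists_eq_set)
  qed
  then have WZ: "|?W| \<le>o |?Z|"
    by (rule ordLeq_transitive[OF _ ordLeq_transitive[OF card_of_lists_infinite[OF infK] KZ]])
  have "|lists D| \<le>o |lists ?Z|"
  proof (rule card_of_ordLeqI[of "map Inr"])
    show "inj_on (map Inr) (lists D)" by (auto intro: inj_on_mapI simp: inj_on_def)
  qed auto
  then have LZ: "|lists D| \<le>o |?Z|" by (rule ordLeq_transitive[OF _ card_of_lists_infinite[OF infZ]])
  have NZ: "|UNIV :: nat set| \<le>o |?Z|" using infZ infinite_iff_card_of_nat by blast
  let ?I = "\<lambda>n E. (\<lambda>a. Imag n E (eq_class C n E a)) ` lists D"
  have "eq_set L C D \<subseteq> Real ` D \<union> (\<Union>n\<in>UNIV. \<Union>E\<in>?W. ?I n E)"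
  proof
    fix x assume "x \<in> eq_set L C D"
    then obtain s where s: "s \<in> Sorts Leq" "x \<in> eq_univ C D s" by (auto simp: eq_set_def)
    show "x \<in> Real ` D \<union> (\<Union>n\<in>UNIV. \<Union>E\<in>?W. ?I n E)"
    proof (cases s)
      case Home
      then show ?thesis using s(2) by (simp add: eq_univ_def)
    next
      case (Quot n E)
      then obtain a where "x = Imag n E (eq_class C n E a)" "set a \<subseteq> D"
        using s(2) by (auto simp: eq_univ_def)
      then have "x \<in> ?I n E" by (auto simp: lists_eq_set)
      moreover have "E \<in> ?W" using s(1) Quot by auto
      ultimately show ?thesis by blast
    qed
  qed
  moreover have "|Real ` D \<union> (\<Union>n\<in>UNIV. \<Union>E\<in>?W. ?I n E)| \<le>o |?Z|"
  proof (rule card_of_Un_ordLeq_infinite_Field[OF inf _ _ card_of_Card_order])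
    show "|Real ` D :: ('a, 'f, 'r) eq_elem set| \<le>o |?Z|" by (rule ordLeq_transitive[OF card_of_image DZ])
    have "|?I n E| \<le>o |?Z|" for n E by (rule ordLeq_transitive[OF card_of_image LZ])
    then have "|\<Union>E\<in>?W. ?I n E| \<le>o |?Z|" for n
      by (intro card_of_UNION_ordLeq_infinite_Field[OF inf card_of_Card_order WZ]) blast
    then show "|\<Union>n\<in>UNIV. \<Union>E\<in>?W. ?I n E| \<le>o |?Z|"
      by (intro card_of_UNION_ordLeq_infinite_Field[OF inf card_of_Card_order NZ]) blast
  qed
  ultimately have "|eq_set L C D| \<le>o |?Z|" using ordLeq_transitive[OF card_of_mono1] by blast
  then show ?thesis using Z by (rule ordLeq_ordLess_trans)
qed

text \<open>Strong stable forking speaks of sets that are \<open>small\<close> by their cardinality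
  in the expansion, whereas realizations rest on \<open>small_eq\<close>; this links the
  two.\<close>

lemma small_eq_set:
  assumes "|Funs L <+> Rels L| <o |univ C ()|" and "D \<subseteq> univ C ()" and "|D| <o |univ C ()|"
    and "A \<subseteq> eq_set L C D"
  shows "small Leq Ceq A"
proof -
  have "Real ` univ C () \<subseteq> points Leq Ceq"
    unfolding points_eq_set by (auto simp: eq_set_def eq_univ_def intro!: bexI[of _ Home])
  then have "|univ C ()| \<le>o |points Leq Ceq|"
    by (intro card_of_ordLeqI[of Real]) (auto simp: inj_on_def)
  moreover have "|A| <o |univ C ()|"
    using card_of_mono1[OF assms(4)] card_eq_set[OF assms(1-3)] by (rule ordLeq_ordLess_trans)
  moreover have "A \<subseteq> points Leq Ceq"
    unfolding points_eq_set using assms(4) eq_set_mono[OF assms(2)] by blast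
  ultimately show ?thesis unfolding small_def using ordLess_ordLeq_trans by blast
qed

end

theorem corollary5p1p3:
  fixes L :: "(unit, 'f, 'r) signature"
    and T :: "(unit, 'f, 'r) fm set"
    and C :: "(unit, 'f, 'r, 'a) struct"
    and M :: "'a set"
    and A :: "('a, 'f, 'r) eq_elem set"
    and Xs :: "('f, 'r) eq_sort list"
    and p q :: "(('f, 'r) eq_sort, ('f, 'r) eq_fun, 'r, ('a, 'f, 'r) eq_elem) inst set"
  assumes "complete_theory L T"
    and "monster_model L T C"
    and "stable_theory L C \<or>
         simple_theory L C \<and> strong_stable_forking (eq_sig L C) (eq_struct C)"
    and "elementary_submodel L C M" and "small L C M"
    and "A \<subseteq> eq_set L C M"
    and "set Xs \<subseteq> Sorts (eq_sig L C)"
    and "q \<in> complete_types (eq_sig L C) (eq_struct C) Xs (eq_set L C M)"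
    and "p = restrict_type q A"
  shows "nonforking_extension (eq_sig L C) (eq_struct C) Xs A p q \<longleftrightarrow>
         non_thorn_forking_extension (eq_sig L C) (eq_struct C) Xs A p q"
proof -
  have monster: "is_signature L" "Sorts L = UNIV" "models L C T" "saturated L C"
    "|UNIV :: nat set| <o |points L C|" "|Funs L <+> Rels L| <o |points L C|"
    using assms(2) unfolding monster_model_def by blast+
  interpret monster_eq L C
    by unfold_locales (use monster in \<open>auto simp: models_def\<close>)
  let ?B = "eq_set L C M"
  have lang: "|Funs L <+> Rels L| <o |univ C ()|" using monster(6) points_univ by simp
  have M: "M \<subseteq> univ C ()" "|M| <o |univ C ()|" using assms(5) points_univ by (simp_all add: small_def)
  have good: "small_eq A" "small_eq ?B" using M assms(6) unfolding small_eq_def by blast+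
  have small: "small Leq Ceq A" "small Leq Ceq ?B"
    using small_eq_set[OF lang M] assms(6) by blast+
  have "forks Leq Ceq Xs A q \<Longrightarrow> thorn_forks Leq Ceq Xs A q"
  proof (cases "stable_theory L C")
    case True
    assume "forks Leq Ceq Xs A q"
    then show ?thesis
      using eq.stable_forks_imp_thorn_forks[OF stable_eq[OF True] assms(7) good assms(8)] by blast
  next
    case False
    assume forks: "forks Leq Ceq Xs A q"
    have simple: "simple_theory Leq Ceq" and ssf: "strong_stable_forking Leq Ceq"
      using False assms(3) simple_eq by blast+
    obtain \<phi> b Ys where \<phi>: "(\<phi>, b) \<in> q" "set Ys \<subseteq> Sorts Leq" "b \<in> tuples Ceq Ys" "wff Leq (Xs @ Ys) \<phi>"
      "stable_formula Ceq Xs Ys \<phi>" "forks Leq Ceq Xs A {(\<phi>, b)}"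
    proof -
      have "\<exists>(\<phi>, b)\<in>q. \<exists>Ys. set Ys \<subseteq> Sorts Leq \<and> b \<in> tuples Ceq Ys \<and> wff Leq (Xs @ Ys) \<phi> \<and>
           stable_formula Ceq Xs Ys \<phi> \<and> forks Leq Ceq Xs A {(\<phi>, b)}"
        using ssf[unfolded strong_stable_forking_def] assms(7,8) small forks by blast
      then show thesis using that by auto
    qed
    \<comment> \<open>Two distinct home elements, needed as equality tags when the dividing formulas
      are merged into one.\<close>
    obtain u v where uv: "u \<in> univ C ()" "v \<in> univ C ()" "u \<noteq> v"
    proof -
      obtain u where "u \<in> univ C ()" using infinite_univ by fastforce
      moreover obtain v where "v \<in> univ C () - {u}" 
        using infinite_imp_nonempty[OF infinite_remove[OF infinite_univ, of u]] by blast
      ultimately show thesis using that by blast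
    qed
    have two: "Home \<in> Sorts Leq" "Real u \<in> univ Ceq Home" "Real v \<in> univ Ceq Home" "Real u \<noteq> (Real v :: ('a, 'f, 'r) eq_elem)"
      using uv by (simp_all add: eq_struct_def eq_univ_def)
    show ?thesis
    proof (rule ccontr)
      assume "\<not> thorn_forks Leq Ceq Xs A q"
      then obtain U where U: "ultra U" "eventually (\<lambda>x. x \<in> tuples Ceq Xs) U"
        and qU: "\<And>\<phi> b. (\<phi>, b) \<in> q \<Longrightarrow> eventually (\<lambda>x. sat Ceq (x @ b) \<phi>) U"
        and nothorn: "\<And>\<psi>. thorn_divides Leq Ceq Xs A \<psi> \<Longrightarrow> \<not> eventually (\<lambda>x. x \<in> sols Ceq Xs {\<psi>}) U"
        by (rule eq.thorn_nonforking_ultrafilter[OF assms(8)]) blast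
      show False
        by (rule eq.simple_stable_nonforking[OF simple assms(7) good(1) \<phi>(5,4,2,3,6) U qU[OF \<phi>(1)] nothorn two])
    qed
  qed
  moreover have "thorn_forks Leq Ceq Xs A q \<Longrightarrow> forks Leq Ceq Xs A q"
    by (rule eq.thorn_forks_imp_forks[OF good(1)])
  moreover have "p \<subseteq> q" using assms(9) by (auto simp: restrict_type_def)
  ultimately show ?thesis
    unfolding nonforking_extension_def non_thorn_forking_extension_def by blast
qed

end
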